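(* Let $k\ge3$, $\alpha\in(0,1)$, and let $B\subset C^{k,\alpha}_0(\mathbb{T}^2)$ be bounded. Then $$\mathcal H_\varepsilon(\rho)=\mathcal H_0(\rho)+\varepsilon\mathcal H_1(\rho)+O_B(\varepsilon^2)\quad\text{in }C^1(B),$$ where $$\mathcal H_0(\rho)=\frac12\int_{\mathbb{T}^2}|\nabla\phi|^2\,dx,\qquad \mathcal H_1(\rho)=\frac13\int_{\mathbb{T}^2}\phi\det D^2\phi\,dx,\qquad \Delta\phi=\rho.$$ Moreover $$\frac{\delta\mathcal H_0}{\delta\rho}=-\phi,\qquad \frac{\delta\mathcal H_1}{\delta\rho}=-\chi,\qquad \Delta\chi=-\det D^2\phi.$$ Consequently the semigeostrophic vector field expands as $$-\{\psi_\varepsilon[\rho],\rho\}=-\{\phi,\rho\}-\varepsilon\{\chi,\rho\}+O_B(\varepsilon^2).$$ Equivalently, the first modified equation is $$\partial_t\rho+\{\phi,\rho\}+\varepsilon\{\chi,\rho\}=O(\varepsilon^2),\qquad \Delta\phi=\rho,\qquad \Delta\chi=-\det D^2\phi.$$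
   Context: $\mathbb{T}^2=\mathbb{R}^2/\mathbb{Z}^2$ with unit volume; $C^{k,\alpha}_0(\mathbb{T}^2)$ is the space of mean-zero $C^{k,\alpha}$ functions; $\nabla^\perp f=(-\partial_2f,\partial_1f)$ and $\{f,g\}=\nabla^\perp f\cdot\nabla g$. The functions $\phi$ and $\chi$ are normalized to have zero mean. For $\rho\in B$ and $\varepsilon$ sufficiently small depending on $B$, $\psi_\varepsilon[\rho]$ is the mean-zero solution of $\Delta\psi_\varepsilon+\varepsilon\det D^2\psi_\varepsilon=\rho$, equivalently $\det(I+\varepsilon D^2\psi_\varepsilon)=1+\varepsilon\rho$. The (scaled) semigeostrophic equation is $\partial_t\rho+\{\psi_\varepsilon[\rho],\rho\}=0$. The functional $\mathcal H_\varepsilon$ is $\mathcal H_\varepsilon(\rho)=\frac{1}{2\varepsilon^2}W_2^2((1+\varepsilon\rho)dx,dx)=\frac12\int_{\mathbb{T}^2}(1+\varepsilon\rho)|\nabla\psi_\varepsilon[\rho]|^2dx$, with $W_2$ the quadratic Wasserstein distance for the flat-torus distance. The subscript in $O_B(\varepsilon^2)$ indicates that the bound depends on the bounded set $B$; "in $C^1(B)$" means that the expansion holds for the functional and for its first derivative in $\rho$. The functional derivative $\delta F/\delta\rho$ is defined by $DF(\rho)[h]=\int_{\mathbb{T}^2}\frac{\delta F}{\delta\rho}h\,dx$ for mean-zero perturbations $h$. *)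

theory Defs
  imports "HOL-Analysis.Analysis"
begin

section \<open>Functions on the flat torus\<close>

text \<open>Functions on the torus are \<open>\<int>\<^sup>2\<close>-periodic functions on \<open>\<real>\<^sup>2\<close>; points and
  measures live on the fundamental domain \<open>[0,1)\<^sup>2\<close>.\<close>

definition int_lattice :: "(real^2) set" where
  "int_lattice = {n. \<forall>i. n $ i \<in> \<int>}"

definition periodic :: "(real^2 \<Rightarrow> real) \<Rightarrow> bool" where
  "periodic f \<longleftrightarrow> (\<forall>x. \<forall>n\<in>int_lattice. f (x + n) = f x)"

definition torus :: "(real^2) measure" where
  "torus = restrict_space lborel {x. \<forall>i. 0 \<le> x $ i \<and> x $ i < 1}"

definition mean_zero :: "(real^2 \<Rightarrow> real) \<Rightarrow> bool" where
  "mean_zero f \<longleftrightarrow> (LINT x|torus. f x) = 0"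

section \<open>Differential operators\<close>

definition pd :: "2 \<Rightarrow> (real^2 \<Rightarrow> real) \<Rightarrow> real^2 \<Rightarrow> real" where
  "pd i f x = frechet_derivative f (at x) (axis i 1)"

definition grad :: "(real^2 \<Rightarrow> real) \<Rightarrow> real^2 \<Rightarrow> real^2" where
  "grad f x = vector [pd 1 f x, pd 2 f x]"

definition grad_perp :: "(real^2 \<Rightarrow> real) \<Rightarrow> real^2 \<Rightarrow> real^2" where
  "grad_perp f x = vector [- pd 2 f x, pd 1 f x]"

definition bracket :: "(real^2 \<Rightarrow> real) \<Rightarrow> (real^2 \<Rightarrow> real) \<Rightarrow> real^2 \<Rightarrow> real" where
  "bracket f g x = grad_perp f x \<bullet> grad g x"

definition hessian :: "(real^2 \<Rightarrow> real) \<Rightarrow> real^2 \<Rightarrow> real^2^2" where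
  "hessian f x = (\<chi> i j. pd i (pd j f) x)"

definition laplacian :: "(real^2 \<Rightarrow> real) \<Rightarrow> real^2 \<Rightarrow> real" where
  "laplacian f x = (\<Sum>i\<in>UNIV. pd i (pd i f) x)"

section \<open>Hoelder spaces on the torus\<close>

fun C_k :: "nat \<Rightarrow> (real^2 \<Rightarrow> real) \<Rightarrow> bool" where
  "C_k 0 f \<longleftrightarrow> continuous_on UNIV f"
| "C_k (Suc k) f \<longleftrightarrow> (\<forall>x. f differentiable (at x)) \<and> (\<forall>i. C_k k (pd i f))"

definition mixed_pd :: "nat \<Rightarrow> nat \<Rightarrow> (real^2 \<Rightarrow> real) \<Rightarrow> real^2 \<Rightarrow> real" where
  "mixed_pd a b f = (pd 1 ^^ a) ((pd 2 ^^ b) f)"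

text \<open>For periodic functions, Hoelder quotients taken over all of \<open>\<real>\<^sup>2\<close> with the Euclidean
  distance have the same supremum as those taken with the flat torus distance.\<close>

definition holder_continuous :: "real \<Rightarrow> (real^2 \<Rightarrow> real) \<Rightarrow> bool" where
  "holder_continuous \<alpha> f \<longleftrightarrow> (\<exists>K. \<forall>x y. \<bar>f x - f y\<bar> \<le> K * dist x y powr \<alpha>)"

definition holder_seminorm :: "real \<Rightarrow> (real^2 \<Rightarrow> real) \<Rightarrow> real" where
  "holder_seminorm \<alpha> f = (SUP (x, y)\<in>{(x, y). x \<noteq> y}. \<bar>f x - f y\<bar> / dist x y powr \<alpha>)"

definition holder_space :: "nat \<Rightarrow> real \<Rightarrow> (real^2 \<Rightarrow> real) set" where
  "holder_space k \<alpha> = {f. periodic f \<and> C_k k f \<and>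
     (\<forall>a b. a + b = k \<longrightarrow> holder_continuous \<alpha> (mixed_pd a b f))}"

definition holder_norm :: "nat \<Rightarrow> real \<Rightarrow> (real^2 \<Rightarrow> real) \<Rightarrow> real" where
  "holder_norm k \<alpha> f =
     (\<Sum>(a, b)\<in>{(a, b). a + b \<le> k}. SUP x. \<bar>mixed_pd a b f x\<bar>) +
     (\<Sum>(a, b)\<in>{(a, b). a + b = k}. holder_seminorm \<alpha> (mixed_pd a b f))"

definition holder_space0 :: "nat \<Rightarrow> real \<Rightarrow> (real^2 \<Rightarrow> real) set" where
  "holder_space0 k \<alpha> = {f \<in> holder_space k \<alpha>. mean_zero f}"

section \<open>Derivatives of functionals\<close>

definition has_frechet_derivative_at ::
  "nat \<Rightarrow> real \<Rightarrow> ((real^2 \<Rightarrow> real) \<Rightarrow> real) \<Rightarrow> (real^2 \<Rightarrow> real) \<Rightarrow> ((real^2 \<Rightarrow> real) \<Rightarrow> real) \<Rightarrow> bool"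
  where
  "has_frechet_derivative_at k \<alpha> F \<rho> L \<longleftrightarrow>
     (\<forall>g\<in>holder_space0 k \<alpha>. \<forall>h\<in>holder_space0 k \<alpha>. L (\<lambda>x. g x + h x) = L g + L h) \<and>
     (\<forall>c. \<forall>h\<in>holder_space0 k \<alpha>. L (\<lambda>x. c * h x) = c * L h) \<and>
     (\<exists>K. \<forall>h\<in>holder_space0 k \<alpha>. \<bar>L h\<bar> \<le> K * holder_norm k \<alpha> h) \<and>
     (\<forall>e>0. \<exists>d>0. \<forall>h\<in>holder_space0 k \<alpha>. holder_norm k \<alpha> h < d \<longrightarrow>
        \<bar>F (\<lambda>x. \<rho> x + h x) - F \<rho> - L h\<bar> \<le> e * holder_norm k \<alpha> h)"

text \<open>The functional derivative is determined only up to an additive constant, since the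
  perturbations have mean zero.\<close>

definition has_functional_derivative ::
  "nat \<Rightarrow> real \<Rightarrow> ((real^2 \<Rightarrow> real) \<Rightarrow> real) \<Rightarrow> (real^2 \<Rightarrow> real) \<Rightarrow> (real^2 \<Rightarrow> real) \<Rightarrow> bool"
  where
  "has_functional_derivative k \<alpha> F \<rho> g \<longleftrightarrow>
     has_frechet_derivative_at k \<alpha> F \<rho> (\<lambda>h. LINT x|torus. g x * h x)"

section \<open>The potentials\<close>

text \<open>Mean-zero periodic classical solutions of the Poisson equation are unique. The same holds
  for the equation defining \<open>psi\<close> as soon as \<open>1 + \<epsilon> \<rho> > 0\<close>: then \<open>I + \<epsilon> D\<^sup>2\<psi>\<close> is
  nowhere singular and is positive definite at an extremum of \<open>\<psi>\<close>, hence everywhere, and the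
  maximum principle applies to the difference of two solutions. So no convexity or higher
  regularity condition is needed to single out the solution.\<close>

definition poisson :: "(real^2 \<Rightarrow> real) \<Rightarrow> real^2 \<Rightarrow> real" where
  "poisson f = (THE u. periodic u \<and> C_k 2 u \<and> mean_zero u \<and> (\<forall>x. laplacian u x = f x))"

definition psi :: "real \<Rightarrow> (real^2 \<Rightarrow> real) \<Rightarrow> real^2 \<Rightarrow> real" where
  "psi \<epsilon> \<rho> = (THE u. periodic u \<and> C_k 2 u \<and> mean_zero u \<and>
     (\<forall>x. laplacian u x + \<epsilon> * det (hessian u x) = \<rho> x))"

definition phi :: "(real^2 \<Rightarrow> real) \<Rightarrow> real^2 \<Rightarrow> real" where
  "phi \<rho> = poisson \<rho>"

definition chi :: "(real^2 \<Rightarrow> real) \<Rightarrow> real^2 \<Rightarrow> real" where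
  "chi \<rho> = poisson (\<lambda>x. - det (hessian (phi \<rho>) x))"

section \<open>Wasserstein distance and the functionals\<close>

definition torus_dist :: "real^2 \<Rightarrow> real^2 \<Rightarrow> real" where
  "torus_dist x y = infdist (x - y) int_lattice"

definition couplings :: "'a measure \<Rightarrow> 'b measure \<Rightarrow> ('a \<times> 'b) measure set" where
  "couplings \<mu> \<nu> = {\<pi>. sets \<pi> = sets (\<mu> \<Otimes>\<^sub>M \<nu>) \<and> distr \<pi> \<mu> fst = \<mu> \<and> distr \<pi> \<nu> snd = \<nu>}"

definition W2 :: "(real^2) measure \<Rightarrow> (real^2) measure \<Rightarrow> real" where
  "W2 \<mu> \<nu> = sqrt (enn2real
     (INF \<pi>\<in>couplings \<mu> \<nu>. \<integral>\<^sup>+ p. ennreal ((torus_dist (fst p) (snd p))\<^sup>2) \<partial>\<pi>))"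

definition H_eps :: "real \<Rightarrow> (real^2 \<Rightarrow> real) \<Rightarrow> real" where
  "H_eps \<epsilon> \<rho> = 1 / (2 * \<epsilon>\<^sup>2) * (W2 (density torus (\<lambda>x. ennreal (1 + \<epsilon> * \<rho> x))) torus)\<^sup>2"

definition H0 :: "(real^2 \<Rightarrow> real) \<Rightarrow> real" where
  "H0 \<rho> = 1 / 2 * (LINT x|torus. (norm (grad (phi \<rho>) x))\<^sup>2)"

definition H1 :: "(real^2 \<Rightarrow> real) \<Rightarrow> real" where
  "H1 \<rho> = 1 / 3 * (LINT x|torus. phi \<rho> x * det (hessian (phi \<rho>) x))"

section \<open>The semigeostrophic equation\<close>

text \<open>\<open>\<rho>' t x\<close> is the pointwise time derivative of \<open>\<rho> t x\<close>.\<close>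

definition semigeostrophic_solution ::
  "real \<Rightarrow> real set \<Rightarrow> (real \<Rightarrow> real^2 \<Rightarrow> real) \<Rightarrow> (real \<Rightarrow> real^2 \<Rightarrow> real) \<Rightarrow> bool" where
  "semigeostrophic_solution \<epsilon> I \<rho> \<rho>' \<longleftrightarrow> (\<forall>t\<in>I. \<forall>x.
     ((\<lambda>s. \<rho> s x) has_real_derivative \<rho>' t x) (at t within I) \<and>
     \<rho>' t x + bracket (psi \<epsilon> (\<rho> t)) (\<rho> t) x = 0)"

end

theory Submission
  imports Defs
begin

text \<open>Write \<open>\<Delta>\<psi> = a\<close>. In Fourier coefficients the equation for \<open>\<psi>\<close> reads \<open>a = \<rho> - \<epsilon> B(a,a)\<close>, where the
  symbol of the bilinear map \<open>B\<close> is built from the bounded multipliers \<open>n\<^sub>i n\<^sub>j / |n|\<^sup>2\<close>. Hence \<open>B\<close> is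
  bounded on weighted absolutely summable coefficient families and, for small \<open>\<epsilon>\<close>, the equation is
  solved by a contraction; this gives \<open>a = \<rho> - \<epsilon> B(\<rho>,\<rho>) + O(\<epsilon>\<^sup>2)\<close>, that is
  \<open>\<psi> = \<phi> + \<epsilon> \<chi> + O(\<epsilon>\<^sup>2)\<close>. With weight exponent \<open>k + \<alpha> - 2\<close>, Bessel's inequality embeds the Hoelder
  densities, and the potentials lie in the Hoelder space of order \<open>k + \<alpha>\<close>, so no Schauder theory is needed.

  The map \<open>x \<mapsto> x + \<epsilon> \<nabla>\<psi>\<close> is the gradient of a strongly convex function and transports
  \<open>(1 + \<epsilon>\<rho>) dx\<close> to \<open>dx\<close>. Comparing its cost with the dual problem shows that it is optimal, that a
  periodic solution \<open>\<psi>\<close> is unique, and that \<open>H_eps\<close> is convex with subgradient \<open>-\<psi>\<close>. As \<open>\<psi>\<close> depends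
  Lipschitz continuously on \<open>\<rho>\<close>, the subgradient is the derivative. The derivatives of \<open>H0\<close> and \<open>H1\<close>
  follow from integration by parts, and the expansion of \<open>H_eps\<close> itself from integrating the expansion
  of its derivative along \<open>t \<mapsto> t\<rho>\<close>.\<close>

section \<open>Lebesgue measure on the torus\<close>

text \<open>The scheme balances a loss of regularity against a gain. Passing from bounded k-th
  derivatives to absolutely summable coefficients costs more than one order, half the dimension: by
  Cauchy-Schwarz the weight exponent s has to satisfy s < k - 1. The inverse Laplacian returns two
  orders, so s = k + \<alpha> - 2 is admissible precisely because \<alpha> < 1. The outcome is two
  orders short of the Schauder estimate, which does no harm: the gradient of \<rho> limits the
  vector field to order k - 1 + \<alpha> anyway. The bound k >= 3 gives s > 1 and potentials of
  class C^3, as used in the integrations by parts for the cubic functional \<open>H1\<close>. Two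
  definitions shape the rest. \<open>psi\<close> is a definite description over all C^2 solutions,
  with no convexity imposed, so the fixed point is known to be \<open>psi\<close> only after
  uniqueness in that class is proved. \<open>H_eps\<close> is an infimum over couplings: its values
  at two densities are compared through dual potentials, and no formula for it is ever
  differentiated.\<close>

definition unit_square :: "(real^2) set" where
  "unit_square = {x. \<forall>i. 0 \<le> x $ i \<and> x $ i < 1}"

definition frac_vec :: "real^2 \<Rightarrow> real^2" where
  "frac_vec x = (\<chi> i. frac (x $ i))"

lemma torus_eq: "torus = restrict_space lborel unit_square"
  by (simp add: torus_def unit_square_def)

lemma unit_square_borel [measurable]: "unit_square \<in> sets borel"
  unfolding unit_square_def by measurable

lemma space_torus [simp]: "space torus = unit_square"
  by (simp add: torus_eq space_restrict_space)

lemma sets_torus: "sets torus = sets (restrict_space borel unit_square)"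
  by (simp add: torus_eq sets_restrict_space)

lemma measurable_torus: "f \<in> borel_measurable borel \<Longrightarrow> f \<in> borel_measurable torus"
  by (simp add: torus_eq measurable_restrict_space1)

lemma int_lattice_iff: "n \<in> int_lattice \<longleftrightarrow> (\<forall>i. n $ i \<in> \<int>)"
  by (simp add: int_lattice_def)

lemma int_lattice_0 [simp]: "0 \<in> int_lattice"
  and int_lattice_minus: "m \<in> int_lattice \<Longrightarrow> - m \<in> int_lattice"
  by (auto simp: int_lattice_iff)

lemma countable_int_lattice: "countable int_lattice"
proof -
  have "int_lattice \<subseteq> (\<lambda>(a,b). vector [of_int a, of_int b]) ` (UNIV :: (int \<times> int) set)"
  proof
    fix n :: "real^2" assume "n \<in> int_lattice"
    then obtain a b where "n $ 1 = of_int a" "n $ 2 = of_int b"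
      by (metis Ints_cases int_lattice_iff)
    then have "n = vector [of_int a, of_int b]"
      by (simp add: vec_eq_iff forall_2)
    then show "n \<in> (\<lambda>(a,b). vector [of_int a, of_int b]) ` UNIV" by auto
  qed
  then show ?thesis by (meson countable_subset countableI_type countable_image)
qed

lemma periodicD: "periodic f \<Longrightarrow> n \<in> int_lattice \<Longrightarrow> f (x + n) = f x"
  by (simp add: periodic_def)

lemma diff_frac_vec: "x - frac_vec x \<in> int_lattice"
  by (simp add: int_lattice_iff frac_vec_def frac_def)

lemma frac_vec_in [simp]: "frac_vec x \<in> unit_square"
  by (simp add: unit_square_def frac_vec_def frac_ge_0 frac_lt_1)

lemma frac_vec_add: "n \<in> int_lattice \<Longrightarrow> frac_vec (x + n) = frac_vec x"
proof -
  assume "n \<in> int_lattice"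
  then have "frac (x $ i + n $ i) = frac (x $ i)" for i
    by (simp add: int_lattice_iff frac_add_int_right)
  then show ?thesis by (simp add: frac_vec_def)
qed

lemma frac_vec_id: "x \<in> unit_square \<Longrightarrow> frac_vec x = x"
  by (simp add: unit_square_def frac_vec_def vec_eq_iff frac_eq)

lemma periodic_frac: "periodic f \<Longrightarrow> f (frac_vec x) = f x"
  using periodicD[of f "x - frac_vec x" "frac_vec x"] diff_frac_vec by simp

lemma frac_vec_measurable [measurable]: "frac_vec \<in> borel_measurable borel"
proof -
  have "(\<lambda>x. frac_vec x \<bullet> i) \<in> borel_measurable borel" if "i \<in> Basis" for i
  proof -
    from that obtain j where "i = axis j (1::real)" unfolding Basis_vec_def by auto
    then have "(\<lambda>x. frac_vec x \<bullet> i) = (\<lambda>x. x $ j - of_int \<lfloor>x $ j\<rfloor>)"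
      by (simp add: frac_vec_def inner_axis frac_def)
    then show ?thesis by simp
  qed
  then show ?thesis by (subst borel_measurable_euclidean_space) auto
qed

lemma unit_square_translate: "\<exists>!n. n \<in> int_lattice \<and> y + n \<in> unit_square"
proof (rule ex1I[of _ "frac_vec y - y"])
  show "frac_vec y - y \<in> int_lattice \<and> y + (frac_vec y - y) \<in> unit_square"
    using int_lattice_minus[OF diff_frac_vec[of y]] by simp
  fix n assume "n \<in> int_lattice \<and> y + n \<in> unit_square"
  then show "n = frac_vec y - y"
    using frac_vec_add[of n y] frac_vec_id[of "y + n"] by (metis add_diff_cancel_left')
qed

text \<open>Insert the factor 1 as the sum over n of the indicators of \<open>x + n\<close> lying in
  the unit square, exchange sum and integral, and translate by n. Periodicity leaves
  \<open>f\<close> alone, and the translated indicators of \<open>S\<close> sum to 1 again. Besides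
  shifted squares, this is applied to the preimage of the square under the inverse transport
  map.\<close>

lemma nn_integral_fundamental_domain:
  fixes f :: "real^2 \<Rightarrow> ennreal"
  assumes S [measurable]: "S \<in> sets borel"
    and uniq: "\<And>y. \<exists>!n. n \<in> int_lattice \<and> y + n \<in> S"
    and f [measurable]: "f \<in> borel_measurable borel"
    and per: "\<And>y n. n \<in> int_lattice \<Longrightarrow> f (y + n) = f y"
  shows "(\<integral>\<^sup>+x. f x * indicator S x \<partial>lborel) = (\<integral>\<^sup>+x. f x * indicator unit_square x \<partial>lborel)"
proof -
  have one: "(\<integral>\<^sup>+n. indicator R (y + n) \<partial>count_space int_lattice) = (1::ennreal)"
    if u: "\<exists>!n. n \<in> int_lattice \<and> y + n \<in> R" for R and y :: "real^2"
  proof -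
    define m where "m = (THE n. n \<in> int_lattice \<and> y + n \<in> R)"
    have m: "m \<in> int_lattice" "y + m \<in> R"
      using theI'[OF u, folded m_def] by auto
    have mu: "n = m" if "n \<in> int_lattice" "y + n \<in> R" for n
      unfolding m_def by (rule the1_equality[OF u, symmetric]) (use that in blast)
    have "(\<integral>\<^sup>+n. indicator R (y + n) \<partial>count_space int_lattice)
       = (\<integral>\<^sup>+n. indicator {m} n \<partial>count_space int_lattice)"
      by (intro nn_integral_cong) (use m in \<open>auto split: split_indicator dest: mu\<close>)
    also have "\<dots> = 1"
      using m by simp
    finally show ?thesis .
  qed
  have "(\<integral>\<^sup>+x. f x * indicator S x \<partial>lborel)
     = (\<integral>\<^sup>+x. \<integral>\<^sup>+n. f x * indicator S x * indicator unit_square (x + n) \<partial>count_space int_lattice \<partial>lborel)"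
    by (intro nn_integral_cong) (simp add: nn_integral_cmult one[OF unit_square_translate])
  also have "\<dots> = (\<integral>\<^sup>+n. \<integral>\<^sup>+x. f x * indicator S x * indicator unit_square (x + n) \<partial>lborel \<partial>count_space int_lattice)"
    by (rule nn_integral_count_space_nn_integral[OF countable_int_lattice]) measurable
  also have "\<dots> = (\<integral>\<^sup>+n. \<integral>\<^sup>+x. f x * indicator S (x - n) * indicator unit_square x \<partial>lborel \<partial>count_space int_lattice)"
  proof (rule nn_integral_cong)
    fix n :: "real^2" assume "n \<in> space (count_space int_lattice)"
    then have n: "n \<in> int_lattice" by simp
    have "(\<integral>\<^sup>+x. f x * indicator S (x - n) * indicator unit_square x \<partial>lborel)
        = (\<integral>\<^sup>+x. f x * indicator S (x - n) * indicator unit_square x \<partial>distr lborel borel ((+) n))"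
      by (simp add: lborel_distr_plus)
    also have "\<dots> = (\<integral>\<^sup>+x. f (n + x) * indicator S (n + x - n) * indicator unit_square (n + x) \<partial>lborel)"
      by (subst nn_integral_distr) measurable
    also have "\<dots> = (\<integral>\<^sup>+x. f x * indicator S x * indicator unit_square (x + n) \<partial>lborel)"
      using per[OF n] by (simp add: add.commute[of n])
    finally show "(\<integral>\<^sup>+x. f x * indicator S x * indicator unit_square (x + n) \<partial>lborel)
       = (\<integral>\<^sup>+x. f x * indicator S (x - n) * indicator unit_square x \<partial>lborel)" by simp
  qed
  also have "\<dots> = (\<integral>\<^sup>+x. \<integral>\<^sup>+n. f x * indicator S (x - n) * indicator unit_square x \<partial>count_space int_lattice \<partial>lborel)"
    by (rule nn_integral_count_space_nn_integral[OF countable_int_lattice, symmetric]) measurable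
  also have "\<dots> = (\<integral>\<^sup>+x. f x * indicator unit_square x \<partial>lborel)"
  proof (rule nn_integral_cong)
    fix x :: "real^2"
    have bij: "bij_betw uminus int_lattice int_lattice"
      by (rule bij_betw_byWitness[where f' = uminus]) (auto simp: int_lattice_minus)
    have "(\<integral>\<^sup>+n. indicator S (x - n) \<partial>count_space int_lattice) = (\<integral>\<^sup>+n. indicator S (x + n) \<partial>count_space int_lattice)"
      using nn_integral_bij_count_space[OF bij, of "\<lambda>n. indicator S (x + n)"] by simp
    also have "\<dots> = (1::ennreal)" by (rule one[OF uniq])
    finally have "(\<integral>\<^sup>+n. indicator S (x - n) \<partial>count_space int_lattice) = (1::ennreal)" .
    then show "(\<integral>\<^sup>+n. f x * indicator S (x - n) * indicator unit_square x \<partial>count_space int_lattice)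
        = f x * indicator unit_square x"
      by (simp add: nn_integral_cmult nn_integral_multc)
  qed
  finally show ?thesis .
qed

lemma distr_frac_vec_fundamental_domain:
  assumes S [measurable]: "S \<in> sets borel"
    and uniq: "\<And>y. \<exists>!n. n \<in> int_lattice \<and> y + n \<in> S"
  shows "distr (restrict_space lborel S) torus frac_vec = torus"
proof (rule measure_eqI)
  show "sets (distr (restrict_space lborel S) torus frac_vec) = sets torus" by simp
  have m: "frac_vec \<in> measurable (restrict_space lborel S) torus"
    unfolding torus_eq by (intro measurable_restrict_space2 measurable_restrict_space1) auto
  fix A assume A: "A \<in> sets (distr (restrict_space lborel S) torus frac_vec)"
  then have Ab: "A \<in> sets borel" "A \<subseteq> unit_square"
    by (auto simp: sets_torus sets_restrict_space)
  note [measurable] = Ab(1)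
  have "emeasure (distr (restrict_space lborel S) torus frac_vec) A
     = emeasure (restrict_space lborel S) (frac_vec -` A \<inter> S)"
    using A m by (simp add: emeasure_distr space_restrict_space)
  also have "\<dots> = emeasure lborel (frac_vec -` A \<inter> S)"
    by (subst emeasure_restrict_space) auto
  also have "\<dots> = (\<integral>\<^sup>+x. indicator A (frac_vec x) * indicator S x \<partial>lborel)"
  proof -
    have "frac_vec -` A \<inter> S \<in> sets lborel"
      using measurable_sets[OF frac_vec_measurable Ab(1)] by simp
    moreover have "(\<lambda>x. indicator A (frac_vec x) * indicator S x) = (indicator (frac_vec -` A \<inter> S) :: _ \<Rightarrow> ennreal)"
      by (auto simp: fun_eq_iff split: split_indicator)
    ultimately show ?thesis by simp
  qed
  also have "\<dots> = (\<integral>\<^sup>+x. indicator A (frac_vec x) * indicator unit_square x \<partial>lborel)"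
    by (rule nn_integral_fundamental_domain[OF S uniq]) (auto simp: frac_vec_add)
  also have "\<dots> = (\<integral>\<^sup>+x. indicator A x \<partial>lborel)"
    by (intro nn_integral_cong) (use Ab(2) frac_vec_id in \<open>auto simp: indicator_def\<close>)
  also have "\<dots> = emeasure torus A"
    using Ab unfolding torus_eq by (subst emeasure_restrict_space) auto
  finally show "emeasure (distr (restrict_space lborel S) torus frac_vec) A = emeasure torus A" .
qed

lemma emeasure_torus: "emeasure torus (space torus) = 1"
proof -
  have one: "One $ i = (1::real)" for i :: 2
    using inner_axis[of "One" i "1::real"] inner_sum_left_Basis[of "axis i (1::real)"] by simp
  have sub1: "box 0 (One::real^2) \<subseteq> unit_square" and sub2: "unit_square \<subseteq> cbox 0 (One::real^2)"
    by (auto simp: unit_square_def mem_box_cart less_imp_le one simp del: sum_component)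
  have "emeasure lborel (box 0 (One::real^2)) = 1" "emeasure lborel (cbox 0 (One::real^2)) = 1"
    by (auto simp: emeasure_lborel_box_eq emeasure_lborel_cbox_eq)
  moreover have "emeasure lborel (box 0 (One::real^2)) \<le> emeasure lborel unit_square"
    "emeasure lborel unit_square \<le> emeasure lborel (cbox 0 (One::real^2))"
    by (intro emeasure_mono sub1 sub2; simp)+
  ultimately have "emeasure lborel unit_square = 1" by (metis antisym)
  then show ?thesis unfolding torus_eq
    by (subst emeasure_restrict_space) (auto simp: space_restrict_space)
qed


section \<open>Integrals of continuous functions over the torus\<close>

lemma finite_measure_torus: "finite_measure torus"
  by (rule finite_measureI) (simp only: emeasure_torus, simp)

lemma measure_torus [simp]: "measure torus unit_square = 1"
  using emeasure_torus by (simp add: measure_def)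

lemma unit_square_subset_cbox: "unit_square \<subseteq> cbox 0 (\<chi> i. 1)"
  by (auto simp: unit_square_def mem_box_cart less_imp_le)

lemma bounded_on_unit_square:
  fixes f :: "real^2 \<Rightarrow> 'b::real_normed_vector"
  assumes "continuous_on UNIV f"
  obtains K where "\<And>x. x \<in> unit_square \<Longrightarrow> norm (f x) \<le> K"
proof -
  have "compact (f ` cbox 0 (\<chi> i. 1))"
    by (rule compact_continuous_image) (use assms continuous_on_subset in auto)
  then obtain K where "\<forall>y\<in>f ` cbox 0 (\<chi> i. 1). norm y \<le> K"
    using compact_imp_bounded bounded_iff by metis
  then show thesis using unit_square_subset_cbox by (intro that[of K]) blast
qed

lemma periodic_bounded:
  assumes "continuous_on UNIV f" "periodic f"
  obtains K where "\<And>x. \<bar>f x\<bar> \<le> K"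
proof -
  obtain K where "\<And>x. x \<in> unit_square \<Longrightarrow> norm (f x) \<le> K"
    using bounded_on_unit_square[OF assms(1)] by auto
  then have "\<bar>f x\<bar> \<le> K" for x
    using frac_vec_in[of x] periodic_frac[OF assms(2), of x] by fastforce
  then show thesis by (rule that)
qed

lemma integrable_torus:
  fixes f :: "real^2 \<Rightarrow> 'b::{banach,second_countable_topology}"
  assumes "continuous_on UNIV f"
  shows "integrable torus f"
proof -
  obtain K where "\<And>x. x \<in> unit_square \<Longrightarrow> norm (f x) \<le> K"
    using bounded_on_unit_square[OF assms] by auto
  then show ?thesis
    by (intro finite_measure.integrable_const_bound[OF finite_measure_torus, of _ K])
       (auto intro!: measurable_torus borel_measurable_continuous_onI assms)
qed

lemma frac_vec_measurable_torus: "frac_vec \<in> measurable (restrict_space lborel S) torus"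
  unfolding torus_eq by (intro measurable_restrict_space2 measurable_restrict_space1) auto

text \<open>The shifted square is another fundamental domain; folding it back by
  \<open>frac_vec\<close> preserves measure and does not change a periodic integrand.\<close>

lemma integral_torus_translate:
  fixes f :: "real^2 \<Rightarrow> 'b::{banach,second_countable_topology}"
  assumes f: "continuous_on UNIV f" and per: "\<And>x n. n \<in> int_lattice \<Longrightarrow> f (x + n) = f x"
  shows "(LINT x|torus. f (x + t)) = (LINT x|torus. f x)"
proof -
  define S where "S = (\<lambda>x. x - t) -` unit_square"
  have [measurable]: "(\<lambda>x. x - t) \<in> borel_measurable (borel :: (real^2) measure)" by simp
  have S: "S \<in> sets borel"
    using measurable_sets[of "\<lambda>x. x - t" borel borel unit_square] by (simp add: S_def)
  have u: "\<exists>!n. n \<in> int_lattice \<and> y + n \<in> S" for y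
    using unit_square_translate[of "y - t"] by (simp add: S_def algebra_simps)
  have fm: "f \<in> borel_measurable borel" by (rule borel_measurable_continuous_onI[OF f])
  have fr: "f (frac_vec x) = f x" for x
    using per[OF diff_frac_vec, of "frac_vec x" x] by simp
  have "(LINT x|torus. f x) = (LINT x|distr (restrict_space lborel S) torus frac_vec. f x)"
    by (simp add: distr_frac_vec_fundamental_domain[OF S u])
  also have "\<dots> = (LINT x|restrict_space lborel S. f x)"
    by (subst integral_distr[OF frac_vec_measurable_torus measurable_torus[OF fm]]) (simp add: fr)
  also have "\<dots> = (LINT x|lborel. indicator S x *\<^sub>R f x)"
    by (subst integral_restrict_space) (use S in auto)
  also have "\<dots> = (LINT x|distr lborel borel ((+) t). indicator S x *\<^sub>R f x)"
    by (simp add: lborel_distr_plus)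
  also have "\<dots> = (LINT x|lborel. indicator S (t + x) *\<^sub>R f (t + x))"
    by (subst integral_distr) (use S fm in \<open>auto\<close>)
  also have "\<dots> = (LINT x|lborel. indicator unit_square x *\<^sub>R f (x + t))"
    by (intro Bochner_Integration.integral_cong) (auto simp: S_def add.commute split: split_indicator)
  also have "\<dots> = (LINT x|torus. f (x + t))"
    unfolding torus_eq by (subst integral_restrict_space) auto
  finally show ?thesis by simp
qed

lemma integral_torus_pos:
  assumes f: "continuous_on UNIV f" and per: "periodic f" and nn: "\<And>x. 0 \<le> f x" and a: "f a > 0"
  shows "(LINT x|torus. f x) > 0"
proof -
  \<comment> \<open>The positive point is moved to the centre of the square, since a ball around
    \<open>a\<close> itself need not stay inside \<open>unit_square\<close>.\<close>
  define c :: "real^2" where "c = (\<chi> i. 1/2)"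
  define g where "g x = f (x + (a - c))" for x
  have gc: "continuous_on UNIV g"
    unfolding g_def by (rule continuous_on_compose2[OF f]) (auto intro!: continuous_intros)
  have "isCont g c" using gc by (simp add: continuous_on_eq_continuous_at)
  moreover have "g c > 0" by (simp add: g_def a)
  ultimately obtain r where r: "r > 0" "\<And>x. dist x c < r \<Longrightarrow> dist (g x) (g c) < g c / 2"
    unfolding continuous_at_eps_delta by (metis half_gt_zero)
  define B where "B = ball c (min r (1/2))"
  have BU: "B \<subseteq> unit_square"
  proof
    fix x assume "x \<in> B"
    then have "dist (x $ i) (c $ i) < 1/2" for i
      using dist_vec_nth_le[of x i c] by (auto simp: B_def dist_commute intro: le_less_trans)
    then have "\<bar>x $ i - 1/2\<bar> < 1/2" for i by (simp add: c_def dist_real_def)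
    then show "x \<in> unit_square"
      unfolding unit_square_def by (auto simp: abs_less_iff) (smt (verit) field_sum_of_halves)+
  qed
  have gB: "g x \<ge> (g c / 2) * indicator B x" for x
  proof (cases "x \<in> B")
    case True
    then have "\<bar>g x - g c\<bar> < g c / 2" using r(2)[of x] by (simp add: B_def dist_commute dist_real_def abs_minus_commute)
    then have "g c / 2 \<le> g x" by linarith
    then show ?thesis using True by simp
  qed (simp add: g_def nn)
  have Bt: "B \<in> sets torus" using BU unfolding sets_torus B_def
    by (auto simp: sets_restrict_space)
  have "0 < (g c / 2) * measure torus B"
  proof -
    have "measure torus B = measure lborel B"
      unfolding torus_eq using BU by (subst measure_restrict_space) auto
    also have "\<dots> > 0"
      unfolding B_def by (subst content_ball_pos) (use r in auto)
    finally show ?thesis using \<open>g c > 0\<close> by simp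
  qed
  also have "\<dots> = (LINT x|torus. (g c / 2) * indicator B x)"
    using BU by (simp add: Int_absorb2)
  also have "\<dots> \<le> (LINT x|torus. g x)"
    by (intro integral_mono integrable_torus[OF gc] integrable_mult_right integrable_real_indicator gB)
       (use Bt finite_measure.emeasure_finite[OF finite_measure_torus] in \<open>auto simp: less_top[symmetric]\<close>)
  also have "\<dots> = (LINT x|torus. f x)"
    unfolding g_def by (rule integral_torus_translate[OF f]) (use per in \<open>simp add: periodicD\<close>)
  finally show ?thesis .
qed

lemma integral_torus_const: "(LINT x|torus. c) = (c::'b::{banach,second_countable_topology})"
  by simp

lemma integral_torus_norm_le:
  fixes f :: "real^2 \<Rightarrow> 'b::{banach,second_countable_topology}"
  assumes "continuous_on UNIV f" "\<And>x. norm (f x) \<le> K"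
  shows "norm (LINT x|torus. f x) \<le> K"
proof -
  have "norm (LINT x|torus. f x) \<le> (LINT x|torus. norm (f x))"
    by (rule integral_norm_bound)
  also have "\<dots> \<le> (LINT x|torus. K)"
    by (intro integral_mono integrable_norm integrable_torus assms continuous_on_const)
  also have "\<dots> = K" by (rule integral_torus_const)
  finally show ?thesis .
qed

section \<open>Partial derivatives\<close>

lemma sum_UNIV_2: "(\<Sum>i\<in>(UNIV::2 set). f i) = f 1 + f 2"
  by (simp add: UNIV_2)

lemma pd_eqI: "(f has_derivative f') (at x) \<Longrightarrow> pd i f x = f' (axis i 1)"
  unfolding pd_def using frechet_derivative_at by metis

lemma differentiable_has_derivative_pd:
  assumes "f differentiable (at x)"
  shows "(f has_derivative (\<lambda>h. \<Sum>i\<in>UNIV. pd i f x * h $ i)) (at x)"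
proof -
  let ?f' = "frechet_derivative f (at x)"
  have d: "(f has_derivative ?f') (at x)" using assms by (simp add: frechet_derivative_works)
  interpret linear ?f' using d by (rule has_derivative_linear)
  have "?f' h = (\<Sum>i\<in>UNIV. pd i f x * h $ i)" for h
  proof -
    have "h = (\<Sum>i\<in>UNIV. h $ i *\<^sub>R axis i 1)"
      using basis_expansion[of h] by (simp add: scalar_mult_eq_scaleR)
    then have "?f' h = ?f' (\<Sum>i\<in>UNIV. h $ i *\<^sub>R axis i 1)" by simp
    then show ?thesis by (simp add: sum scaleR pd_def mult.commute)
  qed
  then show ?thesis using d by (metis (no_types, lifting) ext)
qed

lemma has_real_derivative_along:
  assumes "f differentiable (at (x + t *\<^sub>R d))"
  shows "((\<lambda>t. f (x + t *\<^sub>R d)) has_real_derivative (\<Sum>i\<in>UNIV. pd i f (x + t *\<^sub>R d) * d $ i)) (at t)"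
proof -
  have "((\<lambda>t. x + t *\<^sub>R d) has_derivative (\<lambda>s. s *\<^sub>R d)) (at t)"
    by (auto intro!: derivative_eq_intros)
  from has_derivative_compose[OF this differentiable_has_derivative_pd[OF assms]]
  show ?thesis
    unfolding has_field_derivative_def
    by (rule has_derivative_eq_rhs) (auto simp: sum_distrib_left mult_ac fun_eq_iff)
qed

lemma pd_add: "f differentiable (at x) \<Longrightarrow> g differentiable (at x) \<Longrightarrow>
    pd i (\<lambda>x. f x + g x) x = pd i f x + pd i g x"
  by (subst pd_eqI[OF has_derivative_add[OF differentiable_has_derivative_pd differentiable_has_derivative_pd]])
     (auto simp: axis_def if_distrib cong: if_cong)

lemma pd_diff: "f differentiable (at x) \<Longrightarrow> g differentiable (at x) \<Longrightarrow>
    pd i (\<lambda>x. f x - g x) x = pd i f x - pd i g x"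
  by (subst pd_eqI[OF has_derivative_diff[OF differentiable_has_derivative_pd differentiable_has_derivative_pd]])
     (auto simp: axis_def if_distrib cong: if_cong)

lemma pd_cmult: "f differentiable (at x) \<Longrightarrow> pd i (\<lambda>x. c * f x) x = c * pd i f x"
  by (subst pd_eqI[OF has_derivative_mult_right[OF differentiable_has_derivative_pd]])
     (auto simp: axis_def if_distrib cong: if_cong)

lemma pd_mult: "f differentiable (at x) \<Longrightarrow> g differentiable (at x) \<Longrightarrow>
    pd i (\<lambda>x. f x * g x) x = pd i f x * g x + f x * pd i g x"
  by (subst pd_eqI[OF has_derivative_mult[OF differentiable_has_derivative_pd differentiable_has_derivative_pd]])
     (auto simp: axis_def if_distrib cong: if_cong)

lemma pd_const [simp]: "pd i (\<lambda>x. c) x = 0"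
  by (subst pd_eqI[OF has_derivative_const]) simp

lemma periodic_pd:
  assumes "periodic f" shows "periodic (pd i f)"
  unfolding periodic_def pd_def
proof (intro allI ballI)
  fix x n assume n: "n \<in> int_lattice"
  have shift: "(f has_derivative D) (at y)" if "(f has_derivative D) (at (y + m))" "m \<in> int_lattice" for D y m
  proof -
    have "((\<lambda>y. y + m) has_derivative (\<lambda>h. h)) (at y)" by (auto intro!: derivative_eq_intros)
    from has_derivative_compose[OF this that(1)]
    show ?thesis using periodicD[OF assms that(2)] by simp
  qed
  \<comment> \<open>\<open>frechet_derivative\<close> is a choice among the derivatives at a point,
    so equivalence of the two predicates suffices and differentiability is not assumed.\<close>
  have "(f has_derivative D) (at (x + n)) \<longleftrightarrow> (f has_derivative D) (at x)" for D
    using shift[of D x n] shift[of D "x + n" "- n"] n int_lattice_minus[OF n] by auto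
  then show "frechet_derivative f (at (x + n)) (axis i 1) = frechet_derivative f (at x) (axis i 1)"
    by (simp add: frechet_derivative_def)
qed

lemma C_k_SucD: "C_k (Suc k) f \<Longrightarrow> f differentiable (at x)" "C_k (Suc k) f \<Longrightarrow> C_k k (pd i f)"
  by auto

lemma C_k_continuous: "C_k k f \<Longrightarrow> continuous_on UNIV f"
  by (cases k) (auto intro!: continuous_at_imp_continuous_on differentiable_imp_continuous_within)

lemma C_k_lower: "C_k (Suc k) f \<Longrightarrow> C_k k f"
  by (induction k arbitrary: f) (auto intro: C_k_continuous[of "Suc 0", simplified])

lemma C_k_mono: "C_k k f \<Longrightarrow> j \<le> k \<Longrightarrow> C_k j f"
  by (induction k) (auto simp: le_Suc_eq dest: C_k_lower simp del: C_k.simps(2))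

lemma C_k_diff: "C_k k f \<Longrightarrow> 0 < k \<Longrightarrow> f differentiable (at x)"
  by (cases k) auto

lemma C_k_pd: "C_k k f \<Longrightarrow> Suc j \<le> k \<Longrightarrow> C_k j (pd i f)"
  using C_k_mono[of k f "Suc j"] by auto

lemma C_k_const: "C_k k (\<lambda>x. c)"
proof (induction k arbitrary: c)
  case (Suc k)
  have "pd i (\<lambda>x. c) = (\<lambda>x. 0)" for i by (simp add: fun_eq_iff)
  then show ?case using Suc by simp
qed simp

lemma C_k_add: "C_k k f \<Longrightarrow> C_k k g \<Longrightarrow> C_k k (\<lambda>x. f x + g x)"
proof (induction k arbitrary: f g)
  case (Suc k)
  have "pd i (\<lambda>x. f x + g x) = (\<lambda>x. pd i f x + pd i g x)" for i
    using Suc.prems by (auto simp: fun_eq_iff pd_add)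
  then show ?case using Suc by (auto intro!: differentiable_add)
qed (auto intro: continuous_intros)

lemma C_k_cmult: "C_k k f \<Longrightarrow> C_k k (\<lambda>x. c * f x)"
proof (induction k arbitrary: f)
  case (Suc k)
  have "pd i (\<lambda>x. c * f x) = (\<lambda>x. c * pd i f x)" for i
    using Suc.prems by (auto simp: fun_eq_iff pd_cmult)
  then show ?case using Suc by (auto intro!: differentiable_mult)
qed (auto intro: continuous_intros)

lemma C_k_mult: "C_k k f \<Longrightarrow> C_k k g \<Longrightarrow> C_k k (\<lambda>x. f x * g x)"
proof (induction k arbitrary: f g)
  case (Suc k)
  have "pd i (\<lambda>x. f x * g x) = (\<lambda>x. pd i f x * g x + f x * pd i g x)" for i
    using Suc.prems by (auto simp: fun_eq_iff pd_mult)
  moreover have "C_k k f" "C_k k g" using Suc.prems C_k_lower by blast+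
  ultimately show ?case using Suc by (auto intro!: differentiable_mult C_k_add)
qed (auto intro: continuous_intros)

lemma C_k_minus: "C_k k f \<Longrightarrow> C_k k (\<lambda>x. - f x)"
  using C_k_cmult[of k f "-1"] by simp

lemma C_k_sub: "C_k k f \<Longrightarrow> C_k k g \<Longrightarrow> C_k k (\<lambda>x. f x - g x)"
  using C_k_add[of k f "\<lambda>x. - g x"] C_k_minus[of k g] by simp

section \<open>Fourier coefficients\<close>

definition fexp :: "int \<times> int \<Rightarrow> real^2 \<Rightarrow> complex" where
  "fexp n x = cis (2 * pi * (of_int (fst n) * x $ 1 + of_int (snd n) * x $ 2))"

definition idx :: "int \<times> int \<Rightarrow> 2 \<Rightarrow> int" where
  "idx n i = (if i = 1 then fst n else snd n)"

definition fc :: "(real^2 \<Rightarrow> real) \<Rightarrow> int \<times> int \<Rightarrow> complex" where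
  "fc f n = (LINT x|torus. of_real (f x) * fexp (- n) x)"

lemma fexp_0 [simp]: "fexp 0 x = 1"
  by (simp add: fexp_def)

lemma fexp_add: "fexp (m + n) x = fexp m x * fexp n x"
  by (simp add: fexp_def cis_mult algebra_simps)

lemma fexp_diff: "fexp (m - n) x = fexp m x * fexp (- n) x"
  using fexp_add[of m "- n" x] by simp

lemma continuous_translate: "continuous_on UNIV f \<Longrightarrow> continuous_on S (\<lambda>x. f (x + t :: real^2))"
  by (rule continuous_on_compose2[of UNIV f]) (auto intro!: continuous_intros)

lemma fexp_plus: "fexp n (x + y) = fexp n x * fexp n y"
  by (simp add: fexp_def cis_mult algebra_simps)

lemma fexp_minus: "fexp (- n) x = cnj (fexp n x)"
  by (simp add: fexp_def cis_cnj algebra_simps)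

lemma norm_fexp [simp]: "norm (fexp n x) = 1"
  by (simp add: fexp_def)

lemma fexp_inverse: "fexp n x * fexp (- n) x = 1"
  using fexp_add[of n "- n" x] by simp

lemma fexp_lattice: "m \<in> int_lattice \<Longrightarrow> fexp n m = 1"
proof -
  assume "m \<in> int_lattice"
  then obtain a b where "m $ 1 = of_int a" "m $ 2 = of_int b"
    by (metis Ints_cases int_lattice_iff)
  then have "fexp n m = cis (2 * pi * of_int (fst n * a + snd n * b))"
    by (simp add: fexp_def)
  then show ?thesis by (simp add: cis_multiple_2pi)
qed

lemma fexp_periodic: "m \<in> int_lattice \<Longrightarrow> fexp n (x + m) = fexp n x"
  by (simp add: fexp_plus fexp_lattice)

lemma continuous_fexp [continuous_intros]: "continuous_on S (fexp n)"
  unfolding fexp_def by (intro continuous_intros)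

lemma fexp_axis: "fexp n (axis i t) = cis (2 * pi * idx n i * t)"
  using exhaust_2[of i] by (auto simp: fexp_def idx_def axis_def mult_ac)

text \<open>A translation by half a period in a coordinate with nonzero frequency changes the sign
  of the character, hence of its integral.\<close>

lemma integral_fexp: "(LINT x|torus. fexp n x) = (if n = 0 then 1 else 0)"
proof (cases "n = 0")
  case True
  then show ?thesis using integral_torus_const[of "1::complex"] by simp
next
  case False
  then obtain i where i: "idx n i \<noteq> 0"
    by (metis idx_def prod.collapse zero_prod_def zero_neq_one[where 'a=2])
  define t :: "real^2" where "t = axis i (1 / (2 * of_int (idx n i)))"
  have t: "fexp n t = -1" using i by (simp add: t_def fexp_axis field_simps)
  have "(LINT x|torus. fexp n x) = (LINT x|torus. fexp n (x + t))"
    by (rule integral_torus_translate[symmetric]) (auto intro: continuous_fexp simp: fexp_periodic)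
  also have "\<dots> = - (LINT x|torus. fexp n x)" by (simp add: fexp_plus t)
  finally show ?thesis using False by (simp add: equal_neg_zero)
qed

text \<open>Subtracting the nearest integer brings \<open>t\<close> into [-1/2, 1/2], where the
  cosine decreases with the absolute value.\<close>

lemma cos_gt_nearby:
  fixes t d :: real
  assumes d: "0 < d" "d \<le> 1/2" and c: "cos (2 * pi * t) > cos (2 * pi * d)"
  shows "\<exists>n::int. \<bar>t - of_int n\<bar> < d"
proof -
  define n where "n = round t"
  define u where "u = t - of_int n"
  have u: "\<bar>u\<bar> \<le> 1/2" unfolding u_def n_def using of_int_round_abs_le[of t] by (simp add: abs_minus_commute)
  have "cos (2 * pi * t) = cos (2 * pi * u + 2 * pi * of_int n)" by (simp add: u_def algebra_simps)
  also have "\<dots> = cos (2 * pi * u)"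
    by (simp only: cos_add cos_int_2pin sin_int_2pin mult_1_right mult_zero_right diff_zero)
  also have "\<dots> = cos (2 * pi * \<bar>u\<bar>)" by (cases "u \<ge> 0") auto
  finally have "cos (2 * pi * \<bar>u\<bar>) > cos (2 * pi * d)" using c by simp
  then have "2 * pi * \<bar>u\<bar> < 2 * pi * d"
    by (subst (asm) cos_mono_less_eq) (use u d in auto)
  then show ?thesis unfolding u_def by auto
qed

text \<open>If \<open>f a > 0\<close>, integrate \<open>f\<close> against powers of a trigonometric polynomial \<open>P \<ge> 0\<close> that exceeds 1
  only where \<open>f \<ge> f a / 2\<close>: the integrals vanish, but by Bernoulli's inequality they grow linearly.\<close>

lemma fc_zero_imp_le_zero:
  assumes f: "continuous_on UNIV f" and per: "periodic f" and z: "\<And>n. fc f n = 0"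
  shows "f a \<le> 0"
proof (rule ccontr)
  assume "\<not> f a \<le> 0"
  then have pos: "f a > 0" by simp
  obtain K where K: "\<And>x. \<bar>f x\<bar> \<le> K" using periodic_bounded[OF f per] by blast
  have "isCont f a" using f by (simp add: continuous_on_eq_continuous_at)
  then obtain r where r: "r > 0" "\<And>x. dist x a < r \<Longrightarrow> dist (f x) (f a) < f a / 2"
    unfolding continuous_at_eps_delta using pos by (metis half_gt_zero)
  define d where "d = min (r / 2) (1 / 2)"
  have d: "0 < d" "d \<le> 1/2" "2 * d \<le> r" using r(1) by (auto simp: d_def)
  have cd: "cos (2 * pi * d) < 1"
    using cos_mono_less_eq[of "2 * pi * d" 0] d by auto
  \<comment> \<open>With this normalisation \<open>P x > 1\<close> says that the two cosines sum to
    more than 1 + cos (2 pi d). As each is at most 1, each exceeds cos (2 pi d), which places both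
    coordinates within \<open>d\<close> of those of \<open>a\<close> modulo integers. Since
    \<open>D < 4\<close>, \<open>P\<close> exceeds 1 at \<open>a\<close>.\<close>
  define D where "D = 3 + cos (2 * pi * d)"
  have D: "2 \<le> D" "D < 4" unfolding D_def using cd cos_ge_minus_one[of "2 * pi * d"] by linarith+
  define P where "P x = (2 + cos (2 * pi * (x $ 1 - a $ 1)) + cos (2 * pi * (x $ 2 - a $ 2))) / D" for x :: "real^2"
  have P0: "0 \<le> P x" for x
    using cos_ge_minus_one[of "2 * pi * (x $ 1 - a $ 1)"] cos_ge_minus_one[of "2 * pi * (x $ 2 - a $ 2)"] D
    unfolding P_def by (intro divide_nonneg_nonneg) linarith+
  have Pcont: "continuous_on UNIV P" unfolding P_def by (intro continuous_intros) (use D in auto)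
  have large: "f x \<ge> f a / 2" if "P x > 1" for x
  proof -
    from that D(1) have "D < 2 + cos (2 * pi * (x $ 1 - a $ 1)) + cos (2 * pi * (x $ 2 - a $ 2))"
      by (simp add: P_def less_divide_eq)
    then have *: "cos (2 * pi * (x $ 1 - a $ 1)) + cos (2 * pi * (x $ 2 - a $ 2)) > 1 + cos (2 * pi * d)"
      unfolding D_def by linarith
    obtain m1 :: int where m1: "\<bar>x $ 1 - a $ 1 - of_int m1\<bar> < d"
      using cos_gt_nearby[OF d(1,2), of "x $ 1 - a $ 1"] * cos_le_one[of "2 * pi * (x $ 2 - a $ 2)"] by auto
    obtain m2 :: int where m2: "\<bar>x $ 2 - a $ 2 - of_int m2\<bar> < d"
      using cos_gt_nearby[OF d(1,2), of "x $ 2 - a $ 2"] * cos_le_one[of "2 * pi * (x $ 1 - a $ 1)"] by auto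
    define m :: "real^2" where "m = vector [- of_int m1, - of_int m2]"
    have m: "m \<in> int_lattice" by (auto simp: int_lattice_iff m_def forall_2)
    have "norm (x + m - a) \<le> \<bar>(x + m - a) $ 1\<bar> + \<bar>(x + m - a) $ 2\<bar>"
      using norm_le_l1_cart[of "x + m - a"] by (simp add: sum_UNIV_2)
    also have "\<dots> < r" using m1 m2 d(3) by (simp add: m_def algebra_simps)
    finally have "dist (f (x + m)) (f a) < f a / 2" by (intro r(2)) (simp add: dist_norm)
    then have "\<bar>f x - f a\<bar> < f a / 2" using periodicD[OF per m, of x] by (simp add: dist_real_def)
    then show ?thesis by linarith
  qed
  define p where "p = (\<lambda>c::real. cis (- 2 * pi * c) / (2 * D))"
  have Pexp: "complex_of_real (P x) = of_real (2 / D) + p (a $ 1) * fexp (1, 0) x + cnj (p (a $ 1)) * fexp (-1, 0) x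
      + p (a $ 2) * fexp (0, 1) x + cnj (p (a $ 2)) * fexp (0, -1) x" for x
  proof -
    have 1: "p c * cis (2 * pi * t) + cnj (p c) * cis (- (2 * pi * t)) = of_real (cos (2 * pi * (t - c)) / D)" for c t :: real
    proof -
      have "p c * cis (2 * pi * t) = cis (2 * pi * (t - c)) / (2 * D)"
        "cnj (p c) * cis (- (2 * pi * t)) = cis (- (2 * pi * (t - c))) / (2 * D)"
        by (simp_all add: p_def cis_cnj cis_mult right_diff_distrib)
      moreover have "cis \<theta> + cis (- \<theta>) = of_real (2 * cos \<theta>)" for \<theta>
        by (simp add: complex_eq_iff)
      ultimately show ?thesis by (simp add: add_divide_distrib[symmetric])
    qed
    have "complex_of_real (P x) = of_real (2 / D) + of_real (cos (2 * pi * (x $ 1 - a $ 1)) / D)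
        + of_real (cos (2 * pi * (x $ 2 - a $ 2)) / D)"
      unfolding P_def of_real_add[symmetric] add_divide_distrib ..
    then show ?thesis
      unfolding 1[symmetric] by (simp add: fexp_def add.assoc)
  qed
  \<comment> \<open>\<open>P\<close> is a combination of five characters, so one more factor
    \<open>P\<close> shifts the frequency to itself and its neighbours; the induction therefore runs
    over all \<open>n\<close> at once.\<close>
  have int0: "(LINT x|torus. of_real (f x) * of_real (P x) ^ N * fexp n x) = 0" for N n
  proof (induction N arbitrary: n)
    case 0
    show ?case using z[of "- n"] by (simp add: fc_def)
  next
    case (Suc N)
    define g where "g n x = of_real (f x) * of_real (P x) ^ N * fexp n x" for n x
    have gi: "integrable torus (g n)" for n
      unfolding g_def by (intro integrable_torus continuous_intros f Pcont)
    have "(LINT x|torus. of_real (f x) * of_real (P x) ^ Suc N * fexp n x)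
       = (LINT x|torus. of_real (2 / D) * g n x + p (a $ 1) * g ((1, 0) + n) x + cnj (p (a $ 1)) * g ((-1, 0) + n) x
      + p (a $ 2) * g ((0, 1) + n) x + cnj (p (a $ 2)) * g ((0, -1) + n) x)"
      by (intro Bochner_Integration.integral_cong refl)
         (unfold power_Suc Pexp g_def fexp_add, simp add: algebra_simps)
    also have "\<dots> = 0"
      using Suc.IH by (simp add: gi g_def[symmetric] Bochner_Integration.integral_add[OF Bochner_Integration.integrable_add])
    finally show ?case .
  qed
  have int0': "(LINT x|torus. f x * P x ^ N) = 0" for N
  proof -
    have "of_real (LINT x|torus. f x * P x ^ N) = (LINT x|torus. complex_of_real (f x * P x ^ N))"
      by (rule integral_complex_of_real[symmetric])
    also have "\<dots> = 0" using int0[of N 0] by simp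
    finally show ?thesis by simp
  qed
  define q where "q x = max 0 (P x - 1)" for x
  have qc: "continuous_on UNIV q" unfolding q_def by (intro continuous_intros Pcont)
  have qp: "periodic q" unfolding periodic_def
  proof (intro allI ballI)
    fix x n assume n: "n \<in> int_lattice"
    have "complex_of_real (P (x + n)) = of_real (P x)" unfolding Pexp by (simp add: fexp_periodic n)
    then show "q (x + n) = q x" by (simp add: q_def)
  qed
  have "q a > 0" using D by (simp add: q_def P_def)
  then have I: "(LINT x|torus. q x) > 0"
    by (intro integral_torus_pos[OF qc qp, of a]) (auto simp: q_def)
  have key: "real N * (f a / 2) * q x - K \<le> f x * P x ^ N" for N x
  proof (cases "P x > 1")
    case True
    have "1 + real N * q x \<le> (1 + q x) ^ N" by (rule Bernoulli_inequality) (simp add: q_def)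
    then have "real N * q x \<le> P x ^ N" using True by (simp add: q_def)
    then have "f a / 2 * (real N * q x) \<le> f x * P x ^ N"
      by (intro mult_mono large[OF True]) (use True pos large[OF True] in \<open>auto simp: q_def\<close>)
    then show ?thesis using K[of x] by (simp add: mult_ac)
  next
    case False
    have "\<bar>f x * P x ^ N\<bar> \<le> K * 1" unfolding abs_mult
      by (intro mult_mono K) (use False P0[of x] order_trans[OF abs_ge_zero K] in \<open>auto intro!: power_le_one\<close>)
    then show ?thesis using False by (simp add: q_def)
  qed
  have "real N * (f a / 2) * (LINT x|torus. q x) \<le> K" for N
  proof -
    have "real N * (f a / 2) * (LINT x|torus. q x) - K = (LINT x|torus. real N * (f a / 2) * q x - K)"
      by (subst Bochner_Integration.integral_diff)
         (auto intro!: integrable_torus continuous_intros qc)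
    also have "\<dots> \<le> (LINT x|torus. f x * P x ^ N)"
      by (intro integral_mono key integrable_torus continuous_intros qc f Pcont)
    finally show ?thesis by (simp add: int0')
  qed
  moreover obtain N where "real N * (f a / 2 * (LINT x|torus. q x)) > K"
    using reals_Archimedean3[of "f a / 2 * (LINT x|torus. q x)"] pos I by auto
  ultimately show False by (metis mult.assoc not_le)
qed

section \<open>Injectivity of the coefficients; translations, derivatives and Bessel's
  inequality\<close>

lemma fc_minus: "fc (\<lambda>x. - f x) n = - fc f n"
  by (simp add: fc_def)

lemma fc_unique_zero:
  assumes "continuous_on UNIV f" "periodic f" "\<And>n. fc f n = 0"
  shows "f x = 0"
proof -
  have "f x \<le> 0" by (rule fc_zero_imp_le_zero) (use assms in auto)
  moreover have "- f x \<le> 0"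
    by (rule fc_zero_imp_le_zero[of "\<lambda>x. - f x"])
       (use assms in \<open>auto simp: fc_minus periodic_def intro: continuous_intros\<close>)
  ultimately show ?thesis by simp
qed

lemma fc_integrable: "continuous_on UNIV f \<Longrightarrow> integrable torus (\<lambda>x. complex_of_real (f x) * fexp n x)"
  by (intro integrable_torus continuous_intros)

lemma fc_diff:
  assumes "continuous_on UNIV f" "continuous_on UNIV g"
  shows "fc (\<lambda>x. f x - g x) n = fc f n - fc g n"
  unfolding fc_def by (simp add: algebra_simps fc_integrable assms)

lemma fc_add:
  assumes "continuous_on UNIV f" "continuous_on UNIV g"
  shows "fc (\<lambda>x. f x + g x) n = fc f n + fc g n"
  unfolding fc_def by (simp add: algebra_simps fc_integrable assms)

lemma fc_cmult: "fc (\<lambda>x. c * f x) n = of_real c * fc f n"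
  unfolding fc_def by (simp add: mult.assoc)

lemma fc_unique:
  assumes "continuous_on UNIV f" "periodic f" "continuous_on UNIV g" "periodic g" "\<And>n. fc f n = fc g n"
  shows "f = g"
proof
  fix x
  have "f x - g x = 0"
    by (rule fc_unique_zero[of "\<lambda>x. f x - g x"])
       (use assms in \<open>auto simp: fc_diff periodic_def intro!: continuous_intros\<close>)
  then show "f x = g x" by simp
qed

lemma fc_0: "fc f 0 = of_real (LINT x|torus. f x)"
  by (simp add: fc_def integral_of_real)

lemma fc_minus_index: "fc f (- n) = cnj (fc f n)"
proof -
  have "cnj (fc f n) = (LINT x|torus. cnj (of_real (f x) * fexp (- n) x))"
    unfolding fc_def by (rule Bochner_Integration.integral_cnj[symmetric])
  then show ?thesis by (simp add: fc_def fexp_minus)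
qed

lemma fc_translate:
  assumes "continuous_on UNIV f" "periodic f"
  shows "fc (\<lambda>x. f (x + t)) n = fexp n t * fc f n"
proof -
  have eq: "of_real (f (x + t)) * fexp (- n) x = fexp n t * (of_real (f (x + t)) * fexp (- n) (x + t))" for x
  proof -
    have "fexp n t * (of_real (f (x + t)) * fexp (- n) (x + t)) = (fexp n t * fexp (- n) t) * (of_real (f (x + t)) * fexp (- n) x)"
      by (simp only: fexp_plus mult_ac)
    then show ?thesis by (simp only: fexp_inverse mult_1_left)
  qed
  have "fc (\<lambda>x. f (x + t)) n = fexp n t * (LINT x|torus. of_real (f (x + t)) * fexp (- n) (x + t))"
    unfolding fc_def integral_mult_right_zero[symmetric] by (rule Bochner_Integration.integral_cong[OF refl eq])
  also have "(LINT x|torus. of_real (f (x + t)) * fexp (- n) (x + t)) = fc f n"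
    unfolding fc_def
    by (rule integral_torus_translate)
       (use assms in \<open>auto intro!: continuous_intros simp: periodicD fexp_periodic\<close>)
  finally show ?thesis .
qed

lemma abs_diff_axis_le:
  assumes "\<And>x. f differentiable (at x)" "\<And>x. \<bar>pd i f x\<bar> \<le> K"
  shows "\<bar>f (x + axis i t) - f x\<bar> \<le> K * \<bar>t\<bar>"
proof -
  have d: "((\<lambda>s. f (x + s *\<^sub>R axis i 1)) has_real_derivative pd i f (x + s *\<^sub>R axis i 1)) (at s)" for s
  proof -
    have "(\<Sum>j\<in>UNIV. pd j f (x + s *\<^sub>R axis i 1) * (axis i 1 :: real^2) $ j) = pd i f (x + s *\<^sub>R axis i 1)"
      by (simp add: axis_def if_distrib cong: if_cong)
    note eq = this
    show ?thesis
      using has_real_derivative_along[where f = f and x = x and t = s and d = "axis i 1", OF assms(1)]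
      unfolding eq .
  qed
  have "norm (f (x + t *\<^sub>R axis i 1) - f (x + 0 *\<^sub>R axis i 1)) \<le> K * norm (t - 0)"
    by (rule field_differentiable_bound[where S = UNIV and f = "\<lambda>s. f (x + s *\<^sub>R axis i 1)"
          and f' = "\<lambda>s. pd i f (x + s *\<^sub>R axis i 1)", OF convex_UNIV has_field_derivative_at_within[OF d]])
       (simp_all add: assms(2))
  moreover have "t *\<^sub>R axis i 1 = (axis i t :: real^2)" by (simp add: vec_eq_iff axis_def)
  ultimately show ?thesis by simp
qed

text \<open>Differentiating \<open>fc_translate\<close> in \<open>t\<close> at 0 avoids Fubini's theorem.\<close>

lemma fc_pd:
  assumes f: "C_k 1 f" and per: "periodic f"
  shows "fc (pd i f) n = 2 * pi * \<i> * of_int (idx n i) * fc f n"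
proof -
  have fd: "\<And>x. f differentiable (at x)" and pc: "continuous_on UNIV (pd i f)" and fcont: "continuous_on UNIV f"
    using f C_k_continuous[OF f] by auto
  obtain K where K: "\<And>x. \<bar>pd i f x\<bar> \<le> K"
    using periodic_bounded[OF pc periodic_pd[OF per]] by blast
  \<comment> \<open>Step sizes along a sequence, as dominated convergence asks for; by the mean
    value bound the difference quotients are dominated by the constant \<open>K\<close>.\<close>
  define t where "t j = 1 / real (Suc j)" for j
  have t: "t j > 0" for j by (simp add: t_def)
  have t0: "t \<longlonglongrightarrow> 0" unfolding t_def by (rule LIMSEQ_Suc) (rule lim_1_over_n)
  then have tat: "filterlim t (at 0) sequentially"
    using t by (auto simp: filterlim_at less_imp_neq[symmetric] intro!: always_eventually)
  define s where "s j x = (f (x + axis i (t j)) - f x) / t j" for j x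
  have sb: "\<bar>s j x\<bar> \<le> K" for j x
    using abs_diff_axis_le[OF fd K, of x "t j"] t[of j] by (simp add: s_def field_simps)
  have slim: "(\<lambda>j. s j x) \<longlonglongrightarrow> pd i f x" for x
  proof -
    have ax: "u *\<^sub>R axis i 1 = (axis i u :: real^2)" for u by (simp add: vec_eq_iff axis_def)
    have "(\<Sum>j\<in>UNIV. pd j f (x + 0 *\<^sub>R axis i 1) * (axis i 1 :: real^2) $ j) = pd i f x"
      by (simp add: axis_def if_distrib cong: if_cong)
    then have "((\<lambda>u. f (x + axis i u)) has_real_derivative pd i f x) (at 0)"
      using has_real_derivative_along[OF fd, where x = x and t = 0 and d = "axis i 1"] by (simp add: ax)
    then have "((\<lambda>u. (f (x + axis i u) - f (x + axis i 0)) / u) \<longlongrightarrow> pd i f x) (at 0)"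
      by (simp add: has_field_derivative_iff)
    moreover have "axis i 0 = (0::real^2)" by (simp add: vec_eq_iff axis_def)
    ultimately show ?thesis unfolding s_def using filterlim_compose[OF _ tat] by fastforce
  qed
  have sc: "continuous_on UNIV (s j)" for j
    unfolding s_def using t[of j]
    by (intro continuous_intros fcont continuous_translate) auto
  have lim1: "(\<lambda>j. fc (s j) n) \<longlonglongrightarrow> fc (pd i f) n"
    unfolding fc_def
  proof (rule integral_dominated_convergence[where w = "\<lambda>_. K"])
    show "AE x in torus. (\<lambda>j. of_real (s j x) * fexp (- n) x) \<longlonglongrightarrow> of_real (pd i f x) * fexp (- n) x"
      by (intro AE_I2 tendsto_intros slim)
    show "\<And>j. AE x in torus. norm (complex_of_real (s j x) * fexp (- n) x) \<le> K"
      using sb by (simp add: norm_mult)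
  qed (auto intro!: measurable_torus borel_measurable_continuous_onI continuous_intros sc pc integrable_torus)
  have "fc (s j) n = (fexp n (axis i (t j)) - 1) / of_real (t j) * fc f n" for j
  proof -
    have "fc (s j) n = fc (\<lambda>x. inverse (t j) * (f (x + axis i (t j)) - f x)) n"
      by (simp add: s_def[abs_def] field_simps)
    also have "\<dots> = of_real (inverse (t j)) * (fexp n (axis i (t j)) * fc f n - fc f n)"
      unfolding fc_cmult fc_translate[OF fcont per, symmetric]
      by (subst fc_diff) (auto intro: continuous_translate fcont)
    finally show ?thesis by (simp add: field_simps)
  qed
  moreover have "(\<lambda>j. (fexp n (axis i (t j)) - 1) / of_real (t j) * fc f n) \<longlonglongrightarrow> 2 * pi * \<i> * of_int (idx n i) * fc f n"
  proof (intro tendsto_mult_right)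
    define c where "c = 2 * pi * real_of_int (idx n i)"
    have "((\<lambda>u. exp (\<i> * of_real c * u)) has_field_derivative (\<i> * of_real c)) (at (0::complex))"
      by (auto intro!: derivative_eq_intros)
    then have "((\<lambda>u. (exp (\<i> * of_real c * u) - 1) / u) \<longlongrightarrow> \<i> * of_real c) (at 0)"
      by (simp add: has_field_derivative_iff)
    moreover have "filterlim (\<lambda>j. complex_of_real (t j)) (at 0) sequentially"
      using t t0 by (auto simp: filterlim_at less_imp_neq[symmetric] intro!: always_eventually tendsto_of_real_iff[THEN iffD2, of _ 0, simplified])
    ultimately have "(\<lambda>j. (exp (\<i> * of_real c * of_real (t j)) - 1) / of_real (t j)) \<longlonglongrightarrow> \<i> * of_real c"
      by (rule filterlim_compose)
    moreover have "exp (\<i> * of_real c * of_real (t j)) = fexp n (axis i (t j))" for j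
      by (simp add: fexp_axis c_def cis_conv_exp mult_ac)
    ultimately show "(\<lambda>j. (fexp n (axis i (t j)) - 1) / of_real (t j)) \<longlonglongrightarrow> 2 * pi * \<i> * of_int (idx n i)"
      by (simp add: c_def mult_ac)
  qed
  ultimately show ?thesis using LIMSEQ_unique[OF lim1] by simp
qed

text \<open>The integral is the coefficient at frequency 0, where differentiation multiplies by
  0.\<close>

lemma integral_pd_zero:
  assumes "C_k 1 f" "periodic f"
  shows "(LINT x|torus. pd i f x) = 0"
proof -
  have "idx 0 i = 0" by (simp add: idx_def)
  then show ?thesis using fc_pd[OF assms, of i 0] fc_0[of "pd i f"] by simp
qed

text \<open>On the Fourier side both derivatives multiply by the same product of frequencies, and
  continuous periodic functions are determined by their coefficients.\<close>

lemma pd_commute: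
  assumes f: "C_k 2 f" and per: "periodic f"
  shows "pd i (pd j f) = pd j (pd i f)"
proof (rule fc_unique)
  have 1: "C_k 1 (pd i f)" for i using f by (simp add: numeral_2_eq_2)
  have 2: "C_k 1 f" by (rule C_k_mono[OF f]) simp
  show "continuous_on UNIV (pd i (pd j f))" "continuous_on UNIV (pd j (pd i f))"
    using f by (auto simp: numeral_2_eq_2)
  show "fc (pd i (pd j f)) n = fc (pd j (pd i f)) n" for n
    unfolding fc_pd[OF 1 periodic_pd[OF per]] fc_pd[OF 2 per] by (simp add: mult_ac)
qed (auto intro: periodic_pd per)

lemma integral_by_parts:
  assumes "C_k 1 f" "periodic f" "C_k 1 g" "periodic g"
  shows "(LINT x|torus. pd i f x * g x) = - (LINT x|torus. f x * pd i g x)"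
proof -
  have d: "\<And>x. f differentiable at x" "\<And>x. g differentiable at x" using assms by auto
  have c: "continuous_on UNIV f" "continuous_on UNIV g" "continuous_on UNIV (pd i f)" "continuous_on UNIV (pd i g)"
    using C_k_continuous[OF assms(1)] C_k_continuous[OF assms(3)] assms by auto
  have p: "periodic (\<lambda>x. f x * g x)" using assms by (auto simp: periodic_def)
  have "0 = (LINT x|torus. pd i (\<lambda>x. f x * g x) x)"
    using integral_pd_zero[OF C_k_mult[OF assms(1,3)] p] by simp
  also have "\<dots> = (LINT x|torus. pd i f x * g x + f x * pd i g x)" by (simp add: pd_mult d)
  also have "\<dots> = (LINT x|torus. pd i f x * g x) + (LINT x|torus. f x * pd i g x)"
    by (intro Bochner_Integration.integral_add integrable_torus continuous_intros c)
  finally show ?thesis by simp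
qed

lemma integral_torus_diff_sum:
  fixes h :: "real^2 \<Rightarrow> complex"
  assumes "continuous_on UNIV h" "\<And>n. n \<in> F \<Longrightarrow> continuous_on UNIV (g n)"
  shows "(LINT x|torus. h x - (\<Sum>n\<in>F. c n * g n x)) = (LINT x|torus. h x) - (\<Sum>n\<in>F. c n * (LINT x|torus. g n x))"
proof -
  have "(LINT x|torus. h x - (\<Sum>n\<in>F. c n * g n x)) = (LINT x|torus. h x) - (LINT x|torus. (\<Sum>n\<in>F. c n * g n x))"
    by (intro Bochner_Integration.integral_diff integrable_torus continuous_intros assms)
  also have "(LINT x|torus. (\<Sum>n\<in>F. c n * g n x)) = (\<Sum>n\<in>F. LINT x|torus. c n * g n x)"
    by (intro Bochner_Integration.integral_sum integrable_torus continuous_intros assms)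
  finally show ?thesis by simp
qed

text \<open>The residual of the partial sum is orthogonal to every character in \<open>F\<close>, so
  its square integral, which is nonnegative, equals that of \<open>f\<close> minus the sum of
  squares. The torus has measure 1, so \<open>K\<^sup>2\<close> bounds the square integral of
  \<open>f\<close>.\<close>

lemma bessel:
  assumes f: "continuous_on UNIV f" and K: "\<And>x. \<bar>f x\<bar> \<le> K" and F: "finite F"
  shows "(\<Sum>n\<in>F. (cmod (fc f n))\<^sup>2) \<le> K\<^sup>2"
proof -
  define g where "g x = complex_of_real (f x) - (\<Sum>n\<in>F. fc f n * fexp n x)" for x
  define S where "S = (\<Sum>n\<in>F. (cmod (fc f n))\<^sup>2)"
  have SS: "(\<Sum>n\<in>F. fc f n * cnj (fc f n)) = of_real S"
    by (simp only: S_def of_real_sum complex_norm_square)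
  have gc: "continuous_on UNIV g" unfolding g_def by (intro continuous_intros f)
  have gn: "(LINT x|torus. g x * fexp (- n) x) = 0" if n: "n \<in> F" for n
  proof -
    have "(LINT x|torus. g x * fexp (- n) x)
        = (LINT x|torus. of_real (f x) * fexp (- n) x - (\<Sum>m\<in>F. fc f m * fexp (m + - n) x))"
      by (simp add: g_def algebra_simps sum_distrib_right sum_distrib_left fexp_diff)
    also have "\<dots> = fc f n - (\<Sum>m\<in>F. fc f m * (LINT x|torus. fexp (m + - n) x))"
      unfolding fc_def[of f n]
      by (intro integral_torus_diff_sum continuous_intros f)
    also have "(\<Sum>m\<in>F. fc f m * (LINT x|torus. fexp (m + - n) x)) = (\<Sum>m\<in>F. if m = n then fc f m else 0)"
      by (intro sum.cong) (auto simp: integral_fexp)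
    also have "\<dots> = fc f n" using n F by simp
    finally show ?thesis by simp
  qed
  have "(LINT x|torus. g x * cnj (g x)) = (LINT x|torus. g x * of_real (f x) - (\<Sum>n\<in>F. cnj (fc f n) * (g x * fexp (- n) x)))"
    by (intro Bochner_Integration.integral_cong refl, subst (2) g_def)
       (simp add: algebra_simps sum_distrib_left fexp_minus)
  also have "\<dots> = (LINT x|torus. g x * of_real (f x)) - (\<Sum>n\<in>F. cnj (fc f n) * (LINT x|torus. g x * fexp (- n) x))"
    by (intro integral_torus_diff_sum continuous_intros f gc)
  also have "\<dots> = (LINT x|torus. g x * of_real (f x))" by (simp add: gn)
  also have "\<dots> = (LINT x|torus. of_real ((f x)\<^sup>2) - (\<Sum>n\<in>F. fc f n * (of_real (f x) * fexp (- (- n)) x)))"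
    by (simp add: g_def algebra_simps sum_distrib_right sum_distrib_left power2_eq_square)
  also have "\<dots> = (LINT x|torus. of_real ((f x)\<^sup>2)) - (\<Sum>n\<in>F. fc f n * fc f (- n))"
    unfolding fc_def[of f "- _"]
    by (intro integral_torus_diff_sum continuous_intros f gc)
  also have "\<dots> = of_real ((LINT x|torus. (f x)\<^sup>2) - S)"
    by (simp add: fc_minus_index SS integral_of_real del: of_real_power)
  finally have eq: "(LINT x|torus. g x * cnj (g x)) = of_real ((LINT x|torus. (f x)\<^sup>2) - S)" .
  have "(LINT x|torus. g x * cnj (g x)) = of_real (LINT x|torus. (cmod (g x))\<^sup>2)"
    by (simp add: complex_norm_square[symmetric] integral_of_real del: of_real_power)
  then have "(LINT x|torus. (cmod (g x))\<^sup>2) = (LINT x|torus. (f x)\<^sup>2) - S"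
    using eq of_real_eq_iff by metis
  moreover have "(LINT x|torus. (cmod (g x))\<^sup>2) \<ge> 0" by simp
  moreover have "(LINT x|torus. (f x)\<^sup>2) \<le> K\<^sup>2"
  proof -
    have "norm (LINT x|torus. (f x)\<^sup>2) \<le> K\<^sup>2"
    proof (rule integral_torus_norm_le)
      show "norm ((f x)\<^sup>2) \<le> K\<^sup>2" for x using power_mono[OF K, of x 2] by simp
    qed (intro continuous_intros f)
    then show ?thesis by simp
  qed
  ultimately show ?thesis unfolding S_def[symmetric] by linarith
qed


section \<open>Weighted summability\<close>

text \<open>Comparable to 1 + |n|, but chosen as an l1 expression because it is submultiplicative
  (\<open>wt_add_le\<close>). This is what makes weighted summable families closed under
  convolution.\<close>

definition wt :: "int \<times> int \<Rightarrow> real" where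
  "wt n = 1 + \<bar>real_of_int (fst n)\<bar> + \<bar>real_of_int (snd n)\<bar>"

lemma wt_ge_1: "1 \<le> wt n" by (simp add: wt_def)

lemma wt_pos [simp]: "0 < wt n" using wt_ge_1[of n] by linarith

lemma wt_minus [simp]: "wt (- n) = wt n" by (simp add: wt_def)

lemma wt_add_le: "wt (m + n) \<le> wt m * wt n"
proof -
  have "wt (m + n) \<le> 1 + (\<bar>real_of_int (fst m)\<bar> + \<bar>real_of_int (snd m)\<bar>) + (\<bar>real_of_int (fst n)\<bar> + \<bar>real_of_int (snd n)\<bar>)"
    unfolding wt_def by auto
  also have "\<dots> \<le> wt m * wt n"
    unfolding wt_def by (simp add: algebra_simps)
  finally show ?thesis .
qed

lemma summable_on_int_powr:
  assumes "q > 1"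
  shows "(\<lambda>k::int. (1 + \<bar>real_of_int k\<bar>) powr (- q)) summable_on UNIV"
proof -
  have "summable (\<lambda>n. real (Suc n) powr (- q))"
    using assms by (subst summable_Suc_iff) (simp add: summable_real_powr_iff)
  then have s: "(\<lambda>n. (1 + real n) powr (- q)) summable_on UNIV"
    by (intro summable_nonneg_imp_summable_on) (auto simp: add.commute)
  have "(\<lambda>k::int. (1 + \<bar>real_of_int k\<bar>) powr (- q)) summable_on range int"
    by (subst summable_on_reindex) (use s in \<open>auto simp: o_def\<close>)
  moreover have "(\<lambda>k::int. (1 + \<bar>real_of_int k\<bar>) powr (- q)) summable_on range (\<lambda>n. - int n)"
    by (subst summable_on_reindex) (use s in \<open>auto simp: o_def inj_on_def\<close>)
  moreover have "(UNIV :: int set) = range int \<union> range (\<lambda>n. - int n)"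
    by (auto intro: int_cases2)
  ultimately show ?thesis using summable_on_union by metis
qed

text \<open>\<open>wt n\<close> dominates 1 + |n_i| in both coordinates, so half of the exponent can
  be given to each; p / 2 > 1 makes both one-dimensional sums converge.\<close>

lemma wt_powr_summable:
  assumes "p > 2"
  shows "(\<lambda>n. wt n powr (- p)) summable_on UNIV"
proof -
  let ?h = "\<lambda>k::int. (1 + \<bar>real_of_int k\<bar>) powr (- (p / 2))"
  have h: "?h summable_on UNIV" using assms by (intro summable_on_int_powr) simp
  have "(\<lambda>(a, b). ?h a * ?h b) summable_on (SIGMA a:UNIV. UNIV)"
    by (rule summable_on_SigmaI[where g = "\<lambda>a. ?h a * infsum ?h UNIV"])
       (auto intro!: has_sum_cmult_right has_sum_infsum h summable_on_cmult_left)
  then have hh: "(\<lambda>n. ?h (fst n) * ?h (snd n)) summable_on UNIV"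
    by (simp add: case_prod_beta')
  show ?thesis
  proof (rule summable_on_comparison_test[OF hh])
    fix n
    have "wt n powr (- p) = wt n powr (- (p / 2)) * wt n powr (- (p / 2))"
      by (simp flip: powr_add)
    also have "\<dots> \<le> ?h (fst n) * ?h (snd n)"
      by (intro mult_mono powr_mono2') (use assms in \<open>auto simp: wt_def\<close>)
    finally show "wt n powr (- p) \<le> ?h (fst n) * ?h (snd n)" .
  qed auto
qed

lemma periodic_pd_iter: "periodic f \<Longrightarrow> periodic ((pd i ^^ k) f)"
  by (induction k) (simp_all add: periodic_pd)

lemma C_k_pd_iter: "C_k (a + k) f \<Longrightarrow> C_k a ((pd i ^^ k) f)"
proof (induction k arbitrary: f)
  case (Suc k)
  then have "C_k a ((pd i ^^ k) (pd i f))" by (intro Suc.IH) simp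
  then show ?case by (simp add: funpow_swap1)
qed simp

lemma fc_pd_iter:
  assumes "C_k k f" "periodic f"
  shows "fc ((pd i ^^ k) f) n = (2 * pi * \<i> * of_int (idx n i)) ^ k * fc f n"
  using assms
proof (induction k arbitrary: f)
  case (Suc k)
  have "C_k 1 f" using C_k_mono[OF Suc.prems(1), of 1] by (simp del: C_k.simps)
  then show ?case
    using Suc.IH[of "pd i f"] Suc.prems fc_pd[of f i n] periodic_pd[of f i]
    by (simp add: funpow_swap1)
qed simp

text \<open>For nonzero \<open>n\<close> each of the three summands of \<open>wt n\<close> is at
  most the larger of the two frequencies, whence the factor 3 and, after squaring, 9. Pure
  derivatives in the two directions thus control the full weight.\<close>

lemma wt_power_le:
  assumes "n \<noteq> 0"
  shows "wt n ^ (2 * k) \<le> 9 ^ k * (real_of_int (idx n 1) ^ (2 * k) + real_of_int (idx n 2) ^ (2 * k))"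
proof -
  define M where "M = max \<bar>real_of_int (fst n)\<bar> \<bar>real_of_int (snd n)\<bar>"
  have "M \<ge> 1" using assms unfolding M_def
    by (cases n) (auto simp: zero_prod_def le_max_iff_disj)
  then have "wt n \<le> 3 * M" unfolding wt_def M_def by linarith
  then have "wt n ^ (2 * k) \<le> (3 * M) ^ (2 * k)"
    by (intro power_mono) (simp_all add: less_imp_le)
  also have "\<dots> = 9 ^ k * M ^ (2 * k)" by (simp add: power_mult_distrib power_mult)
  also have "M ^ (2 * k) \<le> real_of_int (idx n 1) ^ (2 * k) + real_of_int (idx n 2) ^ (2 * k)"
    by (auto simp: M_def idx_def max_def power_even_abs)
  finally show ?thesis by simp
qed

text \<open>Cauchy-Schwarz after splitting the weight as wt^k times wt^(s - k). Bessel's inequality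
  for the two pure k-th derivatives bounds the first factor in l2, and s < k - 1 makes the second
  one square summable in dimension two. The constant 2 * 3^k comes from \<open>wt_power_le\<close>
  and the two directions.\<close>

lemma fc_weighted_sum:
  assumes f: "C_k k f" and per: "periodic f" and K: "\<And>i x. \<bar>(pd i ^^ k) f x\<bar> \<le> K"
    and f0: "fc f 0 = 0" and F: "finite F" and s: "s < real k - 1"
  shows "(\<Sum>n\<in>F. wt n powr s * cmod (fc f n)) \<le> 2 * 3 ^ k * K * sqrt (\<Sum>\<^sub>\<infinity>n. wt n powr (2 * (s - real k)))"
proof -
  have K0: "0 \<le> K" using K order_trans[OF abs_ge_zero] by blast
  have pt: "(wt n ^ k * cmod (fc f n))\<^sup>2 \<le> 9 ^ k * ((cmod (fc ((pd 1 ^^ k) f) n))\<^sup>2 + (cmod (fc ((pd 2 ^^ k) f) n))\<^sup>2)" for n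
  proof (cases "n = 0")
    case False
    have le: "real_of_int (idx n i) ^ (2 * k) * (cmod (fc f n))\<^sup>2 \<le> (cmod (fc ((pd i ^^ k) f) n))\<^sup>2" for i
    proof -
      have "1 \<le> 2 * pi" using pi_gt3 by linarith
      then have "\<bar>real_of_int (idx n i)\<bar> \<le> 2 * pi * \<bar>real_of_int (idx n i)\<bar>"
        using mult_right_mono[of 1 "2 * pi" "\<bar>real_of_int (idx n i)\<bar>"] by simp
      then have "\<bar>real_of_int (idx n i)\<bar> ^ k * cmod (fc f n) \<le> cmod (fc ((pd i ^^ k) f) n)"
        unfolding fc_pd_iter[OF f per] by (simp add: norm_mult norm_power mult_right_mono power_mono)
      then have "(\<bar>real_of_int (idx n i)\<bar> ^ k * cmod (fc f n))\<^sup>2 \<le> (cmod (fc ((pd i ^^ k) f) n))\<^sup>2"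
        by (rule power_mono) simp
      then show ?thesis by (simp add: power_mult_distrib power_mult[symmetric] mult.commute[of k 2] power_even_abs)
    qed
    have "(wt n ^ k * cmod (fc f n))\<^sup>2 = wt n ^ (2 * k) * (cmod (fc f n))\<^sup>2"
      by (simp add: power_mult_distrib power_mult[symmetric] mult.commute[of k 2])
    also have "\<dots> \<le> 9 ^ k * (real_of_int (idx n 1) ^ (2 * k) + real_of_int (idx n 2) ^ (2 * k)) * (cmod (fc f n))\<^sup>2"
      by (intro mult_right_mono wt_power_le False) simp
    also have "\<dots> \<le> 9 ^ k * ((cmod (fc ((pd 1 ^^ k) f) n))\<^sup>2 + (cmod (fc ((pd 2 ^^ k) f) n))\<^sup>2)"
      unfolding mult.assoc distrib_right by (intro mult_left_mono add_mono le) simp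
    finally show ?thesis .
  qed (simp add: f0)
  have "(\<Sum>n\<in>F. (wt n ^ k * cmod (fc f n))\<^sup>2) \<le>
      9 ^ k * ((\<Sum>n\<in>F. (cmod (fc ((pd 1 ^^ k) f) n))\<^sup>2) + (\<Sum>n\<in>F. (cmod (fc ((pd 2 ^^ k) f) n))\<^sup>2))"
    unfolding sum.distrib[symmetric] sum_distrib_left by (intro sum_mono pt)
  also have "\<dots> \<le> 9 ^ k * (K\<^sup>2 + K\<^sup>2)"
    using C_k_pd_iter[of 0 k f] f K by (intro mult_left_mono add_mono bessel F) auto
  also have "\<dots> \<le> (2 * 3 ^ k * K)\<^sup>2"
  proof -
    have "(3 ^ k)\<^sup>2 = (9 ^ k :: real)" by (simp add: power2_eq_square flip: power_mult_distrib)
    then show ?thesis by (simp add: power_mult_distrib)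
  qed
  finally have A: "sqrt (\<Sum>n\<in>F. (wt n ^ k * cmod (fc f n))\<^sup>2) \<le> 2 * 3 ^ k * K"
    using K0 by (intro real_le_lsqrt) (auto intro: sum_nonneg)
  have sm: "(\<lambda>n. wt n powr (2 * (s - real k))) summable_on UNIV"
    using wt_powr_summable[of "2 * (real k - s)"] s by (simp add: algebra_simps)
  have "(\<Sum>n\<in>F. (wt n powr (s - real k))\<^sup>2) = (\<Sum>n\<in>F. wt n powr (2 * (s - real k)))"
    by (simp add: power2_eq_square flip: powr_add)
  also have "\<dots> \<le> (\<Sum>\<^sub>\<infinity>n. wt n powr (2 * (s - real k)))"
    by (intro finite_sum_le_infsum sm F) auto
  finally have B: "sqrt (\<Sum>n\<in>F. (wt n powr (s - real k))\<^sup>2) \<le> sqrt (\<Sum>\<^sub>\<infinity>n. wt n powr (2 * (s - real k)))"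
    by simp
  have "(\<Sum>n\<in>F. wt n powr s * cmod (fc f n)) = (\<Sum>n\<in>F. (wt n ^ k * cmod (fc f n)) * (wt n powr (s - real k)))"
  proof (intro sum.cong refl)
    fix n
    have "wt n powr s = wt n ^ k * wt n powr (s - real k)"
      by (simp flip: powr_realpow powr_add)
    then show "wt n powr s * cmod (fc f n) = (wt n ^ k * cmod (fc f n)) * (wt n powr (s - real k))" by simp
  qed
  also have "\<dots> \<le> L2_set (\<lambda>n. wt n ^ k * cmod (fc f n)) F * L2_set (\<lambda>n. wt n powr (s - real k)) F"
    using L2_set_mult_ineq[of "\<lambda>n. wt n ^ k * cmod (fc f n)" "\<lambda>n. wt n powr (s - real k)" F]
    by (simp add: abs_mult power_abs abs_of_pos)
  also have "\<dots> \<le> (2 * 3 ^ k * K) * sqrt (\<Sum>\<^sub>\<infinity>n. wt n powr (2 * (s - real k)))"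
    using A B K0 unfolding L2_set_def by (intro mult_mono) (auto intro: sum_nonneg)
  finally show ?thesis .
qed

abbreviation norm_summable_on (infixr "norm'_summable'_on" 46) where
  "f norm_summable_on A \<equiv> (\<lambda>x. norm (f x)) summable_on A"

section \<open>The space of absolutely summable families on the dual lattice\<close>

text \<open>A type rather than a set, so that it becomes an instance of \<open>banach\<close> and
  the contraction principle applies. Weights are not part of the type: \<open>fourier_embed\<close>
  multiplies them into the coefficients and \<open>unweight\<close> removes them, so one type serves
  all exponents.\<close>

typedef ell1 = "{a :: int \<times> int \<Rightarrow> complex. a norm_summable_on UNIV}"
  morphisms coef Abs_ell1
  by (rule exI[of _ "\<lambda>_. 0"]) simp

lemma coef_summable: "coef a norm_summable_on UNIV"
  using coef[of a] by simp

lemma coef_Abs: "a norm_summable_on UNIV \<Longrightarrow> coef (Abs_ell1 a) = a"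
  by (simp add: Abs_ell1_inverse)

lemma ell1_eqI: "(\<And>n. coef a n = coef b n) \<Longrightarrow> a = b"
  using coef_inject by blast

lemma abs_summable_add:
  fixes f g :: "'a \<Rightarrow> complex"
  assumes "f norm_summable_on A" "g norm_summable_on A"
  shows "(\<lambda>n. f n + g n) norm_summable_on A"
  by (rule summable_on_comparison_test[OF summable_on_add[OF assms]]) (auto intro: norm_triangle_ineq)

lemma infsum_sub:
  fixes f g :: "'a \<Rightarrow> complex"
  assumes "f summable_on A" "g summable_on A"
  shows "(\<Sum>\<^sub>\<infinity>x\<in>A. f x - g x) = infsum f A - infsum g A"
  using infsum_add[OF assms(1) summable_on_uminus[THEN iffD2, OF assms(2)]] by (simp add: infsum_uminus)

lemma abs_summable_cmult:
  fixes f :: "'a \<Rightarrow> complex"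
  assumes "f norm_summable_on A"
  shows "(\<lambda>n. c * f n) norm_summable_on A"
  using summable_on_cmult_right[OF assms, of "cmod c"] by (simp add: norm_mult)

lemma abs_summable_bound:
  fixes f g :: "'a \<Rightarrow> complex"
  assumes "f norm_summable_on A" "\<And>n. n \<in> A \<Longrightarrow> cmod (g n) \<le> C * cmod (f n)"
  shows "g norm_summable_on A"
  by (rule summable_on_comparison_test[OF summable_on_cmult_right[OF assms(1), of C]]) (auto simp: assms(2))

instantiation ell1 :: real_normed_vector
begin

definition "0 = Abs_ell1 (\<lambda>_. 0)"
definition "a + b = Abs_ell1 (\<lambda>n. coef a n + coef b n)"
definition "a - b = Abs_ell1 (\<lambda>n. coef a n - coef b n)"
definition "- a = Abs_ell1 (\<lambda>n. - coef a n)"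
definition "c *\<^sub>R a = Abs_ell1 (\<lambda>n. c *\<^sub>R coef a n)"
definition "norm a = (\<Sum>\<^sub>\<infinity>n. cmod (coef a n))"
definition "dist (a :: ell1) b = norm (a - b)"
definition "sgn (a :: ell1) = inverse (norm a) *\<^sub>R a"
definition "uniformity = (INF e\<in>{0<..}. principal {(x, y). dist (x :: ell1) y < e})"
definition "open U = (\<forall>x\<in>U. eventually (\<lambda>(x', y). x' = x \<longrightarrow> y \<in> U) (uniformity :: (ell1 \<times> ell1) filter))"

lemma coef_zero [simp]: "coef 0 n = 0"
  by (simp add: zero_ell1_def coef_Abs)

lemma coef_plus [simp]: "coef (a + b) n = coef a n + coef b n"
  using abs_summable_add[OF coef_summable coef_summable, of a b] by (simp add: plus_ell1_def coef_Abs)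

lemma coef_uminus [simp]: "coef (- a) n = - coef a n"
  using coef_summable[of a] by (simp add: uminus_ell1_def coef_Abs)

lemma coef_minus [simp]: "coef (a - b) n = coef a n - coef b n"
  using abs_summable_add[OF coef_summable abs_summable_cmult[OF coef_summable, of "-1"], of a b]
  by (simp add: minus_ell1_def coef_Abs)

lemma coef_scaleR [simp]: "coef (c *\<^sub>R a) n = c *\<^sub>R coef a n"
  using abs_summable_cmult[OF coef_summable, of "of_real c" a]
  by (simp add: scaleR_ell1_def coef_Abs scaleR_conv_of_real)

instance
proof
  fix a b c :: ell1 and r s :: real
  show "a + b + c = a + (b + c)" "a + b = b + a" "0 + a = a" "- a + a = 0" "a - b = a + - b"
    "r *\<^sub>R (a + b) = r *\<^sub>R a + r *\<^sub>R b" "(r + s) *\<^sub>R a = r *\<^sub>R a + s *\<^sub>R a"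
    "r *\<^sub>R s *\<^sub>R a = (r * s) *\<^sub>R a" "1 *\<^sub>R a = a"
    by (rule ell1_eqI; simp add: algebra_simps)+
  show "dist a b = norm (a - b)" "sgn a = inverse (norm a) *\<^sub>R a"
    by (simp_all add: dist_ell1_def sgn_ell1_def)
  show "uniformity = (INF e\<in>{0<..}. principal {(x, y :: ell1). dist x y < e})"
    by (simp add: uniformity_ell1_def)
  show "open U = (\<forall>x\<in>U. eventually (\<lambda>(x', y). x' = x \<longrightarrow> y \<in> U) uniformity)" for U :: "ell1 set"
    by (simp add: open_ell1_def)
  show "norm a = 0 \<longleftrightarrow> a = 0"
  proof
    assume "norm a = 0"
    then have "cmod (coef a n) = 0" for n
      using nonneg_infsum_le_0D[of "\<lambda>n. cmod (coef a n)" UNIV n] coef_summable[of a]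
      by (simp add: norm_ell1_def)
    then show "a = 0" by (intro ell1_eqI) simp
  qed (simp add: norm_ell1_def)
  show "norm (a + b) \<le> norm a + norm b"
    unfolding norm_ell1_def infsum_add[OF coef_summable coef_summable, symmetric]
    by (intro infsum_mono coef_summable summable_on_add) (simp add: norm_triangle_ineq)
  show "norm (r *\<^sub>R a) = \<bar>r\<bar> * norm a"
    unfolding norm_ell1_def by (simp add: infsum_cmult_right' norm_mult)
qed

end

lemma norm_coef_le: "cmod (coef a n) \<le> norm a"
  using finite_sum_le_infsum[OF coef_summable, of "{n}" a] by (simp add: norm_ell1_def)

lemma ell1_boundI:
  assumes "\<And>F. finite F \<Longrightarrow> (\<Sum>n\<in>F. cmod (a n)) \<le> C"
  shows "a norm_summable_on UNIV" and "norm (Abs_ell1 a) \<le> C"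
proof -
  show s: "a norm_summable_on UNIV"
    by (rule nonneg_bdd_above_summable_on) (auto intro!: bdd_aboveI2[where M = C] assms)
  show "norm (Abs_ell1 a) \<le> C"
    unfolding norm_ell1_def coef_Abs[OF s] by (rule infsum_le_finite_sums[OF s]) (use assms in auto)
qed

instance ell1 :: banach
proof
  fix X :: "nat \<Rightarrow> ell1"
  assume X: "Cauchy X"
  have "Cauchy (\<lambda>k. coef (X k) n)" for n
  proof (rule CauchyI)
    fix e :: real assume "0 < e"
    then obtain M where M: "\<forall>m\<ge>M. \<forall>l\<ge>M. norm (X m - X l) < e" using CauchyD[OF X] by blast
    show "\<exists>M. \<forall>m\<ge>M. \<forall>l\<ge>M. norm (coef (X m) n - coef (X l) n) < e"
    proof (intro exI[of _ M] allI impI)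
      fix m l assume "M \<le> m" "M \<le> l"
      then show "norm (coef (X m) n - coef (X l) n) < e"
        using M norm_coef_le[of "X m - X l" n] by (auto intro: le_less_trans)
    qed
  qed
  then obtain c where c: "\<And>n. (\<lambda>k. coef (X k) n) \<longlonglongrightarrow> c n"
    unfolding Cauchy_convergent_iff convergent_def by metis
  \<comment> \<open>The Cauchy estimate passes to the limit in finite partial sums. Being uniform in
    the finite set \<open>F\<close>, it yields both summability of the pointwise limit and
    convergence in norm.\<close>
  have est: "\<exists>M. \<forall>m\<ge>M. \<forall>F. finite F \<longrightarrow> (\<Sum>n\<in>F. cmod (coef (X m) n - c n)) \<le> e" if "0 < e" for e
  proof -
    obtain M where M: "\<And>m l. m \<ge> M \<Longrightarrow> l \<ge> M \<Longrightarrow> norm (X m - X l) < e" using CauchyD[OF X \<open>0 < e\<close>] by blast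
    have "(\<Sum>n\<in>F. cmod (coef (X m) n - c n)) \<le> e" if "m \<ge> M" "finite F" for m F
    proof (rule LIMSEQ_le_const2)
      show "(\<lambda>l. \<Sum>n\<in>F. cmod (coef (X m) n - coef (X l) n)) \<longlonglongrightarrow> (\<Sum>n\<in>F. cmod (coef (X m) n - c n))"
        by (intro tendsto_intros c)
      have "(\<Sum>n\<in>F. cmod (coef (X m) n - coef (X l) n)) \<le> norm (X m - X l)" for l
        using finite_sum_le_infsum[OF coef_summable \<open>finite F\<close>, of "X m - X l"] by (simp add: norm_ell1_def)
      then show "\<exists>N. \<forall>l\<ge>N. (\<Sum>n\<in>F. cmod (coef (X m) n - coef (X l) n)) \<le> e"
        using M[OF \<open>m \<ge> M\<close>] by (meson less_imp_le order_trans)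
    qed
    then show ?thesis by blast
  qed
  obtain M1 where M1: "\<And>m F. m \<ge> M1 \<Longrightarrow> finite F \<Longrightarrow> (\<Sum>n\<in>F. cmod (coef (X m) n - c n)) \<le> 1"
    using est[of 1] by auto
  have "(\<lambda>n. coef (X M1) n - c n) norm_summable_on UNIV" by (rule ell1_boundI) (rule M1, auto)
  from abs_summable_add[OF coef_summable abs_summable_cmult[OF this, of "-1"], of "X M1"]
  have cs: "c norm_summable_on UNIV" by simp
  have "X \<longlonglongrightarrow> Abs_ell1 c"
  proof (rule metric_LIMSEQ_I)
    fix e :: real assume e: "0 < e"
    then obtain M where M: "\<And>m F. m \<ge> M \<Longrightarrow> finite F \<Longrightarrow> (\<Sum>n\<in>F. cmod (coef (X m) n - c n)) \<le> e / 2"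
      using est[of "e / 2"] by auto
    have "dist (X m) (Abs_ell1 c) < e" if "m \<ge> M" for m
    proof -
      have "X m - Abs_ell1 c = Abs_ell1 (\<lambda>n. coef (X m) n - c n)"
        unfolding minus_ell1_def by (simp add: coef_Abs[OF cs])
      moreover have "norm (Abs_ell1 (\<lambda>n. coef (X m) n - c n)) \<le> e / 2"
        by (rule ell1_boundI(2)) (rule M[OF that])
      ultimately show ?thesis using e by (simp add: dist_norm)
    qed
    then show "\<exists>M. \<forall>m\<ge>M. dist (X m) (Abs_ell1 c) < e" by blast
  qed
  then show "convergent X" by (auto simp: convergent_def)
qed

lemma continuous_coef: "continuous_on UNIV (\<lambda>a. coef a n)"
proof (rule continuous_onI)
  fix x e assume "0 < (e::real)"
  then show "\<exists>d>0. \<forall>x'\<in>UNIV. dist x' x < d \<longrightarrow> dist (coef x' n) (coef x n) \<le> e"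
    using norm_coef_le[of "_ - x" n] by (intro exI[of _ e]) (auto simp: dist_norm intro: order_trans less_imp_le)
qed

text \<open>Hermitian families are those whose Fourier series is real-valued.\<close>

definition hermitian :: "ell1 set" where
  "hermitian = {a. \<forall>n. coef a (- n) = cnj (coef a n)}"

lemma closed_hermitian: "closed hermitian"
  unfolding hermitian_def by (intro closed_Collect_all closed_Collect_eq continuous_coef continuous_on_cnj)

lemma hermitian_diff: "a \<in> hermitian \<Longrightarrow> b \<in> hermitian \<Longrightarrow> a - b \<in> hermitian"
  and hermitian_scaleR: "a \<in> hermitian \<Longrightarrow> c *\<^sub>R a \<in> hermitian"
  by (auto simp: hermitian_def)

section \<open>Twisted convolution\<close>

lemma abs_summable_product_families:
  fixes u v :: "'i \<Rightarrow> complex"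
  assumes u: "u norm_summable_on UNIV" and v: "v norm_summable_on UNIV"
  shows "(\<lambda>(m, l). u m * v l) norm_summable_on UNIV"
    and "(\<Sum>\<^sub>\<infinity>(m, l). u m * v l) = infsum u UNIV * infsum v UNIV"
    and "(\<Sum>\<^sub>\<infinity>(m, l). cmod (u m * v l)) = (\<Sum>\<^sub>\<infinity>m. cmod (u m)) * (\<Sum>\<^sub>\<infinity>l. cmod (v l))"
proof -
  have *: "(\<lambda>z. u (fst z) * v (snd z)) norm_summable_on (SIGMA m:UNIV. UNIV)"
    unfolding Infinite_Sum.abs_summable_on_Sigma_iff
    using u v by (auto simp: norm_mult infsum_cmult_right' abs_mult abs_of_nonneg infsum_nonneg intro!: summable_on_cmult_right summable_on_cmult_left infsum_nonneg)
  then show s: "(\<lambda>(m, l). u m * v l) norm_summable_on UNIV" by (simp add: case_prod_beta')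
  have s': "(\<lambda>(m, l). u m * v l) summable_on (SIGMA m:UNIV. UNIV)"
    using abs_summable_summable[OF s] by simp
  have s'': "(\<lambda>(m, l). cmod (u m * v l)) summable_on (SIGMA m:UNIV. UNIV)"
    using s by (simp add: case_prod_beta')
  show "(\<Sum>\<^sub>\<infinity>(m, l). u m * v l) = infsum u UNIV * infsum v UNIV"
    using infsum_Sigma'_banach[OF s'] by (simp add: infsum_cmult_right' infsum_cmult_left')
  show "(\<Sum>\<^sub>\<infinity>(m, l). cmod (u m * v l)) = (\<Sum>\<^sub>\<infinity>m. cmod (u m)) * (\<Sum>\<^sub>\<infinity>l. cmod (v l))"
    using infsum_Sigma'_banach[OF s''] by (simp add: norm_mult infsum_cmult_right' infsum_cmult_left')
qed

text \<open>The shear \<open>h\<close> sends (n, m) to (m, n - m). Reindexing by it and summing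
  iteratively turns a double series into the sum of its convolution terms.\<close>

lemma abs_summable_diagonals:
  fixes F :: "'i::ab_group_add \<times> 'i \<Rightarrow> complex"
  assumes F: "F norm_summable_on UNIV"
  shows "(\<lambda>m. F (m, n - m)) norm_summable_on UNIV"
    and "(\<lambda>n. \<Sum>\<^sub>\<infinity>m. F (m, n - m)) norm_summable_on UNIV"
    and "(\<Sum>\<^sub>\<infinity>n. cmod (\<Sum>\<^sub>\<infinity>m. F (m, n - m))) \<le> (\<Sum>\<^sub>\<infinity>z. cmod (F z))"
    and "(\<Sum>\<^sub>\<infinity>n. \<Sum>\<^sub>\<infinity>m. F (m, n - m)) = infsum F UNIV"
proof -
  define h where "h = (\<lambda>z :: 'i \<times> 'i. (snd z, fst z - snd z))"
  have bij: "bij_betw h UNIV UNIV"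
    by (rule bij_betw_byWitness[where f' = "\<lambda>z. (fst z + snd z, fst z)"]) (auto simp: h_def)
  have "(\<lambda>z. cmod (F (h z))) summable_on UNIV"
    using F summable_on_reindex_bij_betw[OF bij, of "\<lambda>z. cmod (F z)"] by simp
  then have Fh: "(\<lambda>z. F (h z)) norm_summable_on (SIGMA n:UNIV. UNIV)" by simp
  have 1: "(\<lambda>m. F (m, n - m)) norm_summable_on UNIV" for n
    using Fh unfolding Infinite_Sum.abs_summable_on_Sigma_iff by (simp add: h_def)
  then show "(\<lambda>m. F (m, n - m)) norm_summable_on UNIV" .
  have N: "(\<lambda>n. \<Sum>\<^sub>\<infinity>m. cmod (F (m, n - m))) summable_on UNIV"
    using Fh unfolding Infinite_Sum.abs_summable_on_Sigma_iff by (simp add: h_def infsum_nonneg)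
  have le: "cmod (\<Sum>\<^sub>\<infinity>m. F (m, n - m)) \<le> (\<Sum>\<^sub>\<infinity>m. cmod (F (m, n - m)))" for n
    by (rule norm_infsum_bound[OF 1])
  show 2: "(\<lambda>n. \<Sum>\<^sub>\<infinity>m. F (m, n - m)) norm_summable_on UNIV"
    by (rule summable_on_comparison_test[OF N]) (auto intro: le)
  have "(\<Sum>\<^sub>\<infinity>n. cmod (\<Sum>\<^sub>\<infinity>m. F (m, n - m))) \<le> (\<Sum>\<^sub>\<infinity>n. \<Sum>\<^sub>\<infinity>m. cmod (F (m, n - m)))"
    by (intro infsum_mono 2 N le)
  also have "\<dots> = (\<Sum>\<^sub>\<infinity>z. cmod (F (h z)))"
    using infsum_Sigma_banach[of "\<lambda>z. cmod (F (h z))" UNIV "\<lambda>_. UNIV"] Fh by (simp add: h_def)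
  also have "\<dots> = (\<Sum>\<^sub>\<infinity>z. cmod (F z))" by (rule infsum_reindex_bij_betw[OF bij])
  finally show "(\<Sum>\<^sub>\<infinity>n. cmod (\<Sum>\<^sub>\<infinity>m. F (m, n - m))) \<le> (\<Sum>\<^sub>\<infinity>z. cmod (F z))" .
  have "(\<Sum>\<^sub>\<infinity>n. \<Sum>\<^sub>\<infinity>m. F (m, n - m)) = (\<Sum>\<^sub>\<infinity>z. F (h z))"
    using infsum_Sigma_banach[of "\<lambda>z. F (h z)" UNIV "\<lambda>_. UNIV"] abs_summable_summable[OF Fh] by (simp add: h_def)
  also have "\<dots> = infsum F UNIV" by (rule infsum_reindex_bij_betw[OF bij])
  finally show "(\<Sum>\<^sub>\<infinity>n. \<Sum>\<^sub>\<infinity>m. F (m, n - m)) = infsum F UNIV" .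
qed

text \<open>The bilinear Fourier multiplier with symbol \<kappa>(m, l); for \<kappa> = 1 it is the
  convolution that represents a product of series. \<open>Abs_ell1\<close> is meaningful here for
  bounded symbols, see \<open>coef_twisted_conv\<close>.\<close>

definition twisted_conv ::
  "(int \<times> int \<Rightarrow> int \<times> int \<Rightarrow> real) \<Rightarrow> ell1 \<Rightarrow> ell1 \<Rightarrow> ell1" where
  "twisted_conv \<kappa> a b = Abs_ell1 (\<lambda>n. \<Sum>\<^sub>\<infinity>m. of_real (\<kappa> m (n - m)) * (coef a m * coef b (n - m)))"

locale bounded_kernel =
  fixes \<kappa> :: "int \<times> int \<Rightarrow> int \<times> int \<Rightarrow> real" and C :: real
  assumes bound: "\<And>m l. \<bar>\<kappa> m l\<bar> \<le> C"
begin

lemma kernel_summable: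
  "(\<lambda>(m, l). of_real (\<kappa> m l) * (coef a m * coef b l)) norm_summable_on UNIV"
proof -
  have "(\<lambda>z. of_real (\<kappa> (fst z) (snd z)) * (coef a (fst z) * coef b (snd z))) norm_summable_on UNIV"
  proof (rule abs_summable_bound[where C = C])
    show "(\<lambda>(m, l). coef a m * coef b l) norm_summable_on UNIV"
      by (rule abs_summable_product_families[OF coef_summable coef_summable])
    show "cmod (of_real (\<kappa> (fst z) (snd z)) * (coef a (fst z) * coef b (snd z))) \<le> C * cmod (case z of (m, l) \<Rightarrow> coef a m * coef b l)" for z
      using bound[of "fst z" "snd z"] by (simp add: norm_mult mult_right_mono case_prod_beta')
  qed
  then show ?thesis by (simp add: case_prod_beta')
qed

lemma inner_summable:
  "(\<lambda>m. of_real (\<kappa> m (n - m)) * (coef a m * coef b (n - m))) summable_on UNIV"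
  using abs_summable_summable[OF abs_summable_diagonals(1)[OF kernel_summable, of a b n]] by simp

lemma coef_twisted_conv:
  "coef (twisted_conv \<kappa> a b) n = (\<Sum>\<^sub>\<infinity>m. of_real (\<kappa> m (n - m)) * (coef a m * coef b (n - m)))"
  using abs_summable_diagonals(2)[OF kernel_summable, of a b] by (simp add: twisted_conv_def coef_Abs)

lemma norm_twisted_conv: "norm (twisted_conv \<kappa> a b) \<le> C * norm a * norm b"
proof -
  let ?F = "\<lambda>(m, l). of_real (\<kappa> m l) * (coef a m * coef b l)"
  have p: "(\<lambda>z. cmod (case z of (m, l) \<Rightarrow> coef a m * coef b l)) summable_on UNIV"
    by (rule abs_summable_product_families[OF coef_summable coef_summable])
  have "norm (twisted_conv \<kappa> a b) \<le> (\<Sum>\<^sub>\<infinity>z. cmod (?F z))"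
    using abs_summable_diagonals(3)[OF kernel_summable, of a b] by (simp add: norm_ell1_def coef_twisted_conv)
  also have "\<dots> \<le> (\<Sum>\<^sub>\<infinity>z. C * cmod (case z of (m, l) \<Rightarrow> coef a m * coef b l))"
    using bound by (intro infsum_mono kernel_summable summable_on_cmult_right p)
      (auto simp: norm_mult mult_right_mono)
  also have "\<dots> = C * (\<Sum>\<^sub>\<infinity>(m, l). cmod (coef a m * coef b l))"
    by (simp add: infsum_cmult_right' case_prod_beta')
  also have "\<dots> = C * norm a * norm b"
    by (simp only: abs_summable_product_families(3)[OF coef_summable coef_summable] norm_ell1_def mult.assoc)
  finally show ?thesis .
qed

lemma twisted_conv_diff_left: "twisted_conv \<kappa> (a - a') b = twisted_conv \<kappa> a b - twisted_conv \<kappa> a' b"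
proof (rule ell1_eqI)
  fix n
  show "coef (twisted_conv \<kappa> (a - a') b) n = coef (twisted_conv \<kappa> a b - twisted_conv \<kappa> a' b) n"
    using infsum_sub[OF inner_summable inner_summable, of n a b n a' b]
    by (simp add: coef_twisted_conv algebra_simps)
qed

lemma twisted_conv_diff_right: "twisted_conv \<kappa> a (b - b') = twisted_conv \<kappa> a b - twisted_conv \<kappa> a b'"
proof (rule ell1_eqI)
  fix n
  show "coef (twisted_conv \<kappa> a (b - b')) n = coef (twisted_conv \<kappa> a b - twisted_conv \<kappa> a b') n"
    using infsum_sub[OF inner_summable inner_summable, of n a b n a b']
    by (simp add: coef_twisted_conv algebra_simps)
qed

lemma twisted_conv_hermitian:
  assumes even: "\<And>m l. \<kappa> (- m) (- l) = \<kappa> m l" and a: "a \<in> hermitian" and b: "b \<in> hermitian"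
  shows "twisted_conv \<kappa> a b \<in> hermitian"
  unfolding hermitian_def
proof (intro CollectI allI)
  fix n
  have bij: "bij_betw uminus UNIV (UNIV :: (int \<times> int) set)"
    by (rule bij_betw_byWitness[where f' = uminus]) auto
  have "coef (twisted_conv \<kappa> a b) (- n) = (\<Sum>\<^sub>\<infinity>m. of_real (\<kappa> (- m) (- n - (- m))) * (coef a (- m) * coef b (- n - (- m))))"
    unfolding coef_twisted_conv
    by (rule infsum_reindex_bij_betw[OF bij, symmetric])
  also have "\<dots> = (\<Sum>\<^sub>\<infinity>m. cnj (of_real (\<kappa> m (n - m)) * (coef a m * coef b (n - m))))"
  proof (intro infsum_cong)
    fix m
    have "- n - - m = - (n - m)" by simp
    then show "of_real (\<kappa> (- m) (- n - (- m))) * (coef a (- m) * coef b (- n - (- m)))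
        = cnj (of_real (\<kappa> m (n - m)) * (coef a m * coef b (n - m)))"
      using a b by (simp only: even hermitian_def mem_Collect_eq complex_cnj_mult complex_cnj_complex_of_real)
  qed
  also have "\<dots> = cnj (coef (twisted_conv \<kappa> a b) n)" by (simp add: coef_twisted_conv flip: infsum_cnj)
  finally show "coef (twisted_conv \<kappa> a b) (- n) = cnj (coef (twisted_conv \<kappa> a b) n)" .
qed

end

text \<open>On the ball of radius 2M the quadratic term is at most 8 |\<epsilon>| M^2, hence at most
  M / 2, so the ball is preserved; the Lipschitz constant there is 8 |\<epsilon>| M, hence at most
  1/2. Both use 16 |\<epsilon>| M <= 1. The closed set \<open>V\<close> carries a symmetry of the
  solution, later that of \<open>hermitian\<close> families.\<close>

lemma quadratic_fixed_point:
  fixes B :: "'a::banach \<Rightarrow> 'a \<Rightarrow> 'a"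
  assumes left: "\<And>x x' y. B (x - x') y = B x y - B x' y"
    and right: "\<And>x y y'. B x (y - y') = B x y - B x y'"
    and norm: "\<And>x y. norm (B x y) \<le> 2 * norm x * norm y"
    and V: "closed V" "p \<in> V" "\<And>x. x \<in> V \<Longrightarrow> p - \<epsilon> *\<^sub>R B x x \<in> V"
    and M: "norm p \<le> M" "16 * \<bar>\<epsilon>\<bar> * M \<le> 1"
  obtains x where "x \<in> V" "norm x \<le> 2 * M" "x = p - \<epsilon> *\<^sub>R B x x"
proof -
  define S where "S = V \<inter> cball 0 (2 * M)"
  have M0: "0 \<le> M" using M(1) norm_ge_zero order_trans by blast
  have "\<exists>!x\<in>S. p - \<epsilon> *\<^sub>R B x x = x"
  proof (rule Banach_fix[where c = "1/2"])
    show "complete S" unfolding S_def complete_eq_closed by (intro closed_Int V closed_cball)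
    show "S \<noteq> {}" using V(2) M M0 by (auto simp: S_def)
    show "(\<lambda>x. p - \<epsilon> *\<^sub>R B x x) ` S \<subseteq> S"
    proof (rule image_subsetI)
      fix x assume x: "x \<in> S"
      then have nx: "norm x \<le> 2 * M" by (simp add: S_def)
      have "norm (B x x) \<le> 2 * (2 * M) * (2 * M)"
        by (rule order_trans[OF norm]) (intro mult_mono nx; use M0 in simp)
      then have "\<bar>\<epsilon>\<bar> * norm (B x x) \<le> \<bar>\<epsilon>\<bar> * (8 * M * M)" by (intro mult_left_mono) auto
      also have "\<dots> = (16 * \<bar>\<epsilon>\<bar> * M) * (M / 2)" by simp
      also have "\<dots> \<le> 1 * (M / 2)" by (intro mult_right_mono M) (use M0 in simp)
      finally have "norm (p - \<epsilon> *\<^sub>R B x x) \<le> 2 * M"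
        using norm_triangle_ineq4[of p "\<epsilon> *\<^sub>R B x x"] M M0 by simp
      then show "p - \<epsilon> *\<^sub>R B x x \<in> S" using V(3) x by (simp add: S_def)
    qed
    show "dist (p - \<epsilon> *\<^sub>R B x x) (p - \<epsilon> *\<^sub>R B y y) \<le> 1/2 * dist x y" if "x \<in> S" "y \<in> S" for x y
    proof -
      have nx: "norm x \<le> 2 * M" "norm y \<le> 2 * M" using that by (auto simp: S_def)
      have "B y y - B x x = B (y - x) y + B x (y - x)" by (simp add: left right)
      then have "norm (B y y - B x x) \<le> 2 * norm (y - x) * norm y + 2 * norm x * norm (y - x)"
        by (metis norm_triangle_mono norm)
      also have "\<dots> \<le> 2 * norm (y - x) * (2 * M) + 2 * (2 * M) * norm (y - x)"
        by (intro add_mono mult_mono nx) (use M0 in auto)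
      finally have "norm (B y y - B x x) \<le> 8 * M * norm (y - x)" by (simp add: algebra_simps)
      then have "\<bar>\<epsilon>\<bar> * norm (B y y - B x x) \<le> \<bar>\<epsilon>\<bar> * (8 * M * norm (y - x))" by (intro mult_left_mono) auto
      also have "\<dots> = (16 * \<bar>\<epsilon>\<bar> * M) * (norm (y - x) / 2)" by simp
      also have "\<dots> \<le> 1 * (norm (y - x) / 2)" by (intro mult_right_mono M) simp
      finally show ?thesis
        by (simp add: dist_norm norm_minus_commute[of x y] flip: scaleR_diff_right)
    qed
  qed auto
  then obtain x where "x \<in> S" "p - \<epsilon> *\<^sub>R B x x = x" by blast
  then show thesis by (intro that[of x]) (auto simp: S_def)
qed

section \<open>Absolutely convergent Fourier series\<close>

text \<open>Taking the real part gives a real function for every family; nothing is lost on families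
  with conjugate symmetry, see \<open>of_real_fseries\<close>.\<close>

definition fseries :: "(int \<times> int \<Rightarrow> complex) \<Rightarrow> real^2 \<Rightarrow> real" where
  "fseries a x = Re (\<Sum>\<^sub>\<infinity>n. a n * fexp n x)"

definition wsummable :: "real \<Rightarrow> (int \<times> int \<Rightarrow> complex) \<Rightarrow> bool" where
  "wsummable s a \<longleftrightarrow> (\<lambda>n. wt n powr s * cmod (a n)) summable_on UNIV"

definition wnorm :: "real \<Rightarrow> (int \<times> int \<Rightarrow> complex) \<Rightarrow> real" where
  "wnorm s a = (\<Sum>\<^sub>\<infinity>n. wt n powr s * cmod (a n))"

definition dcoef :: "2 \<Rightarrow> (int \<times> int \<Rightarrow> complex) \<Rightarrow> int \<times> int \<Rightarrow> complex" where
  "dcoef i a n = 2 * pi * \<i> * of_int (idx n i) * a n"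

lemma wt_nonzero [simp]: "wt n \<noteq> 0"
  using wt_pos[of n] by linarith

lemma has_sum_sub:
  fixes f g :: "'a \<Rightarrow> complex"
  assumes "(f has_sum S) A" "(g has_sum T) A"
  shows "((\<lambda>x. f x - g x) has_sum (S - T)) A"
  using has_sum_add[OF assms(1) has_sum_uminus[THEN iffD2], of g "- T"] assms(2) by simp

lemma holder_imp_continuous:
  fixes f :: "'a::metric_space \<Rightarrow> real"
  assumes \<alpha>: "0 < \<alpha>" and f: "\<And>x y. \<bar>f x - f y\<bar> \<le> K * dist x y powr \<alpha>"
  shows "continuous_on UNIV f"
proof (rule continuous_onI)
  fix x :: 'a and e :: real assume e: "0 < e"
  define d where "d = (e / (\<bar>K\<bar> + 1)) powr (1 / \<alpha>)"
  have "d > 0" using e by (simp add: d_def)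
  moreover have "dist (f y) (f x) \<le> e" if "dist y x < d" for y
  proof -
    have "dist y x powr \<alpha> \<le> d powr \<alpha>" using that \<alpha> by (intro powr_mono2) auto
    also have "\<dots> = e / (\<bar>K\<bar> + 1)" using \<alpha> e by (simp add: d_def powr_powr)
    finally have p: "dist y x powr \<alpha> \<le> e / (\<bar>K\<bar> + 1)" .
    have "dist (f y) (f x) \<le> K * dist y x powr \<alpha>" using f[of y x] by (simp add: dist_real_def)
    also have "\<dots> \<le> (\<bar>K\<bar> + 1) * dist y x powr \<alpha>" by (intro mult_right_mono) auto
    also have "\<dots> \<le> (\<bar>K\<bar> + 1) * (e / (\<bar>K\<bar> + 1))" by (intro mult_left_mono p) auto
    also have "\<dots> = e" by (simp add: add_nonneg_pos[THEN less_imp_neq, symmetric])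
    finally show ?thesis .
  qed
  ultimately show "\<exists>d>0. \<forall>x'\<in>UNIV. dist x' x < d \<longrightarrow> dist (f x') (f x) \<le> e" by blast
qed

lemma wnorm_nonneg [simp]: "0 \<le> wnorm s a"
  unfolding wnorm_def by (rule infsum_nonneg) simp

text \<open>A multiplier of order \<open>r\<close> costs \<open>r\<close> in the weight exponent.
  The instances are inclusions, differentiation (r = 1) and the inverse Laplacian (r = -2).\<close>

lemma wsummable_bound:
  assumes a: "wsummable s a" and b: "\<And>n. cmod (b n) \<le> C * wt n powr r * cmod (a n)"
  shows "wsummable (s - r) b" "wnorm (s - r) b \<le> C * wnorm s a"
proof -
  have le: "wt n powr (s - r) * cmod (b n) \<le> C * (wt n powr s * cmod (a n))" for n
  proof -
    have "wt n powr (s - r) * cmod (b n) \<le> wt n powr (s - r) * (C * wt n powr r * cmod (a n))"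
      by (intro mult_left_mono b) simp
    also have "\<dots> = C * ((wt n powr (s - r) * wt n powr r) * cmod (a n))" by simp
    finally show ?thesis by (simp flip: powr_add)
  qed
  have Ca: "(\<lambda>n. C * (wt n powr s * cmod (a n))) summable_on UNIV"
    using a unfolding wsummable_def by (rule summable_on_cmult_right)
  show "wsummable (s - r) b"
    unfolding wsummable_def by (rule summable_on_comparison_test[OF Ca]) (use le in auto)
  then show "wnorm (s - r) b \<le> C * wnorm s a"
    unfolding wsummable_def wnorm_def infsum_cmult_right'[symmetric]
    by (intro infsum_mono Ca le)
qed

lemma wsummable_mono:
  assumes "wsummable s a" "t \<le> s"
  shows "wsummable t a" "wnorm t a \<le> wnorm s a"
proof -
  have "cmod (a n) \<le> 1 * wt n powr (s - t) * cmod (a n)" for n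
    using ge_one_powr_ge_zero[OF wt_ge_1, of "s - t" n] assms(2) by (simp add: mult_le_cancel_right1)
  from wsummable_bound[OF assms(1) this] show "wsummable t a" "wnorm t a \<le> wnorm s a" by simp_all
qed

lemma wsummable_abs: "wsummable s a \<Longrightarrow> 0 \<le> s \<Longrightarrow> a norm_summable_on UNIV"
  using wsummable_mono(1)[of s a 0] by (simp add: wsummable_def)

lemma idx_le_wt: "\<bar>real_of_int (idx n i)\<bar> \<le> wt n"
  by (simp add: idx_def wt_def)

lemma wsummable_dcoef:
  assumes "wsummable s a"
  shows "wsummable (s - 1) (dcoef i a)" "wnorm (s - 1) (dcoef i a) \<le> 2 * pi * wnorm s a"
proof -
  have "cmod (dcoef i a n) \<le> 2 * pi * wt n powr 1 * cmod (a n)" for n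
    using idx_le_wt[of n i] by (simp add: dcoef_def norm_mult mult_right_mono)
  from wsummable_bound[OF assms this]
  show "wsummable (s - 1) (dcoef i a)" "wnorm (s - 1) (dcoef i a) \<le> 2 * pi * wnorm s a" by simp_all
qed

lemma fseries_term_summable: "a norm_summable_on UNIV \<Longrightarrow> (\<lambda>n. a n * fexp n x) summable_on UNIV"
  by (rule abs_summable_summable) (simp add: norm_mult)

lemma fseries_bound:
  assumes "wsummable 0 a"
  shows "\<bar>fseries a x\<bar> \<le> wnorm 0 a"
proof -
  have "\<bar>fseries a x\<bar> \<le> cmod (\<Sum>\<^sub>\<infinity>n. a n * fexp n x)" unfolding fseries_def by (rule abs_Re_le_cmod)
  also have "\<dots> \<le> (\<Sum>\<^sub>\<infinity>n. cmod (a n * fexp n x))"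
    by (rule norm_infsum_bound) (use wsummable_abs[OF assms] in \<open>simp add: norm_mult\<close>)
  also have "\<dots> = wnorm 0 a" by (simp add: wnorm_def norm_mult)
  finally show ?thesis .
qed

lemma fseries_periodic: "periodic (fseries a)"
  by (simp add: periodic_def fseries_def fexp_periodic)

definition phase :: "int \<times> int \<Rightarrow> real^2 \<Rightarrow> real" where
  "phase n h = 2 * pi * (of_int (fst n) * h $ 1 + of_int (snd n) * h $ 2)"

lemma phase_bound: "\<bar>phase n h\<bar> \<le> 2 * pi * wt n * norm h"
proof -
  have "\<bar>of_int (fst n) * h $ 1 + of_int (snd n) * h $ 2\<bar>
     \<le> \<bar>of_int (fst n)\<bar> * \<bar>h $ 1\<bar> + \<bar>of_int (snd n)\<bar> * \<bar>h $ 2\<bar>"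
    by (metis abs_mult abs_triangle_ineq)
  also have "\<dots> \<le> \<bar>of_int (fst n)\<bar> * norm h + \<bar>of_int (snd n)\<bar> * norm h"
    by (intro add_mono mult_left_mono component_le_norm_cart) auto
  also have "\<dots> \<le> wt n * norm h" by (simp add: wt_def algebra_simps)
  finally show ?thesis by (simp add: phase_def abs_mult)
qed

lemma fexp_eq_exp: "fexp n h = exp (\<i> * of_real (phase n h))"
  by (simp add: fexp_def phase_def cis_conv_exp)

text \<open>Interpolates between the Taylor bound for small phases and the trivial bound 2 for large
  ones. The power \<alpha> is what converts a fractional weight into a Hoelder exponent.\<close>

lemma fexp_diff_bound:
  assumes "0 < \<alpha>" "\<alpha> \<le> 1"
  shows "cmod (fexp n h - 1) \<le> 2 * \<bar>phase n h\<bar> powr \<alpha>"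
proof (cases "\<bar>phase n h\<bar> \<le> 1")
  case True
  have "cmod (fexp n h - 1) \<le> \<bar>phase n h\<bar>"
    using Taylor_exp[of "\<i> * of_real (phase n h)" 0] by (simp add: fexp_eq_exp norm_mult)
  also have "\<dots> \<le> \<bar>phase n h\<bar> powr \<alpha>"
    using powr_mono'[of \<alpha> 1 "\<bar>phase n h\<bar>"] assms True by (cases "phase n h = 0") auto
  finally show ?thesis using powr_ge_zero[of "\<bar>phase n h\<bar>" \<alpha>] by linarith
next
  case False
  have "cmod (fexp n h - 1) \<le> 2" using norm_triangle_ineq4[of "fexp n h" 1] by simp
  moreover have "1 \<le> \<bar>phase n h\<bar> powr \<alpha>" using False assms by (intro ge_one_powr_ge_zero) auto
  ultimately show ?thesis by linarith
qed

text \<open>The same interpolation one order higher: quadratic for small phases, linear for large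
  ones. Hence the weight 1 + \<alpha>, rather than 2, suffices for one derivative.\<close>

lemma fexp_taylor_bound:
  assumes "0 < \<alpha>" "\<alpha> \<le> 1"
  shows "cmod (fexp n h - 1 - \<i> * of_real (phase n h)) \<le> 3 * \<bar>phase n h\<bar> powr (1 + \<alpha>)"
proof (cases "\<bar>phase n h\<bar> \<le> 1")
  case True
  have "cmod (fexp n h - 1 - \<i> * of_real (phase n h)) \<le> \<bar>phase n h\<bar> ^ 2"
    using Taylor_exp[of "\<i> * of_real (phase n h)" 1] by (simp add: fexp_eq_exp norm_mult algebra_simps numeral_2_eq_2)
  also have "\<dots> \<le> \<bar>phase n h\<bar> powr (1 + \<alpha>)"
    using powr_mono'[of "1 + \<alpha>" 2 "\<bar>phase n h\<bar>"] assms True by (cases "phase n h = 0") auto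
  finally show ?thesis using powr_ge_zero[of "\<bar>phase n h\<bar>" "1 + \<alpha>"] by linarith
next
  case False
  have "cmod (fexp n h - 1 - \<i> * of_real (phase n h)) \<le> 2 + \<bar>phase n h\<bar>"
    using norm_triangle_ineq4[of "fexp n h - 1" "\<i> * of_real (phase n h)"] norm_triangle_ineq4[of "fexp n h" 1]
    by (simp add: norm_mult)
  also have "\<dots> \<le> 3 * \<bar>phase n h\<bar>" using False by simp
  also have "\<dots> \<le> 3 * \<bar>phase n h\<bar> powr (1 + \<alpha>)"
    using powr_mono[of 1 "1 + \<alpha>" "\<bar>phase n h\<bar>"] False assms by simp
  finally show ?thesis .
qed

lemma phase_powr_bound:
  assumes "0 \<le> b" "b \<le> 2"
  shows "\<bar>phase n h\<bar> powr b \<le> (2 * pi) powr b * (norm h powr b * wt n powr b)"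
proof -
  have "\<bar>phase n h\<bar> powr b \<le> (2 * pi * wt n * norm h) powr b"
    by (intro powr_mono2 phase_bound assms) simp
  then show ?thesis by (simp add: powr_mult less_imp_le mult_ac)
qed

lemma fseries_holder:
  assumes a: "wsummable \<alpha> a" and \<alpha>: "0 < \<alpha>" "\<alpha> \<le> 1"
  shows "\<bar>fseries a x - fseries a y\<bar> \<le> 4 * pi * wnorm \<alpha> a * dist x y powr \<alpha>"
proof -
  have abs: "a norm_summable_on UNIV" using wsummable_abs[OF a] \<alpha> by simp
  let ?C = "4 * pi * dist x y powr \<alpha>"
  have "cmod ((\<Sum>\<^sub>\<infinity>n. a n * fexp n x) - (\<Sum>\<^sub>\<infinity>n. a n * fexp n y)) \<le> ?C * wnorm \<alpha> a"
  proof (rule norm_infsum_le)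
    show "((\<lambda>n. a n * fexp n x - a n * fexp n y) has_sum ((\<Sum>\<^sub>\<infinity>n. a n * fexp n x) - (\<Sum>\<^sub>\<infinity>n. a n * fexp n y))) UNIV"
      by (intro has_sum_sub has_sum_infsum fseries_term_summable abs)
    show "((\<lambda>n. ?C * (wt n powr \<alpha> * cmod (a n))) has_sum ?C * wnorm \<alpha> a) UNIV"
      unfolding wnorm_def by (intro has_sum_cmult_right has_sum_infsum) (use a in \<open>simp add: wsummable_def\<close>)
    fix n
    have "a n * fexp n x - a n * fexp n y = a n * fexp n y * (fexp n (x - y) - 1)"
      using fexp_plus[of n y "x - y"] by (simp add: algebra_simps)
    then have "cmod (a n * fexp n x - a n * fexp n y) = cmod (a n) * cmod (fexp n (x - y) - 1)"
      by (simp add: norm_mult)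
    also have "cmod (fexp n (x - y) - 1) \<le> 2 * ((2 * pi) powr \<alpha> * (norm (x - y) powr \<alpha> * wt n powr \<alpha>))"
      using fexp_diff_bound[OF \<alpha>, of n "x - y"] phase_powr_bound[of \<alpha> n "x - y"] \<alpha> by simp
    also have "(2 * pi) powr \<alpha> \<le> 2 * pi"
      using powr_mono[of \<alpha> 1 "2 * pi"] \<alpha> pi_gt3 by simp
    finally show "cmod (a n * fexp n x - a n * fexp n y) \<le> ?C * (wt n powr \<alpha> * cmod (a n))"
      by (simp add: dist_norm mult_left_mono mult_right_mono mult_ac)
  qed
  then show ?thesis
    using abs_Re_le_cmod[of "(\<Sum>\<^sub>\<infinity>n. a n * fexp n x) - (\<Sum>\<^sub>\<infinity>n. a n * fexp n y)"]
    by (simp add: fseries_def mult_ac)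
qed

lemma fseries_continuous:
  assumes a: "wsummable \<alpha> a" and \<alpha>: "0 < \<alpha>" "\<alpha> \<le> 1"
  shows "continuous_on UNIV (fseries a)"
  by (rule holder_imp_continuous[OF \<alpha>(1) fseries_holder[OF a \<alpha>]])

text \<open>Termwise Taylor expansion: the weight 1 + \<alpha> sums the remainders to a multiple of
  |h|^(1 + \<alpha>), which is o(|h|).\<close>

lemma fseries_has_derivative:
  assumes a: "wsummable (1 + \<alpha>) a" and \<alpha>: "0 < \<alpha>" "\<alpha> \<le> 1"
  shows "(fseries a has_derivative (\<lambda>h. \<Sum>i\<in>UNIV. fseries (dcoef i a) x * h $ i)) (at x)"
proof -
  have sa: "a norm_summable_on UNIV" using wsummable_abs[OF a] \<alpha> by simp
  have sd: "dcoef i a norm_summable_on UNIV" for i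
    using wsummable_abs[OF wsummable_dcoef(1)[OF a]] \<alpha> by simp
  define C where "C = 3 * (2 * pi) powr (1 + \<alpha>) * wnorm (1 + \<alpha>) a"
  define S where "S b y = (\<Sum>\<^sub>\<infinity>n. b n * fexp n y)" for b y
  have hS: "((\<lambda>n. b n * fexp n y) has_sum S b y) UNIV" if "b norm_summable_on UNIV" for b y
    unfolding S_def by (intro has_sum_infsum fseries_term_summable that)
  have est: "\<bar>fseries a y - fseries a x - (\<Sum>i\<in>UNIV. fseries (dcoef i a) x * (y - x) $ i)\<bar>
      \<le> C * norm (y - x) powr (1 + \<alpha>)" for y
  proof -
    define h where "h = y - x"
    let ?z = "(S a y - S a x) - (of_real (h $ 1) * S (dcoef 1 a) x + of_real (h $ 2) * S (dcoef 2 a) x)"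
    let ?D = "3 * ((2 * pi) powr (1 + \<alpha>) * norm h powr (1 + \<alpha>))"
    have "cmod ?z \<le> ?D * wnorm (1 + \<alpha>) a"
    proof (rule norm_infsum_le)
      show "((\<lambda>n. (a n * fexp n y - a n * fexp n x) - (of_real (h $ 1) * (dcoef 1 a n * fexp n x) + of_real (h $ 2) * (dcoef 2 a n * fexp n x))) has_sum ?z) UNIV"
        by (intro has_sum_sub has_sum_add has_sum_cmult_right hS sa sd)
      show "((\<lambda>n. ?D * (wt n powr (1 + \<alpha>) * cmod (a n))) has_sum ?D * wnorm (1 + \<alpha>) a) UNIV"
        unfolding wnorm_def by (intro has_sum_cmult_right has_sum_infsum) (use a in \<open>simp add: wsummable_def\<close>)
      fix n
      have "fexp n y = fexp n x * fexp n h" using fexp_plus[of n x h] by (simp add: h_def)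
      then have "(a n * fexp n y - a n * fexp n x) - (of_real (h $ 1) * (dcoef 1 a n * fexp n x) + of_real (h $ 2) * (dcoef 2 a n * fexp n x))
          = a n * fexp n x * (fexp n h - 1 - \<i> * of_real (phase n h))"
        by (simp add: dcoef_def idx_def phase_def algebra_simps)
      then have "cmod ((a n * fexp n y - a n * fexp n x) - (of_real (h $ 1) * (dcoef 1 a n * fexp n x) + of_real (h $ 2) * (dcoef 2 a n * fexp n x)))
          = cmod (a n) * cmod (fexp n h - 1 - \<i> * of_real (phase n h))"
        by (simp add: norm_mult)
      also have "\<dots> \<le> cmod (a n) * (3 * ((2 * pi) powr (1 + \<alpha>) * (norm h powr (1 + \<alpha>) * wt n powr (1 + \<alpha>))))"
        using fexp_taylor_bound[OF \<alpha>, of n h] phase_powr_bound[of "1 + \<alpha>" n h] \<alpha>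
        by (intro mult_left_mono) auto
      finally show "cmod ((a n * fexp n y - a n * fexp n x) - (of_real (h $ 1) * (dcoef 1 a n * fexp n x) + of_real (h $ 2) * (dcoef 2 a n * fexp n x)))
          \<le> ?D * (wt n powr (1 + \<alpha>) * cmod (a n))"
        by (simp add: mult_ac)
    qed
    moreover have "fseries a y - fseries a x - (\<Sum>i\<in>UNIV. fseries (dcoef i a) x * (y - x) $ i) = Re ?z"
      by (simp add: fseries_def S_def sum_UNIV_2 h_def)
    ultimately show ?thesis
      using abs_Re_le_cmod[of ?z] by (simp add: C_def h_def mult_ac)
  qed
  show ?thesis
  proof (rule has_derivativeI_sandwich[where e = 1 and H = "\<lambda>y. C * norm (y - x) powr \<alpha>"])
    have "bounded_linear (\<lambda>h::real^2. c * h $ i)" for c i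
      by (intro bounded_linear_const_mult bounded_linear_vec_nth)
    then show "bounded_linear (\<lambda>h. \<Sum>i\<in>UNIV. fseries (dcoef i a) x * h $ i)"
      by (intro bounded_linear_sum) auto
    fix y assume "y \<noteq> x"
    then have n0: "norm (y - x) > 0" by simp
    have "norm (fseries a y - fseries a x - (\<Sum>i\<in>UNIV. fseries (dcoef i a) x * (y - x) $ i)) / norm (y - x)
        \<le> C * norm (y - x) powr (1 + \<alpha>) / norm (y - x)"
      using est[of y] by (intro divide_right_mono) auto
    also have "\<dots> = C * norm (y - x) powr \<alpha>" using n0 by (simp add: powr_add)
    finally show "norm (fseries a y - fseries a x - (\<Sum>i\<in>UNIV. fseries (dcoef i a) x * (y - x) $ i)) / norm (y - x)
        \<le> C * norm (y - x) powr \<alpha>" .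
  next
    have c: "continuous_on UNIV (\<lambda>y. C * norm (y - x) powr \<alpha>)"
      by (intro continuous_intros continuous_on_powr') (use \<alpha> in auto)
    then have "isCont (\<lambda>y. C * norm (y - x) powr \<alpha>) x" by (simp add: continuous_on_eq_continuous_at)
    then show "((\<lambda>y. C * norm (y - x) powr \<alpha>) \<longlongrightarrow> 0) (at x)"
      using \<alpha> by (simp add: isCont_def)
  qed simp
qed

lemma pd_fseries:
  assumes a: "wsummable (1 + \<alpha>) a" and \<alpha>: "0 < \<alpha>" "\<alpha> \<le> 1"
  shows "pd i (fseries a) = fseries (dcoef i a)"
proof
  fix x
  show "pd i (fseries a) x = fseries (dcoef i a) x"
    unfolding pd_eqI[OF fseries_has_derivative[OF assms]]
    by (simp add: axis_def if_distrib cong: if_cong)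
qed

section \<open>Uniform Hoelder bounds\<close>

text \<open>A recursive substitute for \<open>holder_norm\<close>, with a single constant for all
  iterated derivatives in every order, so that sums, products and series are treated by induction on
  the order. \<open>hoelder_bd_imp_holder_norm\<close> and
  \<open>holder_space_imp_hoelder_bd\<close> translate between the two.\<close>

fun hoelder_bd :: "nat \<Rightarrow> real \<Rightarrow> real \<Rightarrow> (real^2 \<Rightarrow> real) \<Rightarrow> bool" where
  "hoelder_bd 0 \<alpha> K f \<longleftrightarrow> (\<forall>x. \<bar>f x\<bar> \<le> K) \<and> (\<forall>x y. \<bar>f x - f y\<bar> \<le> K * dist x y powr \<alpha>)"
| "hoelder_bd (Suc m) \<alpha> K f \<longleftrightarrow> (\<forall>x. \<bar>f x\<bar> \<le> K) \<and> (\<forall>x. f differentiable (at x)) \<and> (\<forall>i. hoelder_bd m \<alpha> K (pd i f))"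

lemma hoelder_bd_abs: "hoelder_bd m \<alpha> K f \<Longrightarrow> \<bar>f x\<bar> \<le> K"
  by (cases m) auto

lemma hoelder_bd_nonneg: "hoelder_bd m \<alpha> K f \<Longrightarrow> 0 \<le> K"
  using hoelder_bd_abs[of m \<alpha> K f 0] abs_ge_zero order_trans by blast

lemma hoelder_bd_mono: "hoelder_bd m \<alpha> K f \<Longrightarrow> K \<le> L \<Longrightarrow> hoelder_bd m \<alpha> L f"
proof (induction m arbitrary: f)
  case 0
  have "K * dist x y powr \<alpha> \<le> L * dist x y powr \<alpha>" for x y :: "real^2"
    by (intro mult_right_mono 0) simp
  moreover have "\<bar>f x\<bar> \<le> K" "\<bar>f x - f y\<bar> \<le> K * dist x y powr \<alpha>" for x y using 0 by auto
  ultimately have "\<bar>f x\<bar> \<le> L" "\<bar>f x - f y\<bar> \<le> L * dist x y powr \<alpha>" for x y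
    using \<open>K \<le> L\<close> order_trans by blast+
  then show ?case by simp
next
  case (Suc m)
  then show ?case by (auto intro: order_trans)
qed

lemma hoelder_bd_C_k: "hoelder_bd m \<alpha> K f \<Longrightarrow> 0 < \<alpha> \<Longrightarrow> C_k m f"
  by (induction m arbitrary: f) (auto intro: holder_imp_continuous[of \<alpha> _ K])

text \<open>At distance at most 1 the mean value theorem applies, and the factor 2 counts the two
  coordinates; farther apart the sup bound applies, and it counts the two function values.\<close>

lemma hoelder_bd_lower:
  assumes "hoelder_bd (Suc m) \<alpha> K f" and \<alpha>: "0 < \<alpha>" "\<alpha> \<le> 1"
  shows "hoelder_bd m \<alpha> (2 * K) f"
  using assms(1)
proof (induction m arbitrary: f)
  case 0
  then have b: "\<And>x. \<bar>f x\<bar> \<le> K" and d: "\<And>x. f differentiable (at x)" and pb: "\<And>i x. \<bar>pd i f x\<bar> \<le> K"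
    by auto
  have K: "0 \<le> K" using b order_trans[OF abs_ge_zero] by blast
  have "\<bar>f x - f y\<bar> \<le> 2 * K * dist x y powr \<alpha>" for x y
  proof (cases "dist x y \<le> 1")
    case True
    have der: "((\<lambda>t. f (y + t *\<^sub>R (x - y))) has_real_derivative (\<Sum>i\<in>UNIV. pd i f (y + t *\<^sub>R (x - y)) * (x - y) $ i)) (at t within UNIV)" for t
      by (rule has_real_derivative_along[OF d])
    have nb: "norm (\<Sum>i\<in>UNIV. pd i f (y + t *\<^sub>R (x - y)) * (x - y) $ i) \<le> 2 * K * dist x y" for t
    proof -
      have "\<bar>pd i f (y + t *\<^sub>R (x - y)) * (x - y) $ i\<bar> \<le> K * dist x y" for i
        unfolding abs_mult dist_norm by (intro mult_mono pb component_le_norm_cart K) simp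
      from this[of 1] this[of 2] show ?thesis unfolding sum_UNIV_2 real_norm_def by linarith
    qed
    have "norm (f (y + 1 *\<^sub>R (x - y)) - f (y + 0 *\<^sub>R (x - y))) \<le> 2 * K * dist x y * norm (1 - 0 :: real)"
      by (rule field_differentiable_bound[where S = UNIV and f = "\<lambda>t. f (y + t *\<^sub>R (x - y))"
            and f' = "\<lambda>t. \<Sum>i\<in>UNIV. pd i f (y + t *\<^sub>R (x - y)) * (x - y) $ i", OF convex_UNIV der nb]) auto
    then have "\<bar>f x - f y\<bar> \<le> 2 * K * dist x y" by simp
    also have "dist x y \<le> dist x y powr \<alpha>"
      using powr_mono'[of \<alpha> 1 "dist x y"] \<alpha> True by (cases "x = y") auto
    finally show ?thesis using K by (simp add: mult_left_mono)
  next
    case False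
    have "\<bar>f x - f y\<bar> \<le> 2 * K" using b[of x] b[of y] by linarith
    also have "\<dots> \<le> 2 * K * dist x y powr \<alpha>"
      using mult_left_mono[OF ge_one_powr_ge_zero[of "dist x y" \<alpha>], of "2 * K"] False \<alpha> K by simp
    finally show ?thesis .
  qed
  moreover have "\<bar>f x\<bar> \<le> 2 * K" for x using b[of x] K by linarith
  ultimately show ?case by simp
next
  case (Suc m)
  have "0 \<le> K" using hoelder_bd_nonneg[OF Suc.prems] .
  then have "\<bar>f x\<bar> \<le> 2 * K" for x using hoelder_bd_abs[OF Suc.prems, of x] by linarith
  then show ?case using Suc by simp
qed

lemma hoelder_bd_add:
  "hoelder_bd m \<alpha> K f \<Longrightarrow> hoelder_bd m \<alpha> L g \<Longrightarrow> hoelder_bd m \<alpha> (K + L) (\<lambda>x. f x + g x)"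
proof (induction m arbitrary: f g)
  case 0
  have "\<bar>f x + g x - (f y + g y)\<bar> \<le> (K + L) * dist x y powr \<alpha>" for x y
  proof -
    have "\<bar>f x - f y\<bar> \<le> K * dist x y powr \<alpha>" "\<bar>g x - g y\<bar> \<le> L * dist x y powr \<alpha>"
      using 0 by auto
    then show ?thesis by (simp add: distrib_right)
  qed
  moreover have "\<bar>f x + g x\<bar> \<le> K + L" for x
  proof -
    have "\<bar>f x\<bar> \<le> K" "\<bar>g x\<bar> \<le> L" using 0 by auto
    then show ?thesis by linarith
  qed
  ultimately show ?case by simp
next
  case (Suc m)
  have "pd i (\<lambda>x. f x + g x) = (\<lambda>x. pd i f x + pd i g x)" for i
    using Suc.prems by (auto simp: fun_eq_iff pd_add)
  moreover have "\<bar>f x + g x\<bar> \<le> K + L" for x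
    using hoelder_bd_abs[OF Suc.prems(1), of x] hoelder_bd_abs[OF Suc.prems(2), of x] by linarith
  ultimately show ?case using Suc by (auto intro!: differentiable_add)
qed

lemma hoelder_bd_cmult:
  "hoelder_bd m \<alpha> K f \<Longrightarrow> hoelder_bd m \<alpha> (\<bar>c\<bar> * K) (\<lambda>x. c * f x)"
proof (induction m arbitrary: f)
  case 0
  have "\<bar>c * f x - c * f y\<bar> \<le> \<bar>c\<bar> * K * dist x y powr \<alpha>" for x y
    using mult_left_mono[of "\<bar>f x - f y\<bar>" "K * dist x y powr \<alpha>" "\<bar>c\<bar>"] 0
    by (simp add: abs_mult[symmetric] right_diff_distrib mult.assoc)
  then show ?case using 0 by (auto simp: abs_mult mult_left_mono)
next
  case (Suc m)
  have "pd i (\<lambda>x. c * f x) = (\<lambda>x. c * pd i f x)" for i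
    using Suc.prems by (auto simp: fun_eq_iff pd_cmult)
  then show ?case using Suc by (auto intro!: differentiable_mult simp: abs_mult mult_left_mono)
qed

text \<open>Each derivative produces two products, and in each the undifferentiated factor is
  lowered by one order at the cost of a factor 2; this gives 4 per order. The initial 2 is the
  Hoelder product rule.\<close>

lemma hoelder_bd_mult:
  assumes "0 < \<alpha>" "\<alpha> \<le> 1"
  shows "hoelder_bd m \<alpha> K f \<Longrightarrow> hoelder_bd m \<alpha> L g \<Longrightarrow> hoelder_bd m \<alpha> (2 * 4 ^ m * K * L) (\<lambda>x. f x * g x)"
proof (induction m arbitrary: f g K L)
  case 0
  have K: "0 \<le> K" "0 \<le> L" using hoelder_bd_nonneg 0 by blast+
  have fb: "\<And>x. \<bar>f x\<bar> \<le> K" "\<And>x. \<bar>g x\<bar> \<le> L" using 0 by auto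
  have "\<bar>f x * g x - f y * g y\<bar> \<le> 2 * K * L * dist x y powr \<alpha>" for x y
  proof -
    have "f x * g x - f y * g y = f x * (g x - g y) + (f x - f y) * g y" by (simp add: algebra_simps)
    then have "\<bar>f x * g x - f y * g y\<bar> \<le> \<bar>f x\<bar> * \<bar>g x - g y\<bar> + \<bar>f x - f y\<bar> * \<bar>g y\<bar>"
      by (metis abs_mult abs_triangle_ineq)
    also have "\<dots> \<le> K * (L * dist x y powr \<alpha>) + (K * dist x y powr \<alpha>) * L"
      using 0 by (intro add_mono mult_mono fb) (auto simp: K)
    finally show ?thesis by (simp add: algebra_simps)
  qed
  moreover have "\<bar>f x * g x\<bar> \<le> 2 * K * L" for x
  proof -
    have "\<bar>f x * g x\<bar> \<le> K * L" unfolding abs_mult by (intro mult_mono fb) (auto simp: K)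
    moreover have "0 \<le> K * L" using K by simp
    ultimately show ?thesis by linarith
  qed
  ultimately show ?case by simp
next
  case (Suc m)
  have K: "0 \<le> K" "0 \<le> L" using hoelder_bd_nonneg Suc.prems by blast+
  have pdm: "pd i (\<lambda>x. f x * g x) = (\<lambda>x. pd i f x * g x + f x * pd i g x)" for i
    using Suc.prems by (auto simp: fun_eq_iff pd_mult)
  have "hoelder_bd m \<alpha> (2 * 4 ^ m * K * (2 * L) + 2 * 4 ^ m * (2 * K) * L) (\<lambda>x. pd i f x * g x + f x * pd i g x)" for i
    using Suc.prems by (intro hoelder_bd_add Suc.IH hoelder_bd_lower assms) auto
  then have "hoelder_bd m \<alpha> (2 * 4 ^ Suc m * K * L) (pd i (\<lambda>x. f x * g x))" for i
    unfolding pdm by (rule hoelder_bd_mono) simp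
  moreover have "\<bar>f x * g x\<bar> \<le> 2 * 4 ^ Suc m * K * L" for x
  proof -
    have "\<bar>f x * g x\<bar> \<le> K * L" unfolding abs_mult using Suc.prems by (intro mult_mono) (auto simp: K)
    also have "\<dots> \<le> (2 * 4 ^ Suc m) * (K * L)"
    proof -
      have "1 \<le> (4::real) ^ Suc m" by (rule one_le_power) simp
      then have "1 \<le> 2 * (4::real) ^ Suc m" by linarith
      then show ?thesis using mult_right_mono[of 1 "2 * 4 ^ Suc m" "K * L"] K by simp
    qed
    finally show ?thesis by (simp add: mult.assoc)
  qed
  ultimately show ?case using Suc.prems by (auto intro!: differentiable_mult)
qed

lemma hoelder_bd_fseries:
  assumes \<alpha>: "0 < \<alpha>" "\<alpha> \<le> 1"
  shows "wsummable (real m + \<alpha>) a \<Longrightarrow> hoelder_bd m \<alpha> (4 * pi * (2 * pi) ^ m * wnorm (real m + \<alpha>) a) (fseries a)"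
proof (induction m arbitrary: a)
  case 0
  have "\<bar>fseries a x\<bar> \<le> 4 * pi * wnorm \<alpha> a" for x
  proof -
    have "\<bar>fseries a x\<bar> \<le> wnorm \<alpha> a"
      using fseries_bound[of a x] wsummable_mono[of \<alpha> a 0] 0 \<alpha> by simp
    also have "\<dots> \<le> 4 * pi * wnorm \<alpha> a" using mult_right_mono[of 1 "4 * pi" "wnorm \<alpha> a"] pi_gt3 by simp
    finally show ?thesis .
  qed
  then show ?case using fseries_holder[of \<alpha> a] 0 \<alpha> by simp
next
  case (Suc m)
  let ?K = "4 * pi * (2 * pi) ^ Suc m * wnorm (real (Suc m) + \<alpha>) a"
  have a1: "wsummable (1 + \<alpha>) a" using wsummable_mono(1)[OF Suc.prems] by simp
  have d: "wsummable (real m + \<alpha>) (dcoef i a)" "wnorm (real m + \<alpha>) (dcoef i a) \<le> 2 * pi * wnorm (real (Suc m) + \<alpha>) a" for i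
    using wsummable_dcoef[OF Suc.prems, of i] by (simp_all add: algebra_simps)
  have "hoelder_bd m \<alpha> ?K (pd i (fseries a))" for i
    unfolding pd_fseries[OF a1 \<alpha>]
    by (rule hoelder_bd_mono[OF Suc.IH[OF d(1)]]) (use d(2)[of i] in \<open>simp add: mult_left_mono mult.assoc\<close>)
  moreover have "fseries a differentiable (at x)" for x
    using fseries_has_derivative[OF a1 \<alpha>] by (auto simp: differentiable_def)
  moreover have "\<bar>fseries a x\<bar> \<le> ?K" for x
  proof -
    have "\<bar>fseries a x\<bar> \<le> 1 * wnorm (real (Suc m) + \<alpha>) a"
      using fseries_bound[of a x] wsummable_mono[OF Suc.prems, of 0] \<alpha> by simp
    also have "\<dots> \<le> (4 * pi * (2 * pi) ^ Suc m) * wnorm (real (Suc m) + \<alpha>) a"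
    proof (intro mult_right_mono wnorm_nonneg)
      have "1 \<le> (2 * pi) ^ Suc m" using pi_gt3 by (intro one_le_power) simp
      then have "1 * 1 \<le> 4 * pi * (2 * pi) ^ Suc m" using pi_gt3 by (intro mult_mono) auto
      then show "1 \<le> 4 * pi * (2 * pi) ^ Suc m" by simp
    qed
    finally show ?thesis .
  qed
  ultimately show ?case by (simp del: of_nat_Suc power_Suc)
qed


lemma hoelder_bd_pd_iter: "hoelder_bd (j + m) \<alpha> K f \<Longrightarrow> hoelder_bd m \<alpha> K ((pd i ^^ j) f)"
proof (induction j arbitrary: f)
  case (Suc j)
  then have "hoelder_bd m \<alpha> K ((pd i ^^ j) (pd i f))" by (intro Suc.IH) simp
  then show ?case by (simp add: funpow_swap1)
qed simp

lemma hoelder_bd_mixed_pd: "hoelder_bd (a + b + m) \<alpha> K f \<Longrightarrow> hoelder_bd m \<alpha> K (mixed_pd a b f)"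
  unfolding mixed_pd_def by (intro hoelder_bd_pd_iter) (simp add: ac_simps)

text \<open>The number of summands in \<open>holder_norm k \<alpha>\<close>, each of which
  \<open>hoelder_bd\<close> bounds by the same constant.\<close>

definition pd_count :: "nat \<Rightarrow> real" where
  "pd_count k = real (card {(a::nat, b). a + b \<le> k}) + real (card {(a::nat, b). a + b = k})"

lemma finite_pd_indices: "finite {(a::nat, b). a + b \<le> k}" "finite {(a::nat, b). a + b = k}"
proof -
  have "{(a::nat, b). a + b \<le> k} \<subseteq> {..k} \<times> {..k}" "{(a::nat, b). a + b = k} \<subseteq> {..k} \<times> {..k}" by auto
  then show "finite {(a::nat, b). a + b \<le> k}" "finite {(a::nat, b). a + b = k}"
    using finite_subset by blast+
qed

lemma holder_continuous_bdd_above: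
  assumes "\<And>x y. \<bar>f x - f y\<bar> \<le> K * dist x y powr \<alpha>"
  shows "\<forall>z\<in>{(x, y). x \<noteq> y}. (case z of (x, y) \<Rightarrow> \<bar>f x - f y\<bar> / dist x y powr \<alpha>) \<le> K"
  using assms by (auto simp: divide_le_eq)

lemma distinct_points: "{(x, y :: real^2). x \<noteq> y} \<noteq> {}"
proof -
  have "axis 1 1 \<noteq> (0 :: real^2)" by (simp add: axis_eq_0_iff)
  then show ?thesis by auto
qed

lemma hoelder_bd_imp_holder_norm:
  assumes f: "hoelder_bd m \<alpha> K f" and per: "periodic f" and \<alpha>: "0 < \<alpha>"
  shows "f \<in> holder_space m \<alpha>" "holder_norm m \<alpha> f \<le> pd_count m * K"
proof -
  have hol: "\<bar>mixed_pd a b f x - mixed_pd a b f y\<bar> \<le> K * dist x y powr \<alpha>" if "a + b = m" for a b x y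
    using hoelder_bd_mixed_pd[of a b 0 \<alpha> K f] f that by simp
  have sup: "\<bar>mixed_pd a b f x\<bar> \<le> K" if "a + b \<le> m" for a b x
  proof -
    have "hoelder_bd (m - (a + b)) \<alpha> K (mixed_pd a b f)"
      by (rule hoelder_bd_mixed_pd) (use f that in simp)
    then show ?thesis by (rule hoelder_bd_abs)
  qed
  show "f \<in> holder_space m \<alpha>"
    using hol per hoelder_bd_C_k[OF f \<alpha>] unfolding holder_space_def holder_continuous_def by blast
  have "(\<Sum>(a, b)\<in>{(a, b). a + b \<le> m}. SUP x. \<bar>mixed_pd a b f x\<bar>) \<le> of_nat (card {(a::nat, b). a + b \<le> m}) * K"
    by (rule sum_bounded_above) (auto intro!: cSUP_least sup)
  moreover have "(\<Sum>(a, b)\<in>{(a, b). a + b = m}. holder_seminorm \<alpha> (mixed_pd a b f)) \<le> of_nat (card {(a::nat, b). a + b = m}) * K"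
  proof (rule sum_bounded_above)
    fix z :: "nat \<times> nat" assume "z \<in> {(a, b). a + b = m}"
    then show "(case z of (a, b) \<Rightarrow> holder_seminorm \<alpha> (mixed_pd a b f)) \<le> K"
      using holder_continuous_bdd_above[OF hol] unfolding holder_seminorm_def
      by (auto intro!: cSUP_least distinct_points)
  qed
  ultimately show "holder_norm m \<alpha> f \<le> pd_count m * K"
    by (simp add: holder_norm_def pd_count_def distrib_right)
qed

lemma holder_seminorm_bound:
  assumes "holder_continuous \<alpha> f"
  shows "\<bar>f x - f y\<bar> \<le> holder_seminorm \<alpha> f * dist x y powr \<alpha>" "0 \<le> holder_seminorm \<alpha> f"
proof -
  obtain K where K: "\<And>x y. \<bar>f x - f y\<bar> \<le> K * dist x y powr \<alpha>"
    using assms unfolding holder_continuous_def by blast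
  have bdd: "bdd_above ((\<lambda>(x, y). \<bar>f x - f y\<bar> / dist x y powr \<alpha>) ` {(x, y). x \<noteq> y})"
    using holder_continuous_bdd_above[OF K] unfolding bdd_above_def by blast
  have le: "\<bar>f x - f y\<bar> / dist x y powr \<alpha> \<le> holder_seminorm \<alpha> f" if "x \<noteq> y" for x y
    unfolding holder_seminorm_def using cSUP_upper[OF _ bdd, of "(x, y)"] that by simp
  show "\<bar>f x - f y\<bar> \<le> holder_seminorm \<alpha> f * dist x y powr \<alpha>"
    using le[of x y] by (cases "x = y") (auto simp: divide_le_eq)
  obtain x y :: "real^2" where "x \<noteq> y" using distinct_points by blast
  then have "0 \<le> \<bar>f x - f y\<bar> / dist x y powr \<alpha>" by simp
  also have "\<dots> \<le> holder_seminorm \<alpha> f" by (rule le) fact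
  finally show "0 \<le> holder_seminorm \<alpha> f" .
qed

lemma pd_pd_iter_commute:
  assumes "C_k (Suc a) g" "periodic g"
  shows "pd i ((pd j ^^ a) g) = (pd j ^^ a) (pd i g)"
  using assms
proof (induction a)
  case (Suc a)
  have "C_k 2 ((pd j ^^ a) g)" using C_k_pd_iter[of 2 a g j] Suc.prems(1) by (simp del: C_k.simps)
  then have "pd i (pd j ((pd j ^^ a) g)) = pd j (pd i ((pd j ^^ a) g))"
    by (intro pd_commute periodic_pd_iter Suc.prems)
  then show ?case using Suc.IH C_k_lower[OF Suc.prems(1)] Suc.prems(2) by simp
qed simp

text \<open>Every summand is at most the sum because all are nonnegative. The suprema are
  real-valued, so they bound anything only because continuous periodic functions are bounded and the
  Hoelder quotients are bounded by assumption.\<close>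

lemma holder_norm_bounds:
  assumes f: "f \<in> holder_space k \<alpha>"
  shows "a + b \<le> k \<Longrightarrow> \<bar>mixed_pd a b f x\<bar> \<le> holder_norm k \<alpha> f"
    and "a + b = k \<Longrightarrow> \<bar>mixed_pd a b f x - mixed_pd a b f y\<bar> \<le> holder_norm k \<alpha> f * dist x y powr \<alpha>"
    and "0 \<le> holder_norm k \<alpha> f"
proof -
  have C: "C_k k f" and per: "periodic f"
    and hc: "\<And>a b. a + b = k \<Longrightarrow> holder_continuous \<alpha> (mixed_pd a b f)"
    using f by (auto simp: holder_space_def)
  have le: "\<bar>mixed_pd a b f x\<bar> \<le> (SUP x. \<bar>mixed_pd a b f x\<bar>)" if "a + b \<le> k" for a b x
  proof -
    have "C_k 0 (mixed_pd a b f)" unfolding mixed_pd_def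
      using C_k_mono[OF C that] by (intro C_k_pd_iter) simp
    moreover have "periodic (mixed_pd a b f)" unfolding mixed_pd_def by (intro periodic_pd_iter per)
    ultimately obtain K where K: "\<And>x. \<bar>mixed_pd a b f x\<bar> \<le> K" using periodic_bounded[of "mixed_pd a b f"] by auto
    show ?thesis by (rule cSUP_upper) (auto intro!: bdd_aboveI2[where M = K] K)
  qed
  define A where "A = (\<Sum>(a, b)\<in>{(a, b). a + b \<le> k}. SUP x. \<bar>mixed_pd a b f x\<bar>)"
  define S where "S = (\<Sum>(a, b)\<in>{(a, b). a + b = k}. holder_seminorm \<alpha> (mixed_pd a b f))"
  have N: "holder_norm k \<alpha> f = A + S" by (simp add: holder_norm_def A_def S_def)
  have sup0: "0 \<le> (SUP x. \<bar>mixed_pd a b f x\<bar>)" if "a + b \<le> k" for a b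
    using le[OF that, of 0] abs_ge_zero order_trans by blast
  have A: "(SUP x. \<bar>mixed_pd a b f x\<bar>) \<le> A" if "a + b \<le> k" for a b
    unfolding A_def
    using member_le_sum[of "(a, b)" "{(a, b). a + b \<le> k}" "\<lambda>(a, b). SUP x. \<bar>mixed_pd a b f x\<bar>"] that sup0 finite_pd_indices
    by auto
  have S: "holder_seminorm \<alpha> (mixed_pd a b f) \<le> S" if "a + b = k" for a b
    unfolding S_def
    using member_le_sum[of "(a, b)" "{(a, b). a + b = k}" "\<lambda>(a, b). holder_seminorm \<alpha> (mixed_pd a b f)"]
      that holder_seminorm_bound(2)[OF hc] finite_pd_indices
    by auto
  have A0: "0 \<le> A" and S0: "0 \<le> S"
    unfolding A_def S_def using sup0 holder_seminorm_bound(2)[OF hc] by (auto intro!: sum_nonneg)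
  show "0 \<le> holder_norm k \<alpha> f" using A0 S0 N by simp
  show "\<bar>mixed_pd a b f x\<bar> \<le> holder_norm k \<alpha> f" if "a + b \<le> k"
    using le[OF that, of x] A[OF that] S0 N by linarith
  show "\<bar>mixed_pd a b f x - mixed_pd a b f y\<bar> \<le> holder_norm k \<alpha> f * dist x y powr \<alpha>" if "a + b = k"
  proof -
    have "holder_seminorm \<alpha> (mixed_pd a b f) * dist x y powr \<alpha> \<le> holder_norm k \<alpha> f * dist x y powr \<alpha>"
      using S[OF that] A0 N by (intro mult_right_mono) auto
    then show ?thesis using holder_seminorm_bound(1)[OF hc[OF that], of x y] by linarith
  qed
qed

text \<open>\<open>holder_norm\<close> sees derivatives only in the order fixed by
  \<open>mixed_pd\<close>, whereas \<open>hoelder_bd\<close> asks for every order. Moving each new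
  \<open>pd 2\<close> past the iterated \<open>pd 1\<close> brings it into the form
  \<open>mixed_pd\<close>.\<close>

lemma holder_space_imp_hoelder_bd:
  assumes f: "f \<in> holder_space k \<alpha>"
  shows "hoelder_bd k \<alpha> (holder_norm k \<alpha> f) f"
proof -
  have C: "C_k k f" and per: "periodic f" using f by (auto simp: holder_space_def)
  have "hoelder_bd j \<alpha> (holder_norm k \<alpha> f) (mixed_pd a b f)" if "a + b + j = k" for j a b
    using that
  proof (induction j arbitrary: a b)
    case 0
    then show ?case using holder_norm_bounds[OF f] by simp
  next
    case (Suc j)
    have 1: "pd 1 (mixed_pd a b f) = mixed_pd (Suc a) b f" by (simp add: mixed_pd_def)
    have "C_k (Suc a) ((pd 2 ^^ b) f)"
      by (intro C_k_pd_iter C_k_mono[OF C]) (use Suc.prems in simp)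
    then have 2: "pd 2 (mixed_pd a b f) = mixed_pd a (Suc b) f"
      unfolding mixed_pd_def by (simp add: pd_pd_iter_commute periodic_pd_iter per)
    have "C_k (Suc 0) (mixed_pd a b f)"
      unfolding mixed_pd_def by (intro C_k_pd_iter C_k_mono[OF C]) (use Suc.prems in simp)
    moreover have "hoelder_bd j \<alpha> (holder_norm k \<alpha> f) (pd i (mixed_pd a b f))" for i
      using exhaust_2[of i] 1 2 Suc.IH[of "Suc a" b] Suc.IH[of a "Suc b"] Suc.prems by auto
    ultimately show ?case using holder_norm_bounds(1)[OF f, of a b] Suc.prems by simp
  qed
  from this[of 0 0 k] show ?thesis by (simp add: mixed_pd_def)
qed

section \<open>Optimal transport by a gradient perturbation of the identity\<close>

text \<open>The determinant of I + D^2 v, that is, the Jacobian determinant of x + grad v.\<close>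

definition jac :: "(real^2 \<Rightarrow> real) \<Rightarrow> real^2 \<Rightarrow> real" where
  "jac v x = (1 + pd 1 (pd 1 v) x) * (1 + pd 2 (pd 2 v) x) - pd 1 (pd 2 v) x * pd 2 (pd 1 v) x"

lemma grad_nth: "grad f x $ i = pd i f x"
  using exhaust_2[of i] by (auto simp: grad_def)

lemma grad_inner: "grad f x \<bullet> d = (\<Sum>i\<in>UNIV. pd i f x * d $ i)"
  by (simp add: inner_vec_def grad_nth)

lemma grad_eq: "grad f = (\<lambda>x. \<chi> j. pd j f x)"
  by (simp add: fun_eq_iff vec_eq_iff grad_nth)

lemma det_2_matrix: "det (matrix f :: real^2^2) = f (axis 1 1) $ 1 * f (axis 2 1) $ 2 - f (axis 2 1) $ 1 * f (axis 1 1) $ 2"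
  by (simp add: det_2 matrix_def)

text \<open>In the application \<open>v\<close> is \<epsilon> times \<open>psi\<close>. The last
  assumption says that I + D^2 v is bounded below by \<open>l\<close>, so |x|^2 / 2 + v is strongly
  convex.\<close>

locale transport_potential =
  fixes v :: "real^2 \<Rightarrow> real" and l :: real
  assumes v: "C_k 2 v" and per: "periodic v" and l: "0 < l"
    and elliptic: "\<And>x d. l * (norm d)\<^sup>2 \<le> (norm d)\<^sup>2 + (\<Sum>i\<in>UNIV. \<Sum>j\<in>UNIV. pd i (pd j v) x * d $ i * d $ j)"
begin

section \<open>The gradient map of a strongly convex potential\<close>

definition T :: "real^2 \<Rightarrow> real^2" where "T x = x + grad v x"

text \<open>As a function of \<open>x\<close> this differs from |x|^2 / 2 + v by an affine function,
  hence is strongly convex, and its gradient is T x - y. Its minimiser is therefore the point that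
  \<open>T\<close> sends to \<open>y\<close>.\<close>

definition cost :: "real^2 \<Rightarrow> real^2 \<Rightarrow> real" where "cost y x = (norm (x - y))\<^sup>2 / 2 + v x"

lemma v_diff: "v differentiable (at x)" and pd_v_diff: "pd i v differentiable (at x)"
  and v_cont: "continuous_on UNIV v" and pd_v_cont: "continuous_on UNIV (pd i v)"
  and pd2_v_cont: "continuous_on UNIV (pd i (pd j v))"
  using v C_k_continuous[OF v] C_k_continuous[of 1 "pd i v"] by (auto simp: numeral_2_eq_2)

lemma T_cont: "continuous_on UNIV T"
  unfolding T_def grad_eq by (intro continuous_intros continuous_on_vec_lambda pd_v_cont)

lemma grad_cont: "continuous_on UNIV (grad v)"
proof -
  have "continuous_on UNIV (\<lambda>x. T x - x)" by (intro continuous_intros T_cont)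
  then show ?thesis by (simp add: T_def)
qed

lemma cost_deriv:
  "((\<lambda>t. cost y (z + t *\<^sub>R d)) has_real_derivative ((T (z + t *\<^sub>R d) - y) \<bullet> d)) (at t)"
proof -
  have "((\<lambda>t. (norm (z + t *\<^sub>R d - y))\<^sup>2 / 2) has_real_derivative ((z + t *\<^sub>R d - y) \<bullet> d)) (at t)"
    unfolding power2_norm_eq_inner has_field_derivative_def
    by (auto intro!: derivative_eq_intros simp: inner_commute algebra_simps fun_eq_iff) (simp add: field_simps)
  from DERIV_add[OF this has_real_derivative_along[where f = v and x = z and t = t and d = d, OF v_diff]]
  show ?thesis
    by (simp add: cost_def T_def grad_inner inner_add_left inner_diff_left algebra_simps)
qed

lemma cost_deriv2:
  "((\<lambda>t. (T (z + t *\<^sub>R d) - y) \<bullet> d) has_real_derivative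
     ((norm d)\<^sup>2 + (\<Sum>i\<in>UNIV. \<Sum>j\<in>UNIV. pd i (pd j v) (z + t *\<^sub>R d) * d $ i * d $ j))) (at t)"
proof -
  have 1: "((\<lambda>t. (z + t *\<^sub>R d - y) \<bullet> d) has_real_derivative (norm d)\<^sup>2) (at t)"
    unfolding power2_norm_eq_inner has_field_derivative_def
    by (auto intro!: derivative_eq_intros simp: algebra_simps fun_eq_iff)
  have 2: "((\<lambda>t. \<Sum>j\<in>UNIV. pd j v (z + t *\<^sub>R d) * d $ j) has_real_derivative
     (\<Sum>j\<in>UNIV. (\<Sum>i\<in>UNIV. pd i (pd j v) (z + t *\<^sub>R d) * d $ i) * d $ j)) (at t)"
    by (intro DERIV_sum DERIV_cmult_right has_real_derivative_along pd_v_diff)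
  have "(\<Sum>j\<in>UNIV. (\<Sum>i\<in>UNIV. pd i (pd j v) (z + t *\<^sub>R d) * d $ i) * d $ j) =
     (\<Sum>i\<in>UNIV. \<Sum>j\<in>UNIV. pd i (pd j v) (z + t *\<^sub>R d) * d $ i * d $ j)"
    by (simp add: sum_UNIV_2 algebra_simps)
  moreover have "(\<lambda>t. (T (z + t *\<^sub>R d) - y) \<bullet> d) = (\<lambda>t. (z + t *\<^sub>R d - y) \<bullet> d + (\<Sum>j\<in>UNIV. pd j v (z + t *\<^sub>R d) * d $ j))"
    by (simp add: fun_eq_iff T_def grad_inner inner_add_left inner_diff_left)
  ultimately show ?thesis using DERIV_add[OF 1 2] by simp
qed

text \<open>Along the segment from \<open>z\<close> to \<open>x\<close> the second derivative is at
  least l |d|^2; two monotonicity arguments integrate this twice.\<close>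

lemma cost_strongly_convex:
  "cost y z + (T z - y) \<bullet> (x - z) + l / 2 * (norm (x - z))\<^sup>2 \<le> cost y x"
proof -
  define d where "d = x - z"
  define g' where "g' t = (T (z + t *\<^sub>R d) - y) \<bullet> d" for t
  have mono: "g' 0 + l * (norm d)\<^sup>2 * t \<le> g' t" if "0 \<le> t" for t
  proof -
    have "g' 0 - l * (norm d)\<^sup>2 * 0 \<le> g' t - l * (norm d)\<^sup>2 * t"
    proof (rule DERIV_nonneg_imp_nondecreasing[OF that])
      fix s
      show "\<exists>y. ((\<lambda>t. g' t - l * (norm d)\<^sup>2 * t) has_real_derivative y) (at s) \<and> 0 \<le> y"
        unfolding g'_def using elliptic[of d "z + s *\<^sub>R d"]
        by (intro exI[of _ "(norm d)\<^sup>2 + (\<Sum>i\<in>UNIV. \<Sum>j\<in>UNIV. pd i (pd j v) (z + s *\<^sub>R d) * d $ i * d $ j) - l * (norm d)\<^sup>2"]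
            conjI DERIV_diff cost_deriv2 DERIV_cmult_Id) simp
    qed
    then show ?thesis by simp
  qed
  have "cost y (z + 0 *\<^sub>R d) - (g' 0 * 0 + l / 2 * (norm d)\<^sup>2 * 0\<^sup>2) \<le> cost y (z + 1 *\<^sub>R d) - (g' 0 * 1 + l / 2 * (norm d)\<^sup>2 * 1\<^sup>2)"
  proof (rule DERIV_nonneg_imp_nondecreasing[of 0 "1::real" "\<lambda>t. cost y (z + t *\<^sub>R d) - (g' 0 * t + l / 2 * (norm d)\<^sup>2 * t\<^sup>2)"])
    fix s :: real assume "0 \<le> s"
    have "((\<lambda>t. g' 0 * t + l / 2 * (norm d)\<^sup>2 * t\<^sup>2) has_real_derivative (g' 0 + l * (norm d)\<^sup>2 * s)) (at s)"
      by (auto intro!: derivative_eq_intros)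
    then show "\<exists>w. ((\<lambda>t. cost y (z + t *\<^sub>R d) - (g' 0 * t + l / 2 * (norm d)\<^sup>2 * t\<^sup>2)) has_real_derivative w) (at s) \<and> 0 \<le> w"
      using mono[OF \<open>0 \<le> s\<close>] cost_deriv[of y z d s]
      by (intro exI[of _ "g' s - (g' 0 + l * (norm d)\<^sup>2 * s)"] conjI DERIV_diff) (simp_all add: g'_def)
  qed simp
  then show ?thesis by (simp add: d_def g'_def)
qed

text \<open>Add the two strong convexity inequalities with \<open>x\<close> and \<open>z\<close>
  exchanged.\<close>

lemma T_monotone: "l * (norm (x - z))\<^sup>2 \<le> (T x - T z) \<bullet> (x - z)"
  using cost_strongly_convex[of 0 z x] cost_strongly_convex[of 0 x z]
  by (simp add: inner_diff_left inner_diff_right norm_minus_commute[of z x] algebra_simps)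

lemma T_expand: "l * norm (x - z) \<le> norm (T x - T z)"
proof (cases "x = z")
  case False
  have "l * (norm (x - z))\<^sup>2 \<le> norm (T x - T z) * norm (x - z)"
    using T_monotone[of x z] norm_cauchy_schwarz[of "T x - T z" "x - z"] by linarith
  then show ?thesis using False by (simp add: power2_eq_square mult.assoc[symmetric])
qed simp

lemma inj_T: "inj T"
proof (rule injI)
  fix x z assume "T x = T z"
  then have "l * norm (x - z) \<le> 0" using T_expand[of x z] by simp
  then show "x = z" using l by (simp add: mult_le_0_iff)
qed

text \<open>A minimiser of \<open>cost y\<close> is a critical point and hence a preimage of
  \<open>y\<close>. Boundedness of \<open>v\<close> confines the minimisation to a ball.\<close>

lemma surj_T: "\<exists>z. T z = y"
proof -
  obtain K where K: "\<And>x. \<bar>v x\<bar> \<le> K" using periodic_bounded[OF v_cont per] by blast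
  have K0: "0 \<le> K" using K[of 0] by linarith
  \<comment> \<open>Outside the ball the cost is at least R^2 / 2 - K. Since R^2 >= 4K this is at
    least K, which already bounds the cost at the centre \<open>y\<close>.\<close>
  define R where "R = 2 * K + 2"
  have cc: "continuous_on (cball y R) (cost y)"
    unfolding cost_def by (intro continuous_intros continuous_on_subset[OF v_cont]) auto
  have "cball y R \<noteq> {}" using K0 by (simp add: R_def)
  then obtain z where z: "z \<in> cball y R" "\<And>x. x \<in> cball y R \<Longrightarrow> cost y z \<le> cost y x"
    using continuous_attains_inf[OF compact_cball _ cc] by blast
  have min: "cost y z \<le> cost y x" for x
  proof (cases "x \<in> cball y R")
    case False
    then have "R \<le> norm (x - y)" by (simp add: dist_norm norm_minus_commute)
    then have "R\<^sup>2 \<le> (norm (x - y))\<^sup>2" using K0 by (intro power_mono) (auto simp: R_def)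
    moreover have "4 * K \<le> R\<^sup>2" using K0 by (simp add: R_def power2_eq_square algebra_simps)
    ultimately have "K \<le> cost y x" using K[of x] unfolding cost_def abs_le_iff by linarith
    moreover have "cost y z \<le> K"
      using z(2)[of y] K[of y] K0 by (auto simp: cost_def R_def)
    ultimately show ?thesis by linarith
  qed (rule z(2))
  \<comment> \<open>The directional derivative is taken along T z - y itself, so its vanishing says
    |T z - y|^2 = 0.\<close>
  have "(T (z + 0 *\<^sub>R (T z - y)) - y) \<bullet> (T z - y) = 0"
    by (rule DERIV_local_min[OF cost_deriv[of y z "T z - y" 0], of 1]) (auto simp: min)
  then show ?thesis by (intro exI[of _ z]) simp
qed

section \<open>The inverse map and the Kantorovich dual potential\<close>

definition S :: "real^2 \<Rightarrow> real^2" where "S = inv T"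

lemma T_S [simp]: "T (S y) = y"
proof -
  obtain z where "T z = y" using surj_T by blast
  then show ?thesis unfolding S_def by (intro f_inv_into_f) blast
qed

lemma S_T [simp]: "S (T x) = x" unfolding S_def by (rule inv_f_f[OF inj_T])

lemma S_lipschitz: "norm (S y - S z) \<le> norm (y - z) / l"
  using T_expand[of "S y" "S z"] l by (simp add: le_divide_eq mult.commute)

lemma S_cont: "continuous_on UNIV S"
proof (rule continuous_onI)
  fix x :: "real^2" and e :: real assume "0 < e"
  have "norm (S y - S x) \<le> e" if "norm (y - x) < l * e" for y
  proof -
    have "norm (y - x) / l \<le> e" using that l by (simp add: divide_le_eq mult.commute)
    then show ?thesis using S_lipschitz[of y x] by linarith
  qed
  then show "\<exists>d>0. \<forall>x'\<in>UNIV. dist x' x < d \<longrightarrow> dist (S x') (S x) \<le> e"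
    using l \<open>0 < e\<close> by (intro exI[of _ "l * e"]) (auto simp: dist_norm)
qed

lemma grad_periodic: "n \<in> int_lattice \<Longrightarrow> grad v (x + n) = grad v x"
  by (simp add: grad_def periodicD[OF periodic_pd[OF per]])

lemma T_periodic: "n \<in> int_lattice \<Longrightarrow> T (x + n) = T x + n"
  by (simp add: T_def grad_periodic)

lemma S_periodic: "n \<in> int_lattice \<Longrightarrow> S (y + n) = S y + n"
  using S_T[of "S y + n"] by (simp add: T_periodic del: S_T)

text \<open>The minimum of \<open>cost y\<close> over all points, attained at \<open>S y\<close>:
  the quadratic-cost transform (Hopf-Lax formula) of \<open>v\<close>, serving as the dual potential
  on the target side.\<close>

definition dual :: "real^2 \<Rightarrow> real" where "dual y = cost y (S y)"

lemma dual_cont: "continuous_on UNIV dual"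
  unfolding dual_def cost_def
  by (intro continuous_intros S_cont continuous_on_compose2[OF v_cont S_cont]) auto

lemma dual_periodic: "periodic dual"
  by (simp add: periodic_def dual_def cost_def S_periodic periodicD[OF per])

lemma dual_T: "dual (T x) = (norm (grad v x))\<^sup>2 / 2 + v x"
  unfolding dual_def cost_def S_T by (simp add: T_def norm_minus_commute)

text \<open>At \<open>S y\<close> the first-order term of strong convexity vanishes. The quadratic
  surplus is kept because it measures the distance from the optimal map in the uniqueness
  proof.\<close>

lemma cost_ge_dual: "dual y + l / 2 * (norm (x - S y))\<^sup>2 \<le> cost y x"
  using cost_strongly_convex[of y "S y" x] by (simp add: dual_def)

text \<open>Admissibility in the Kantorovich dual problem for the torus distance:
  \<open>dual\<close> is periodic, so the Euclidean inequality may be used at every lattice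
  translate of \<open>y\<close>, in particular near the closest one.\<close>

lemma torus_dist_ge: "2 * (dual y - v x) \<le> (torus_dist x y)\<^sup>2"
proof -
  define c where "c = sqrt (max 0 (2 * (dual y - v x)))"
  have ne: "int_lattice \<noteq> {}" using int_lattice_0 by blast
  have "c \<le> torus_dist x y"
    unfolding torus_dist_def infdist_notempty[OF ne]
  proof (rule cINF_greatest[OF ne])
    fix n assume n: "n \<in> int_lattice"
    have "dual y \<le> cost (y + n) x"
      using cost_ge_dual[of "y + n" x] l periodicD[OF dual_periodic n, of y]
      by (smt (verit) mult_nonneg_nonneg zero_le_power2 half_gt_zero less_imp_le)
    then have "2 * (dual y - v x) \<le> (norm (x - y - n))\<^sup>2" by (simp add: cost_def diff_diff_eq)
    then have "c \<le> sqrt ((norm (x - y - n))\<^sup>2)" unfolding c_def by (intro real_sqrt_le_mono) simp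
    then show "c \<le> dist (x - y) n" by (simp add: dist_norm)
  qed
  moreover have "0 \<le> c" by (simp add: c_def)
  ultimately have "c\<^sup>2 \<le> (torus_dist x y)\<^sup>2" by (intro power_mono)
  then show ?thesis by (simp add: c_def)
qed

lemma torus_dist_le: "(torus_dist x (frac_vec (T x)))\<^sup>2 \<le> (norm (grad v x))\<^sup>2"
proof -
  have "torus_dist x (frac_vec (T x)) \<le> dist (x - frac_vec (T x)) (T x - frac_vec (T x))"
    unfolding torus_dist_def by (intro infdist_le diff_frac_vec)
  also have "\<dots> = norm (grad v x)" by (simp add: dist_norm T_def)
  finally show ?thesis by (intro power_mono) (simp_all add: torus_dist_def infdist_nonneg)
qed

section \<open>Change of variables and the push-forward of the density\<close>

lemma T_has_derivative:
  "(T has_derivative (\<lambda>h. h + (\<chi> j. \<Sum>i\<in>UNIV. pd i (pd j v) x * h $ i))) (at x)"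
proof -
  have "(grad v has_derivative (\<lambda>h. \<chi> j. \<Sum>i\<in>UNIV. pd i (pd j v) x * h $ i)) (at x)"
  proof -
    have "(\<lambda>h. (\<Sum>i\<in>UNIV. pd i (pd j v) x * h $ i)) = (\<lambda>h. (\<chi> j. \<Sum>i\<in>UNIV. pd i (pd j v) x * h $ i) \<bullet> axis j 1)" for j
      by (simp add: inner_axis)
    then have *: "((\<lambda>x. grad v x \<bullet> axis j 1) has_derivative (\<lambda>h. (\<chi> j. \<Sum>i\<in>UNIV. pd i (pd j v) x * h $ i) \<bullet> axis j 1)) (at x)" for j
      using differentiable_has_derivative_pd[OF pd_v_diff, of j x] by (simp add: inner_axis grad_nth)
    show ?thesis
    proof (rule has_derivative_componentwise_within[THEN iffD2], rule ballI)
      fix b :: "real^2" assume "b \<in> Basis"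
      then obtain j where "b = axis j 1" unfolding Basis_vec_def by auto
      then show "((\<lambda>x. grad v x \<bullet> b) has_derivative (\<lambda>h. (\<chi> j. \<Sum>i\<in>UNIV. pd i (pd j v) x * h $ i) \<bullet> b)) (at x)"
        using * by simp
    qed
  qed
  then show ?thesis unfolding T_def[abs_def] by (intro derivative_intros)
qed

lemma det_T: "det (matrix (\<lambda>h. h + (\<chi> j. \<Sum>i\<in>UNIV. pd i (pd j v) x * h $ i))) = jac v x"
  unfolding det_2_matrix by (simp add: jac_def sum_UNIV_2 axis_def algebra_simps)

lemma jac_cont: "continuous_on UNIV (jac v)"
  unfolding jac_def by (intro continuous_intros pd2_v_cont)

lemma jac_periodic: "periodic (jac v)"
  using periodicD[OF periodic_pd[OF periodic_pd[OF per]]] by (simp add: periodic_def jac_def)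

lemma T_borel [measurable]: "T \<in> borel_measurable borel"
  by (rule borel_measurable_continuous_onI[OF T_cont])

lemma S_borel [measurable]: "S \<in> borel_measurable borel"
  by (rule borel_measurable_continuous_onI[OF S_cont])

lemma frac_T_measurable: "(\<lambda>x. frac_vec (T x)) \<in> measurable torus torus"
  unfolding torus_eq by (intro measurable_restrict_space2 measurable_restrict_space1) auto

lemma push_forward:
  assumes pos: "\<And>x. 0 \<le> jac v x"
  shows "distr (density torus (\<lambda>x. ennreal (jac v x))) torus (\<lambda>x. frac_vec (T x)) = torus"
proof (rule measure_eqI)
  have jm [measurable]: "jac v \<in> borel_measurable borel" by (rule borel_measurable_continuous_onI[OF jac_cont])
  obtain K where K: "\<And>x. \<bar>jac v x\<bar> \<le> K" using periodic_bounded[OF jac_cont jac_periodic] by blast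
  fix A assume "A \<in> sets (distr (density torus (\<lambda>x. ennreal (jac v x))) torus (\<lambda>x. frac_vec (T x)))"
  then have At: "A \<in> sets torus" by simp
  then have A: "A \<in> sets borel" "A \<subseteq> unit_square"
    by (auto simp: sets_torus sets_restrict_space)
  note [measurable] = A(1)
  define R where "R = {x \<in> unit_square. frac_vec (T x) \<in> A}"
  have R [measurable]: "R \<in> sets borel"
  proof -
    have "(\<lambda>x. frac_vec (T x)) \<in> borel_measurable borel" by measurable
    from measurable_sets[OF this A(1)] have "unit_square \<inter> (\<lambda>x. frac_vec (T x)) -` A \<in> sets borel"
      by (intro sets.Int unit_square_borel) simp
    moreover have "R = unit_square \<inter> (\<lambda>x. frac_vec (T x)) -` A" by (auto simp: R_def)
    ultimately show ?thesis by simp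
  qed
  have TR: "T ` R = {y. S y \<in> unit_square \<and> frac_vec y \<in> A}"
  proof (intro set_eqI iffI)
    fix y assume "y \<in> {y. S y \<in> unit_square \<and> frac_vec y \<in> A}"
    then have "S y \<in> R" by (simp add: R_def)
    then have "T (S y) \<in> T ` R" by (rule imageI)
    then show "y \<in> T ` R" by simp
  qed (auto simp: R_def)
  have "{y \<in> space borel. S y \<in> unit_square \<and> frac_vec y \<in> A} \<in> sets borel" by measurable
  then have TRb: "T ` R \<in> sets borel" by (simp add: TR)
  define r where "r = enn2real (\<integral>\<^sup>+x. ennreal (jac v x * indicator R x) \<partial>lborel)"
  have "(\<integral>\<^sup>+x. ennreal (jac v x * indicator R x) \<partial>lborel) \<le> (\<integral>\<^sup>+x. ennreal K * indicator unit_square x \<partial>lborel)"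
    using K by (intro nn_integral_mono) (auto simp: R_def abs_le_iff intro!: ennreal_leI split: split_indicator)
  also have "\<dots> = ennreal K * emeasure lborel unit_square"
    by (subst nn_integral_cmult_indicator) auto
  also have "emeasure lborel unit_square = 1"
    using emeasure_torus unfolding torus_eq by (subst (asm) emeasure_restrict_space) (auto simp: space_restrict_space)
  finally have "(\<integral>\<^sup>+x. ennreal (jac v x * indicator R x) \<partial>lborel) < \<infinity>"
    by (simp add: le_less_trans less_top)
  then have r: "(\<integral>\<^sup>+x. ennreal (jac v x * indicator R x) \<partial>lborel) = ennreal r" "0 \<le> r"
    by (simp_all add: r_def)
  have "((\<lambda>x. jac v x * indicator R x) has_integral r) UNIV"
    by (rule nn_integral_has_integral[OF _ _ r]) (use pos in auto)
  moreover have "(\<lambda>x. jac v x * indicator R x) = (\<lambda>x. if x \<in> R then \<bar>det (matrix (\<lambda>h. h + (\<chi> j. \<Sum>i\<in>UNIV. pd i (pd j v) x * h $ i)))\<bar> else 0)"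
    using pos by (auto simp: fun_eq_iff det_T split: split_indicator)
  ultimately have "((\<lambda>x. \<bar>det (matrix (\<lambda>h. h + (\<chi> j. \<Sum>i\<in>UNIV. pd i (pd j v) x * h $ i)))\<bar>) has_integral r) R"
    by (simp add: has_integral_restrict_UNIV)
  then have m: "T ` R \<in> lmeasurable" "measure lebesgue (T ` R) = r"
    using has_measure_differentiable_image[of R T "\<lambda>x h. h + (\<chi> j. \<Sum>i\<in>UNIV. pd i (pd j v) x * h $ i)" r]
      R T_has_derivative[THEN has_derivative_at_withinI] inj_on_subset[OF inj_T] by auto
  have "emeasure (distr (density torus (\<lambda>x. ennreal (jac v x))) torus (\<lambda>x. frac_vec (T x))) A
     = emeasure (density torus (\<lambda>x. ennreal (jac v x))) ((\<lambda>x. frac_vec (T x)) -` A \<inter> unit_square)"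
    using At frac_T_measurable by (subst emeasure_distr) auto
  also have "(\<lambda>x. frac_vec (T x)) -` A \<inter> unit_square = R" by (auto simp: R_def)
  also have "emeasure (density torus (\<lambda>x. ennreal (jac v x))) R = (\<integral>\<^sup>+x. ennreal (jac v x) * indicator R x \<partial>torus)"
  proof (rule emeasure_density)
    show "R \<in> sets torus" using R by (auto simp: sets_torus sets_restrict_space R_def)
  qed (auto intro!: measurable_torus)
  also have "\<dots> = (\<integral>\<^sup>+x. ennreal (jac v x * indicator R x) \<partial>lborel)"
    unfolding torus_eq
    by (subst nn_integral_restrict_space)
       (auto intro!: nn_integral_cong simp: R_def split: split_indicator)
  also have "\<dots> = emeasure lebesgue (T ` R)"
    using m(2) r(1) emeasure_eq_ennreal_measure[OF fmeasurableD2[OF m(1)]] by simp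
  also have "\<dots> = emeasure lborel (T ` R)" using TRb by simp
  also have "\<dots> = (\<integral>\<^sup>+y. indicator (T ` R) y \<partial>lborel)" using TRb by simp
  also have "\<dots> = (\<integral>\<^sup>+y. indicator A (frac_vec y) * indicator (S -` unit_square) y \<partial>lborel)"
    unfolding TR by (intro nn_integral_cong) (auto split: split_indicator)
  also have "\<dots> = (\<integral>\<^sup>+y. indicator A (frac_vec y) * indicator unit_square y \<partial>lborel)"
  proof (rule nn_integral_fundamental_domain)
    show "S -` unit_square \<in> sets borel" using measurable_sets[OF S_borel unit_square_borel] by simp
    show "\<exists>!n. n \<in> int_lattice \<and> y + n \<in> S -` unit_square" for y
    proof -
      have "(n \<in> int_lattice \<and> y + n \<in> S -` unit_square) \<longleftrightarrow> (n \<in> int_lattice \<and> S y + n \<in> unit_square)" for n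
        using S_periodic[of n y] by auto
      then show ?thesis using unit_square_translate[of "S y"] by presburger
    qed
  qed (auto simp: frac_vec_add)
  also have "\<dots> = (\<integral>\<^sup>+x. indicator A x \<partial>lborel)"
    by (intro nn_integral_cong) (use A(2) frac_vec_id in \<open>auto split: split_indicator\<close>)
  also have "\<dots> = emeasure torus A"
    using A unfolding torus_eq by (subst emeasure_restrict_space) auto
  finally show "emeasure (distr (density torus (\<lambda>x. ennreal (jac v x))) torus (\<lambda>x. frac_vec (T x))) A = emeasure torus A" .
qed simp


section \<open>Duality and optimality of the gradient map\<close>

lemma nonneg_jac_density:
  assumes "\<And>x. 0 \<le> jac v x" and f: "continuous_on UNIV f"
  shows "(LINT x|density torus (\<lambda>x. ennreal (jac v x)). f x) = (LINT x|torus. jac v x * f x)"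
  using assms by (subst integral_density)
    (auto intro!: measurable_torus borel_measurable_continuous_onI jac_cont f)

lemma integral_push_forward:
  fixes f :: "real^2 \<Rightarrow> real"
  assumes pos: "\<And>x. 0 \<le> jac v x" and f: "continuous_on UNIV f" "periodic f"
  shows "(LINT y|torus. f y) = (LINT x|torus. jac v x * f (T x))"
proof -
  have "(LINT y|torus. f y) = (LINT y|distr (density torus (\<lambda>x. ennreal (jac v x))) torus (\<lambda>x. frac_vec (T x)). f y)"
    by (simp add: push_forward[OF pos])
  also have "\<dots> = (LINT x|density torus (\<lambda>x. ennreal (jac v x)). f (frac_vec (T x)))"
    by (rule integral_distr)
       (use frac_T_measurable f in \<open>auto intro!: measurable_torus borel_measurable_continuous_onI\<close>)
  also have "\<dots> = (LINT x|torus. jac v x * f (T x))"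
    unfolding periodic_frac[OF f(2)]
    by (rule nonneg_jac_density[OF pos continuous_on_compose2[OF f(1) T_cont]]) simp
  finally show ?thesis .
qed

definition transport_cost :: real where
  "transport_cost = (LINT x|torus. jac v x * (norm (grad v x))\<^sup>2)"

text \<open>There is no duality gap: along the graph of \<open>T\<close> the dual inequality is an
  equality (\<open>dual_T\<close>), and the push-forward converts the integral of
  \<open>dual\<close> over the target into one over the source.\<close>

lemma transport_cost_dual:
  assumes pos: "\<And>x. 0 \<le> jac v x"
  shows "transport_cost = 2 * ((LINT y|torus. dual y) - (LINT x|torus. jac v x * v x))"
proof -
  have "(LINT y|torus. dual y) = (LINT x|torus. (jac v x * (norm (grad v x))\<^sup>2) / 2 + jac v x * v x)"
    unfolding integral_push_forward[OF pos dual_cont dual_periodic] dual_T by (simp add: algebra_simps)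
  also have "\<dots> = transport_cost / 2 + (LINT x|torus. jac v x * v x)"
    unfolding transport_cost_def
    by (subst Bochner_Integration.integral_add)
       (auto intro!: integrable_torus continuous_intros jac_cont grad_cont v_cont)
  finally show ?thesis by simp
qed

text \<open>Weak duality, obtained by integrating \<open>torus_dist_ge\<close>. The density
  \<open>m\<close> is arbitrary rather than \<open>jac v\<close>, so that the potentials of one
  density can test another one, which yields the subgradient inequality.\<close>

lemma coupling_cost_ge:
  assumes m: "continuous_on UNIV m" "\<And>x. 0 \<le> m x"
    and \<pi>: "\<pi> \<in> couplings (density torus (\<lambda>x. ennreal (m x))) torus"
  shows "ennreal (2 * ((LINT y|torus. dual y) - (LINT x|torus. m x * v x)))
    \<le> (\<integral>\<^sup>+ p. ennreal ((torus_dist (fst p) (snd p))\<^sup>2) \<partial>\<pi>)"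
proof -
  let ?\<mu> = "density torus (\<lambda>x. ennreal (m x))"
  have sets: "sets \<pi> = sets (?\<mu> \<Otimes>\<^sub>M torus)" and d1: "distr \<pi> ?\<mu> fst = ?\<mu>" and d2: "distr \<pi> torus snd = torus"
    using \<pi> by (auto simp: couplings_def)
  have fm: "fst \<in> measurable \<pi> ?\<mu>" "snd \<in> measurable \<pi> torus"
    by (simp_all add: measurable_cong_sets[OF sets refl])
  have vm: "v \<in> borel_measurable torus" "dual \<in> borel_measurable torus" "m \<in> borel_measurable torus"
    by (intro measurable_torus borel_measurable_continuous_onI v_cont dual_cont m)+
  have iv: "integrable \<pi> (\<lambda>p. v (fst p))"
  proof -
    have "integrable ?\<mu> v"
      using m vm by (subst integrable_density) (auto intro!: integrable_torus continuous_intros v_cont)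
    then show ?thesis using integrable_distr[OF fm(1), of v] by (simp add: d1)
  qed
  have ig: "integrable \<pi> (\<lambda>p. dual (snd p))"
    using integrable_distr[OF fm(2), of dual] integrable_torus[OF dual_cont] by (simp add: d2)
  have "(LINT p|\<pi>. v (fst p)) = (LINT x|torus. m x * v x)"
  proof -
    have "(LINT p|\<pi>. v (fst p)) = (LINT x|?\<mu>. v x)"
      using integral_distr[OF fm(1), of v] vm by (simp add: d1)
    then show ?thesis using m vm by (simp add: integral_density)
  qed
  moreover have "(LINT p|\<pi>. dual (snd p)) = (LINT y|torus. dual y)"
    using integral_distr[OF fm(2) vm(2)] by (simp add: d2)
  ultimately have "2 * ((LINT y|torus. dual y) - (LINT x|torus. m x * v x)) = (LINT p|\<pi>. 2 * (dual (snd p) - v (fst p)))"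
    using iv ig by simp
  \<comment> \<open>Truncation at 0 mediates between the Bochner integral, whose integrand may be
    negative, and the extended nonnegative cost integral.\<close>
  also have "\<dots> \<le> (LINT p|\<pi>. max 0 (2 * (dual (snd p) - v (fst p))))"
    using iv ig by (intro integral_mono) auto
  finally have "ennreal (2 * ((LINT y|torus. dual y) - (LINT x|torus. m x * v x)))
     \<le> ennreal (LINT p|\<pi>. max 0 (2 * (dual (snd p) - v (fst p))))"
    by (rule ennreal_leI)
  also have "\<dots> = (\<integral>\<^sup>+ p. ennreal (max 0 (2 * (dual (snd p) - v (fst p)))) \<partial>\<pi>)"
    using iv ig by (intro nn_integral_eq_integral[symmetric]) auto
  also have "\<dots> \<le> (\<integral>\<^sup>+ p. ennreal ((torus_dist (fst p) (snd p))\<^sup>2) \<partial>\<pi>)"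
    using torus_dist_ge by (intro nn_integral_mono ennreal_leI) auto
  finally show ?thesis .
qed

text \<open>The coupling is carried by the graph of \<open>T\<close> folded into the square. An
  upper bound on its cost is enough, since weak duality supplies the matching lower bound.\<close>

lemma optimal_coupling:
  assumes pos: "\<And>x. 0 \<le> jac v x"
  obtains \<pi> where "\<pi> \<in> couplings (density torus (\<lambda>x. ennreal (jac v x))) torus"
    "(\<integral>\<^sup>+ p. ennreal ((torus_dist (fst p) (snd p))\<^sup>2) \<partial>\<pi>) \<le> ennreal transport_cost"
proof -
  define \<mu> where "\<mu> = density torus (\<lambda>x. ennreal (jac v x))"
  define f where "f x = (x, frac_vec (T x))" for x
  have s\<mu>: "sets \<mu> = sets torus" by (simp add: \<mu>_def)
  have fT: "(\<lambda>x. frac_vec (T x)) \<in> measurable \<mu> torus"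
    using frac_T_measurable by (simp add: measurable_cong_sets[OF s\<mu> refl])
  have fm: "f \<in> measurable \<mu> (\<mu> \<Otimes>\<^sub>M torus)"
    unfolding f_def using fT by (intro measurable_Pair measurable_ident) auto
  define \<pi> where "\<pi> = distr \<mu> (\<mu> \<Otimes>\<^sub>M torus) f"
  have "distr \<pi> \<mu> fst = distr \<mu> \<mu> (\<lambda>x. x)"
    unfolding \<pi>_def by (subst distr_distr[OF _ fm]) (auto simp: f_def o_def)
  then have 1: "distr \<pi> \<mu> fst = \<mu>" by (simp add: distr_id2)
  have "distr \<pi> torus snd = distr \<mu> torus (\<lambda>x. frac_vec (T x))"
    unfolding \<pi>_def by (subst distr_distr[OF _ fm]) (auto simp: f_def o_def)
  then have 2: "distr \<pi> torus snd = torus" using push_forward[OF pos] by (simp add: \<mu>_def)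
  have c: "\<pi> \<in> couplings \<mu> torus" using 1 2 by (simp add: couplings_def \<pi>_def)
  have "(\<lambda>p. torus_dist (fst p) (snd p)) \<in> borel_measurable (\<mu> \<Otimes>\<^sub>M torus)"
  proof -
    have id: "(\<lambda>x. x) \<in> borel_measurable torus" by (rule measurable_torus) simp
    then have "(\<lambda>x. x) \<in> borel_measurable \<mu>" by (simp add: measurable_cong_sets[OF s\<mu> refl])
    then have "fst \<in> borel_measurable (\<mu> \<Otimes>\<^sub>M torus)" "snd \<in> borel_measurable (\<mu> \<Otimes>\<^sub>M torus)"
      using measurable_compose[OF measurable_fst, of "\<lambda>x. x" \<mu> borel torus]
        measurable_compose[OF measurable_snd, of "\<lambda>x. x" torus borel \<mu>] id by auto
    then have "(\<lambda>p. fst p - snd p) \<in> borel_measurable (\<mu> \<Otimes>\<^sub>M torus)" by (rule borel_measurable_diff)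
    moreover have "(\<lambda>z. infdist z int_lattice) \<in> borel_measurable borel"
      by (intro borel_measurable_continuous_onI continuous_intros)
    ultimately show ?thesis unfolding torus_dist_def by (rule measurable_compose)
  qed
  then have "(\<integral>\<^sup>+ p. ennreal ((torus_dist (fst p) (snd p))\<^sup>2) \<partial>\<pi>) = (\<integral>\<^sup>+ x. ennreal ((torus_dist x (frac_vec (T x)))\<^sup>2) \<partial>\<mu>)"
    unfolding \<pi>_def by (subst nn_integral_distr[OF fm]) (auto simp: f_def)
  also have "\<dots> \<le> (\<integral>\<^sup>+ x. ennreal ((norm (grad v x))\<^sup>2) \<partial>\<mu>)"
    by (intro nn_integral_mono ennreal_leI torus_dist_le)
  also have "\<dots> = ennreal (LINT x|\<mu>. (norm (grad v x))\<^sup>2)"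
  proof (rule nn_integral_eq_integral)
    show "integrable \<mu> (\<lambda>x. (norm (grad v x))\<^sup>2)"
      unfolding \<mu>_def using pos
      by (subst integrable_density)
         (auto intro!: integrable_torus continuous_intros jac_cont grad_cont measurable_torus borel_measurable_continuous_onI)
  qed simp
  also have "(LINT x|\<mu>. (norm (grad v x))\<^sup>2) = transport_cost"
    unfolding \<mu>_def transport_cost_def by (intro nonneg_jac_density pos continuous_intros grad_cont)
  finally show thesis using c that by (simp add: \<mu>_def)
qed

lemma W2_eq_transport_cost:
  assumes pos: "\<And>x. 0 \<le> jac v x"
  shows "(W2 (density torus (\<lambda>x. ennreal (jac v x))) torus)\<^sup>2 = transport_cost"
proof -
  let ?C = "couplings (density torus (\<lambda>x. ennreal (jac v x))) torus"
  let ?I = "INF \<pi>\<in>?C. \<integral>\<^sup>+ p. ennreal ((torus_dist (fst p) (snd p))\<^sup>2) \<partial>\<pi>"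
  have 0: "0 \<le> transport_cost" unfolding transport_cost_def using pos by (intro Bochner_Integration.integral_nonneg) auto
  obtain \<pi> where \<pi>: "\<pi> \<in> ?C" "(\<integral>\<^sup>+ p. ennreal ((torus_dist (fst p) (snd p))\<^sup>2) \<partial>\<pi>) \<le> ennreal transport_cost"
    using optimal_coupling[OF pos] by blast
  have "?I \<le> ennreal transport_cost"
    by (rule INF_lower2[of \<pi>]) (use \<pi> in auto)
  moreover have "ennreal transport_cost \<le> ?I"
    using coupling_cost_ge[OF jac_cont pos] transport_cost_dual[OF pos] by (intro INF_greatest) auto
  ultimately have "?I = ennreal transport_cost" by (rule antisym)
  then show ?thesis using 0 by (simp add: W2_def)
qed

end

text \<open>The dual potential of \<open>v\<close> is admissible for every other density.\<close>

lemma W2_subgradient: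
  assumes v: "transport_potential v l" and w: "transport_potential w l'"
    and pos: "\<And>x. 0 \<le> jac v x" "\<And>x. 0 \<le> jac w x"
  shows "(W2 (density torus (\<lambda>x. ennreal (jac v x))) torus)\<^sup>2 - 2 * (LINT x|torus. (jac w x - jac v x) * v x)
    \<le> (W2 (density torus (\<lambda>x. ennreal (jac w x))) torus)\<^sup>2"
proof -
  interpret V: transport_potential v l by (rule v)
  interpret W: transport_potential w l' by (rule w)
  have W0: "0 \<le> W.transport_cost" unfolding W.transport_cost_def using pos by (intro Bochner_Integration.integral_nonneg) auto
  obtain \<pi> where \<pi>: "\<pi> \<in> couplings (density torus (\<lambda>x. ennreal (jac w x))) torus"
    "(\<integral>\<^sup>+ p. ennreal ((torus_dist (fst p) (snd p))\<^sup>2) \<partial>\<pi>) \<le> ennreal W.transport_cost"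
    using W.optimal_coupling[OF pos(2)] by blast
  have "ennreal (2 * ((LINT y|torus. V.dual y) - (LINT x|torus. jac w x * v x))) \<le> ennreal W.transport_cost"
    using V.coupling_cost_ge[OF W.jac_cont pos(2) \<pi>(1)] \<pi>(2) by (rule order_trans)
  then have "2 * ((LINT y|torus. V.dual y) - (LINT x|torus. jac w x * v x)) \<le> W.transport_cost"
    using W0 by (simp add: ennreal_le_iff)
  moreover have "(LINT x|torus. (jac w x - jac v x) * v x) = (LINT x|torus. jac w x * v x) - (LINT x|torus. jac v x * v x)"
    unfolding left_diff_distrib
    by (intro Bochner_Integration.integral_diff integrable_torus continuous_intros V.jac_cont W.jac_cont V.v_cont)
  ultimately show ?thesis
    unfolding V.W2_eq_transport_cost[OF pos(1)] W.W2_eq_transport_cost[OF pos(2)] V.transport_cost_dual[OF pos(1)]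
    by (simp add: algebra_simps)
qed

text \<open>Both maps transport the same density, so each is optimal; by strong convexity the cost of a
  non-optimal map exceeds the optimal cost by a multiple of its squared distance from the optimal map.\<close>

lemma transport_potential_unique:
  assumes v: "transport_potential v l" and w: "transport_potential w l'"
    and eq: "jac v = jac w" and pos: "\<And>x. 0 < jac v x"
  shows "grad v = grad w"
proof -
  have key: "transport_potential.transport_cost v + l * (LINT x|torus. jac v x * (norm (x - transport_potential.S v (transport_potential.T w x)))\<^sup>2)
      \<le> transport_potential.transport_cost w"
    if v: "transport_potential v l" and w: "transport_potential w l'" and eq: "jac v = jac w" and pos: "\<And>x. 0 < jac v x"
    for v w l l'
  proof -
    interpret V: transport_potential v l by (rule v)
    interpret W: transport_potential w l' by (rule w)
    have pos': "\<And>x. 0 \<le> jac v x" "\<And>x. 0 \<le> jac w x" using pos less_imp_le eq by metis+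
    have c: "continuous_on UNIV (\<lambda>x. jac v x * (norm (x - V.S (W.T x)))\<^sup>2)"
      by (intro continuous_intros V.jac_cont continuous_on_compose2[OF V.S_cont W.T_cont]) auto
    have cd: "continuous_on UNIV (\<lambda>x. jac v x * V.dual (W.T x))"
      by (intro continuous_intros V.jac_cont continuous_on_compose2[OF V.dual_cont W.T_cont]) auto
    have cw: "continuous_on UNIV (\<lambda>x. jac v x * (norm (grad w x))\<^sup>2)"
      by (intro continuous_intros V.jac_cont W.grad_cont)
    have cv: "continuous_on UNIV (\<lambda>x. jac v x * v x)"
      by (intro continuous_intros V.jac_cont V.v_cont)
    have pt: "2 * (jac v x * V.dual (W.T x)) + l * (jac v x * (norm (x - V.S (W.T x)))\<^sup>2)
        \<le> jac v x * (norm (grad w x))\<^sup>2 + 2 * (jac v x * v x)" for x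
    proof -
      have "V.dual (W.T x) + l / 2 * (norm (x - V.S (W.T x)))\<^sup>2 \<le> (norm (grad w x))\<^sup>2 / 2 + v x"
        using V.cost_ge_dual[of "W.T x" x] by (simp add: V.cost_def W.T_def)
      from mult_left_mono[OF this, of "2 * jac v x"] pos'(1)[of x] show ?thesis by (simp add: algebra_simps)
    qed
    have "(LINT x|torus. 2 * (jac v x * V.dual (W.T x)) + l * (jac v x * (norm (x - V.S (W.T x)))\<^sup>2))
       \<le> (LINT x|torus. jac v x * (norm (grad w x))\<^sup>2 + 2 * (jac v x * v x))"
      by (intro integral_mono integrable_torus continuous_on_add continuous_on_mult_left c cd cw cv pt)
    then have "2 * (LINT x|torus. jac v x * V.dual (W.T x)) + l * (LINT x|torus. jac v x * (norm (x - V.S (W.T x)))\<^sup>2)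
       \<le> (LINT x|torus. jac v x * (norm (grad w x))\<^sup>2) + 2 * (LINT x|torus. jac v x * v x)"
      using integrable_torus[OF c] integrable_torus[OF cd] integrable_torus[OF cv] integrable_torus[OF cw] by simp
    moreover have "(LINT x|torus. jac v x * V.dual (W.T x)) = (LINT y|torus. V.dual y)"
      using W.integral_push_forward[OF pos'(2) V.dual_cont V.dual_periodic] eq by simp
    moreover have "(LINT x|torus. jac v x * (norm (grad w x))\<^sup>2) = W.transport_cost"
      by (simp add: W.transport_cost_def eq)
    ultimately show ?thesis using V.transport_cost_dual[OF pos'(1)] by (simp add: algebra_simps)
  qed
  interpret V: transport_potential v l by (rule v)
  interpret W: transport_potential w l' by (rule w)
  define f where "f x = jac v x * (norm (x - V.S (W.T x)))\<^sup>2" for x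
  have "W.transport_cost \<le> V.transport_cost"
  proof -
    have "0 \<le> l' * (LINT x|torus. jac w x * (norm (x - W.S (V.T x)))\<^sup>2)"
      using W.l pos eq by (intro mult_nonneg_nonneg Bochner_Integration.integral_nonneg) (auto intro: less_imp_le)
    then show ?thesis using key[OF w v eq[symmetric]] pos eq by simp
  qed
  then have "l * (LINT x|torus. f x) \<le> 0"
    using key[OF v w eq pos] by (simp add: f_def)
  then have le: "(LINT x|torus. f x) \<le> 0" using V.l by (simp add: mult_le_0_iff)
  have fc: "continuous_on UNIV f"
    unfolding f_def by (intro continuous_intros V.jac_cont continuous_on_compose2[OF V.S_cont W.T_cont]) auto
  have fp: "periodic f"
    unfolding periodic_def f_def by (simp add: periodicD[OF V.jac_periodic] W.T_periodic V.S_periodic)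
  have "grad v x = grad w x" for x
  proof -
    have f0: "0 \<le> f x" for x using pos[of x] by (simp add: f_def less_imp_le)
    have "\<not> f x > 0" using integral_torus_pos[OF fc fp f0, of x] le by auto
    then have "f x = 0" using f0[of x] by linarith
    then have "x = V.S (W.T x)" using pos[of x] by (simp add: f_def)
    then have "V.T x = W.T x" by (metis V.T_S)
    then show ?thesis by (simp add: V.T_def W.T_def)
  qed
  then show ?thesis by (rule ext)
qed


section \<open>Ellipticity from a positive Jacobian, and recovery of a function from its
  gradient\<close>

lemma periodic_pos_lower_bound:
  assumes f: "continuous_on UNIV f" "periodic f" and pos: "\<And>x. 0 < f x"
  obtains c where "0 < c" "\<And>x. c \<le> f x"
proof -
  have "cbox 0 (\<chi> i. 1) \<noteq> ({} :: (real^2) set)" using unit_square_subset_cbox frac_vec_in by blast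
  then obtain z where "z \<in> cbox 0 (\<chi> i. 1)" "\<And>x. x \<in> cbox 0 (\<chi> i. 1) \<Longrightarrow> f z \<le> f x"
    using continuous_attains_inf[OF compact_cbox _ continuous_on_subset[OF f(1)]] by blast
  then have "f z \<le> f x" for x
    using periodic_frac[OF f(2), of x] unit_square_subset_cbox frac_vec_in[of x] by (metis subsetD)
  then show thesis using that pos by blast
qed

text \<open>The entry \<open>1 + \<partial>\<^sub>1\<partial>\<^sub>1v\<close> has mean 1 and, as the determinant is positive, no zero; so it is
  positive everywhere.\<close>

lemma jac_pos_imp_transport_potential:
  assumes v: "C_k 2 v" and per: "periodic v" and pos: "\<And>x. 0 < jac v x"
  obtains l where "transport_potential v l"
proof -
  define a b c where "a x = 1 + pd 1 (pd 1 v) x" and "b x = 1 + pd 2 (pd 2 v) x" and "c x = pd 1 (pd 2 v) x" for x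
  have sym: "pd 2 (pd 1 v) = pd 1 (pd 2 v)" by (rule pd_commute[OF v per])
  have J: "jac v x = a x * b x - (c x)\<^sup>2" for x by (simp add: jac_def a_def b_def c_def sym power2_eq_square)
  have C1: "C_k 1 (pd i v)" for i using v by (simp add: numeral_2_eq_2)
  have pc: "continuous_on UNIV (pd i (pd j v))" for i j using v by (simp add: numeral_2_eq_2)
  have cont: "continuous_on UNIV a" "continuous_on UNIV b" "continuous_on UNIV (jac v)"
    unfolding a_def b_def jac_def by (intro continuous_intros pc)+
  have pp: "periodic a" "periodic b" "periodic (jac v)"
    using periodicD[OF periodic_pd[OF periodic_pd[OF per]]] by (simp_all add: periodic_def a_def b_def jac_def)
  have ab: "0 < a x * b x" for x using pos[of x] J[of x] zero_le_power2[of "c x"] by linarith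
  have "\<exists>x. 0 < a x"
  proof (rule ccontr)
    assume "\<not> (\<exists>x. 0 < a x)"
    then have neg: "a x \<le> 0" for x by (simp add: not_less)
    have "(LINT x|torus. a x) = 1 + (LINT x|torus. pd 1 (pd 1 v) x)"
      unfolding a_def by (subst Bochner_Integration.integral_add)
        (auto intro!: integrable_torus continuous_intros pc)
    also have "\<dots> = 1" using integral_pd_zero[OF C1 periodic_pd[OF per]] by simp
    finally have "(LINT x|torus. a x) = 1" .
    moreover have "(LINT x|torus. a x) \<le> (LINT x|torus. 0)"
      by (intro integral_mono integrable_torus cont continuous_on_const neg)
    ultimately show False by simp
  qed
  then obtain x0 where x0: "0 < a x0" by blast
  have apos: "0 < a x" for x
  proof (rule ccontr)
    assume "\<not> 0 < a x"
    then have "a x \<le> 0" by simp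
    then have "\<exists>z\<in>UNIV. a z = 0"
      using connected_iff_interval[of "range a"] connected_continuous_image[OF cont(1) connected_UNIV] x0
      by (metis (no_types, lifting) less_imp_le rangeE rangeI UNIV_I)
    then obtain z where "a z = 0" by blast
    then show False using ab[of z] by simp
  qed
  have bpos: "0 < b x" for x using ab[of x] apos[of x] by (simp add: zero_less_mult_iff)
  \<comment> \<open>Determinant over trace, a continuous lower bound for the smaller eigenvalue of I
    + D^2 v.\<close>
  define q where "q x = jac v x / (a x + b x)" for x
  have qc: "continuous_on UNIV q"
    unfolding q_def using apos bpos by (intro continuous_intros cont) (metis add_pos_pos less_irrefl)
  have qp: "periodic q" using pp by (simp add: periodic_def q_def)
  have "0 < q x" for x unfolding q_def using pos apos bpos by (intro divide_pos_pos add_pos_pos) auto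
  from periodic_pos_lower_bound[OF qc qp this] obtain l where l: "0 < l" "\<And>x. l \<le> q x" by blast
  have "transport_potential v l"
  proof
    fix x and d :: "real^2"
    define Q where "Q = a x * (d $ 1)\<^sup>2 + 2 * c x * d $ 1 * d $ 2 + b x * (d $ 2)\<^sup>2"
    have nd: "(norm d)\<^sup>2 = (d $ 1)\<^sup>2 + (d $ 2)\<^sup>2"
      unfolding power2_norm_eq_inner by (simp add: inner_vec_def sum_UNIV_2 power2_eq_square)
    \<comment> \<open>The Cayley-Hamilton identity for the symmetric matrix A = I + D^2 v: trace
      times the quadratic form minus determinant times |d|^2 equals |A d|^2.\<close>
    have "(a x + b x) * Q - jac v x * (norm d)\<^sup>2 = (a x * d $ 1 + c x * d $ 2)\<^sup>2 + (c x * d $ 1 + b x * d $ 2)\<^sup>2"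
      unfolding Q_def nd J by (simp add: power2_eq_square algebra_simps)
    then have "0 \<le> (a x + b x) * Q - jac v x * (norm d)\<^sup>2" by simp
    then have "jac v x * (norm d)\<^sup>2 \<le> (a x + b x) * Q" by linarith
    then have "q x * (norm d)\<^sup>2 \<le> Q"
      using apos[of x] bpos[of x] by (simp add: q_def divide_le_eq mult.commute)
    moreover have "l * (norm d)\<^sup>2 \<le> q x * (norm d)\<^sup>2" by (intro mult_right_mono l) simp
    moreover have "(norm d)\<^sup>2 + (\<Sum>i\<in>UNIV. \<Sum>j\<in>UNIV. pd i (pd j v) x * d $ i * d $ j) = Q"
      unfolding Q_def nd by (simp add: sum_UNIV_2 a_def b_def c_def sym power2_eq_square algebra_simps)
    ultimately show "l * (norm d)\<^sup>2 \<le> (norm d)\<^sup>2 + (\<Sum>i\<in>UNIV. \<Sum>j\<in>UNIV. pd i (pd j v) x * d $ i * d $ j)" by linarith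
  qed (rule v per l(1))+
  then show thesis by (rule that)
qed

lemma mean_zero_eq_of_grad_eq:
  assumes u: "C_k 1 u" "mean_zero u" and w: "C_k 1 w" "mean_zero w" and g: "grad u = grad w"
  shows "u = w"
proof -
  have d: "\<And>x. u differentiable (at x)" "\<And>x. w differentiable (at x)" using u w by auto
  have "((\<lambda>x. u x - w x) has_derivative (\<lambda>h. 0)) (at x within UNIV)" for x
  proof -
    have "(\<lambda>h. (\<Sum>i\<in>UNIV. pd i u x * h $ i) - (\<Sum>i\<in>UNIV. pd i w x * h $ i)) = (\<lambda>h. 0)"
      using g by (simp add: grad_inner[symmetric] fun_eq_iff)
    then show ?thesis
      using has_derivative_diff[OF differentiable_has_derivative_pd[OF d(1)] differentiable_has_derivative_pd[OF d(2)], of x]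
      by simp
  qed
  then obtain c where "\<And>x. u x - w x = c"
    using has_derivative_zero_constant[OF convex_UNIV, of "\<lambda>x. u x - w x"] by auto
  then have c: "u = (\<lambda>x. w x + c)" by (auto simp: fun_eq_iff algebra_simps)
  have "(LINT x|torus. u x) = (LINT x|torus. w x) + c"
    unfolding c by (subst Bochner_Integration.integral_add)
      (auto intro!: integrable_torus C_k_continuous[OF w(1)])
  then have "c = 0" using u w by (simp add: mean_zero_def)
  then show ?thesis using c by simp
qed

section \<open>Fourier inversion and products of Fourier series\<close>

lemma bij_from_nat_lattice: "bij_betw (from_nat_into (UNIV :: (int \<times> int) set)) UNIV UNIV"
proof (rule bij_betw_from_nat_into)
  show "infinite (UNIV :: (int \<times> int) set)"
    using infinite_UNIV_int by (metis finite_prod infinite_UNIV_char_0)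
qed (rule countableI_type)

definition real_family :: "(int \<times> int \<Rightarrow> complex) \<Rightarrow> bool" where
  "real_family a \<longleftrightarrow> a norm_summable_on UNIV \<and> (\<forall>n. a (- n) = cnj (a n))"

lemma of_real_fseries:
  assumes "real_family a"
  shows "of_real (fseries a x) = (\<Sum>\<^sub>\<infinity>n. a n * fexp n x)"
proof -
  let ?S = "\<Sum>\<^sub>\<infinity>n. a n * fexp n x"
  have bij: "bij_betw uminus UNIV (UNIV :: (int \<times> int) set)"
    by (rule bij_betw_byWitness[where f' = uminus]) auto
  have "cnj ?S = (\<Sum>\<^sub>\<infinity>n. cnj (a n * fexp n x))" by (rule infsum_cnj[symmetric])
  also have "\<dots> = (\<Sum>\<^sub>\<infinity>n. a (- n) * fexp (- n) x)"
    using assms unfolding real_family_def by (simp only: fexp_minus complex_cnj_mult)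
  also have "\<dots> = ?S" by (rule infsum_reindex_bij_betw[OF bij])
  finally show ?thesis by (simp add: fseries_def complex_eq_iff)
qed

text \<open>Termwise integration against a character. The lattice is enumerated because
  \<open>integral_suminf\<close> concerns sequences; absolute summability makes the enumeration
  immaterial.\<close>

lemma fc_fseries:
  assumes a: "real_family a"
  shows "fc (fseries a) m = a m"
proof -
  let ?g = "from_nat_into (UNIV :: (int \<times> int) set)"
  have sum: "a norm_summable_on UNIV" using a by (simp add: real_family_def)
  have sumg: "summable (\<lambda>i. cmod (a (?g i)))"
    using sum summable_on_reindex_bij_betw[OF bij_from_nat_lattice, of "\<lambda>n. cmod (a n)"]
    by (intro summable_on_imp_summable) simp
  have reind: "infsum h UNIV = (\<Sum>i. h (?g i))" if "h summable_on UNIV" for h :: "int \<times> int \<Rightarrow> complex"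
  proof -
    have "(\<lambda>i. h (?g i)) summable_on UNIV"
      using that summable_on_reindex_bij_betw[OF bij_from_nat_lattice, of h] by simp
    then have "(\<lambda>i. h (?g i)) sums (\<Sum>\<^sub>\<infinity>i. h (?g i))" by (intro has_sum_imp_sums has_sum_infsum)
    then show ?thesis
      using infsum_reindex_bij_betw[OF bij_from_nat_lattice, of h] by (simp add: sums_unique)
  qed
  let ?f = "\<lambda>i x. a (?g i) * fexp (?g i - m) x"
  have int: "integrable torus (?f i)" for i by (intro integrable_torus continuous_intros)
  have nint: "(LINT x|torus. norm (?f i x)) = cmod (a (?g i))" for i
    by (simp add: norm_mult)
  have "fc (fseries a) m = (LINT x|torus. (\<Sum>i. ?f i x))"
    unfolding fc_def
  proof (intro Bochner_Integration.integral_cong refl)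
    fix x
    have "of_real (fseries a x) * fexp (- m) x = (\<Sum>\<^sub>\<infinity>n. a n * fexp n x) * fexp (- m) x"
      by (simp add: of_real_fseries[OF a])
    also have "\<dots> = (\<Sum>\<^sub>\<infinity>n. a n * fexp (n - m) x)"
      by (simp add: fexp_diff mult.assoc flip: infsum_cmult_left')
    also have "\<dots> = (\<Sum>i. ?f i x)"
      by (rule reind[OF abs_summable_summable]) (use sum in \<open>simp add: norm_mult\<close>)
    finally show "of_real (fseries a x) * fexp (- m) x = (\<Sum>i. ?f i x)" .
  qed
  also have "\<dots> = (\<Sum>i. LINT x|torus. ?f i x)"
    by (rule integral_suminf) (use int sumg nint in \<open>auto simp: norm_mult\<close>)
  also have "\<dots> = (\<Sum>i. if ?g i = m then a m else 0)"
    by (intro suminf_cong) (auto simp: integral_fexp)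
  also have "\<dots> = (\<Sum>\<^sub>\<infinity>n. if n = m then a m else 0)"
  proof (rule reind[symmetric])
    show "(\<lambda>n. if n = m then a m else 0) summable_on UNIV"
      using summable_on_cong_neutral[of UNIV "{m}" "\<lambda>n. if n = m then a m else 0" "\<lambda>n. if n = m then a m else 0"] by auto
  qed
  also have "\<dots> = a m"
    using infsum_cong_neutral[of UNIV "{m}" "\<lambda>n. if n = m then a m else 0" "\<lambda>n. if n = m then a m else 0"] by simp
  finally show ?thesis .
qed

text \<open>Both sides are continuous and have the same coefficients. The positive weight is used
  for the continuity of the series.\<close>

lemma fourier_inversion:
  assumes f: "continuous_on UNIV f" "periodic f" and s: "wsummable s (fc f)" "0 < s"
  shows "fseries (fc f) = f"
proof (rule fc_unique)
  have "real_family (fc f)"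
    using wsummable_abs[OF s(1)] s(2) by (simp add: real_family_def fc_minus_index)
  then show "fc (fseries (fc f)) n = fc f n" for n by (rule fc_fseries)
  have "wsummable (min s 1) (fc f)" using wsummable_mono(1)[OF s(1)] by simp
  then show "continuous_on UNIV (fseries (fc f))" by (rule fseries_continuous) (use s in auto)
qed (use f fseries_periodic in auto)

text \<open>The Cauchy product of the two absolutely convergent series, regrouped by total
  frequency.\<close>

lemma fseries_mult:
  assumes a: "real_family a" and b: "real_family b"
  shows "fseries a x * fseries b x = fseries (\<lambda>n. \<Sum>\<^sub>\<infinity>m. a m * b (n - m)) x"
    and "(\<lambda>m. a m * b (n - m)) summable_on UNIV"
    and "(\<lambda>n. \<Sum>\<^sub>\<infinity>m. a m * b (n - m)) norm_summable_on UNIV"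
proof -
  have sa: "a norm_summable_on UNIV" and sb: "b norm_summable_on UNIV"
    using a b by (auto simp: real_family_def)
  have s0: "(\<lambda>(m, l). a m * b l) norm_summable_on UNIV" by (rule abs_summable_product_families[OF sa sb])
  show "(\<lambda>m. a m * b (n - m)) summable_on UNIV"
    using abs_summable_summable[OF abs_summable_diagonals(1)[OF s0, of n]] by simp
  show "(\<lambda>n. \<Sum>\<^sub>\<infinity>m. a m * b (n - m)) norm_summable_on UNIV"
    using abs_summable_diagonals(2)[OF s0] by simp
  let ?u = "\<lambda>m. a m * fexp m x" and ?v = "\<lambda>l. b l * fexp l x"
  have su: "?u norm_summable_on UNIV" "?v norm_summable_on UNIV" using sa sb by (simp_all add: norm_mult)
  have "of_real (fseries a x * fseries b x) = infsum ?u UNIV * infsum ?v UNIV"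
    by (simp add: of_real_fseries a b)
  also have "\<dots> = (\<Sum>\<^sub>\<infinity>(m, l). ?u m * ?v l)" by (rule abs_summable_product_families(2)[OF su, symmetric])
  also have "\<dots> = (\<Sum>\<^sub>\<infinity>n. \<Sum>\<^sub>\<infinity>m. ?u m * ?v (n - m))"
    using abs_summable_diagonals(4)[OF abs_summable_product_families(1)[OF su]] by simp
  also have "\<dots> = (\<Sum>\<^sub>\<infinity>n. (\<Sum>\<^sub>\<infinity>m. a m * b (n - m)) * fexp n x)"
  proof (intro infsum_cong)
    fix n
    have "fexp n x = fexp m x * fexp (n - m) x" for m
      using fexp_add[of m "n - m" x] by simp
    then have "?u m * ?v (n - m) = (a m * b (n - m)) * fexp n x" for m by simp
    then show "(\<Sum>\<^sub>\<infinity>m. ?u m * ?v (n - m)) = (\<Sum>\<^sub>\<infinity>m. a m * b (n - m)) * fexp n x"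
      by (simp only: infsum_cmult_left')
  qed
  finally have "Re (of_real (fseries a x * fseries b x)) = Re (\<Sum>\<^sub>\<infinity>n. (\<Sum>\<^sub>\<infinity>m. a m * b (n - m)) * fexp n x)" by simp
  then show "fseries a x * fseries b x = fseries (\<lambda>n. \<Sum>\<^sub>\<infinity>m. a m * b (n - m)) x"
    by (simp add: fseries_def)
qed

lemma fseries_diff:
  assumes "a norm_summable_on UNIV" "b norm_summable_on UNIV"
  shows "fseries (\<lambda>n. a n - b n) x = fseries a x - fseries b x"
  unfolding fseries_def left_diff_distrib
  by (simp add: infsum_sub fseries_term_summable assms)

lemma fseries_add:
  assumes "a norm_summable_on UNIV" "b norm_summable_on UNIV"
  shows "fseries (\<lambda>n. a n + b n) x = fseries a x + fseries b x"
  unfolding fseries_def distrib_right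
  by (simp add: infsum_add fseries_term_summable assms)

lemma fseries_scaleR: "fseries (\<lambda>n. c *\<^sub>R a n) x = c * fseries a x"
  unfolding fseries_def scaleR_conv_of_real mult.assoc by (simp add: infsum_cmult_right')

section \<open>Uniqueness for the Poisson and the Monge--Ampere equation\<close>

definition sq_norm :: "int \<times> int \<Rightarrow> real" where
  "sq_norm n = (real_of_int (idx n 1))\<^sup>2 + (real_of_int (idx n 2))\<^sup>2"

lemma sq_norm_0_iff: "sq_norm n = 0 \<longleftrightarrow> n = 0"
  by (cases n) (auto simp: sq_norm_def idx_def sum_power2_eq_zero_iff zero_prod_def)

lemma fc_laplacian:
  assumes u: "C_k 2 u" "periodic u"
  shows "fc (laplacian u) n = - of_real (4 * pi\<^sup>2 * sq_norm n) * fc u n"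
proof -
  have c: "C_k 1 u" "C_k 1 (pd i u)" "continuous_on UNIV (pd i (pd i u))" for i
    using u(1) C_k_mono[OF u(1), of 1] by (auto simp: numeral_2_eq_2 simp del: C_k.simps(2)) (auto)
  have "laplacian u = (\<lambda>x. pd 1 (pd 1 u) x + pd 2 (pd 2 u) x)"
    by (simp add: fun_eq_iff laplacian_def sum_UNIV_2)
  then have "fc (laplacian u) n = fc (pd 1 (pd 1 u)) n + fc (pd 2 (pd 2 u)) n"
    by (simp add: fc_add c)
  then show ?thesis
    unfolding fc_pd[OF c(2) periodic_pd[OF u(2)]] fc_pd[OF c(1) u(2)]
    by (simp add: sq_norm_def power2_eq_square algebra_simps)
qed

text \<open>At nonzero frequencies the Laplacian multiplies by a nonzero number, and the mean fixes
  the coefficient at 0.\<close>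

lemma poisson_unique:
  assumes u: "C_k 2 u" "periodic u" "mean_zero u" and w: "C_k 2 w" "periodic w" "mean_zero w"
    and eq: "\<And>x. laplacian u x = laplacian w x"
  shows "u = w"
proof (rule fc_unique)
  have e: "laplacian u = laplacian w" using eq by (simp add: fun_eq_iff)
  show "fc u n = fc w n" for n
  proof (cases "n = 0")
    case True
    then show ?thesis using u(3) w(3) by (simp add: fc_0 mean_zero_def)
  next
    case False
    have "- of_real (4 * pi\<^sup>2 * sq_norm n) * fc u n = - of_real (4 * pi\<^sup>2 * sq_norm n) * fc w n"
      using fc_laplacian[OF u(1,2), of n] fc_laplacian[OF w(1,2), of n] unfolding e by (rule trans[OF sym])
    then show ?thesis using False sq_norm_0_iff[of n] by simp
  qed
qed (use u w C_k_continuous in auto)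

lemma poisson_eqI:
  assumes "C_k 2 u" "periodic u" "mean_zero u" "\<And>x. laplacian u x = f x"
  shows "poisson f = u"
  unfolding poisson_def
proof (rule the_equality)
  fix w assume "periodic w \<and> C_k 2 w \<and> mean_zero w \<and> (\<forall>x. laplacian w x = f x)"
  then show "w = u" using assms by (intro poisson_unique) auto
qed (use assms in auto)

lemma pd_cmult_fun: "(\<And>x. f differentiable (at x)) \<Longrightarrow> pd i (\<lambda>x. c * f x) = (\<lambda>x. c * pd i f x)"
  by (simp add: fun_eq_iff pd_cmult)

lemma jac_cmult:
  assumes u: "C_k 2 u"
  shows "jac (\<lambda>x. c * u x) x = 1 + c * (laplacian u x + c * det (hessian u x))"
proof -
  have "\<And>x. u differentiable (at x)" "\<And>i x. pd i u differentiable (at x)"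
    using u by (auto simp: numeral_2_eq_2)
  then show ?thesis
    by (simp add: jac_def laplacian_def hessian_def det_2 sum_UNIV_2 pd_cmult_fun algebra_simps)
qed

lemma grad_cmult:
  assumes "\<And>x. u differentiable (at x)"
  shows "grad (\<lambda>x. c * u x) x = c *\<^sub>R grad u x"
  using assms by (simp add: vec_eq_iff grad_nth pd_cmult)

lemma periodic_cmult: "periodic u \<Longrightarrow> periodic (\<lambda>x. c * u x)"
  by (simp add: periodic_def)

text \<open>Multiplication by \<epsilon> turns the equation into a prescribed Jacobian 1 +
  \<epsilon> f. Its positivity alone makes \<epsilon> u and \<epsilon> w transport potentials, so
  uniqueness of the optimal map identifies their gradients.\<close>

lemma monge_ampere_unique:
  assumes u: "C_k 2 u" "periodic u" "mean_zero u" and w: "C_k 2 w" "periodic w" "mean_zero w"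
    and eq: "\<And>x. laplacian u x + \<epsilon> * det (hessian u x) = f x" "\<And>x. laplacian w x + \<epsilon> * det (hessian w x) = f x"
    and pos: "\<And>x. 0 < 1 + \<epsilon> * f x" and \<epsilon>: "\<epsilon> \<noteq> 0"
  shows "u = w"
proof (rule mean_zero_eq_of_grad_eq)
  have d: "\<And>x. u differentiable (at x)" "\<And>x. w differentiable (at x)"
    using u w by (auto simp: numeral_2_eq_2)
  have ju: "jac (\<lambda>x. \<epsilon> * u x) = (\<lambda>x. 1 + \<epsilon> * f x)" and jw: "jac (\<lambda>x. \<epsilon> * w x) = (\<lambda>x. 1 + \<epsilon> * f x)"
    using jac_cmult[OF u(1)] jac_cmult[OF w(1)] eq by (auto simp: fun_eq_iff)
  obtain l where l: "transport_potential (\<lambda>x. \<epsilon> * u x) l"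
    using jac_pos_imp_transport_potential[OF C_k_cmult[OF u(1)] periodic_cmult[OF u(2)]] pos ju by metis
  obtain l' where l': "transport_potential (\<lambda>x. \<epsilon> * w x) l'"
    using jac_pos_imp_transport_potential[OF C_k_cmult[OF w(1)] periodic_cmult[OF w(2)]] pos jw by metis
  have "grad (\<lambda>x. \<epsilon> * u x) = grad (\<lambda>x. \<epsilon> * w x)"
    by (rule transport_potential_unique[OF l l']) (use ju jw pos in auto)
  then show "grad u = grad w"
    using \<epsilon> by (auto simp: fun_eq_iff grad_cmult d)
  show "C_k 1 u" "C_k 1 w" using C_k_mono[OF u(1), of 1] C_k_mono[OF w(1), of 1] by (simp_all del: C_k.simps)
qed (use u w in auto)

lemma psi_eqI:
  assumes "C_k 2 u" "periodic u" "mean_zero u" "\<And>x. laplacian u x + \<epsilon> * det (hessian u x) = \<rho> x"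
    and "\<And>x. 0 < 1 + \<epsilon> * \<rho> x" "\<epsilon> \<noteq> 0"
  shows "psi \<epsilon> \<rho> = u"
  unfolding psi_def
proof (rule the_equality)
  fix w assume "periodic w \<and> C_k 2 w \<and> mean_zero w \<and> (\<forall>x. laplacian w x + \<epsilon> * det (hessian w x) = \<rho> x)"
  then show "w = u" using assms by (intro monge_ampere_unique[of w u \<epsilon> \<rho>]) auto
qed (use assms in auto)

section \<open>The Monge--Ampere equation in weighted Fourier coefficients\<close>

text \<open>At \<open>n = 0\<close> division by zero makes the multipliers below vanish, which is the right value for
  mean-zero functions.\<close>

definition riesz :: "2 \<Rightarrow> 2 \<Rightarrow> int \<times> int \<Rightarrow> real" where
  "riesz i j n = real_of_int (idx n i) * real_of_int (idx n j) / sq_norm n"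

text \<open>The first factor is the symbol of det D^2 in terms of the Laplacian. The second
  conjugates with the weight, so that the operator acts on weighted coefficients inside the
  unweighted space \<open>ell1\<close>.\<close>

definition det_kernel :: "real \<Rightarrow> int \<times> int \<Rightarrow> int \<times> int \<Rightarrow> real" where
  "det_kernel s m l = (riesz 1 1 m * riesz 2 2 l - riesz 1 2 m * riesz 2 1 l) *
     (wt (m + l) powr s / (wt m powr s * wt l powr s))"

lemma idx_minus: "idx (- n) i = - idx n i" by (simp add: idx_def)

lemma sq_norm_minus: "sq_norm (- n) = sq_norm n" by (simp add: sq_norm_def idx_minus)

lemma riesz_minus: "riesz i j (- n) = riesz i j n" by (simp add: riesz_def idx_minus sq_norm_minus)

lemma riesz_bound: "\<bar>riesz i j n\<bar> \<le> 1"
proof (cases "n = 0")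
  case True
  then show ?thesis by (simp add: riesz_def idx_def)
next
  case False
  have p: "0 < sq_norm n" using False sq_norm_0_iff[of n] by (simp add: sq_norm_def less_le)
  have sq: "\<bar>real_of_int (idx n i)\<bar> \<le> sqrt (sq_norm n)" for i
  proof (rule real_le_rsqrt)
    show "\<bar>real_of_int (idx n i)\<bar>\<^sup>2 \<le> sq_norm n" using exhaust_2[of i] by (auto simp: sq_norm_def)
  qed
  have "\<bar>real_of_int (idx n i) * real_of_int (idx n j)\<bar> \<le> sqrt (sq_norm n) * sqrt (sq_norm n)"
    unfolding abs_mult using p by (intro mult_mono sq) auto
  then show ?thesis using p by (simp add: riesz_def)
qed

text \<open>Both factors are controlled separately: the symbol is a difference of two products of
  numbers at most 1 in modulus, and the weight quotient is at most 1 by submultiplicativity.\<close>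

lemma det_kernel_bound:
  assumes "0 \<le> s"
  shows "\<bar>det_kernel s m l\<bar> \<le> 2"
proof -
  have "\<bar>riesz 1 1 m * riesz 2 2 l - riesz 1 2 m * riesz 2 1 l\<bar> \<le> \<bar>riesz 1 1 m * riesz 2 2 l\<bar> + \<bar>riesz 1 2 m * riesz 2 1 l\<bar>"
    by (rule abs_triangle_ineq4)
  also have "\<dots> \<le> 1 * 1 + 1 * 1"
    unfolding abs_mult by (intro add_mono mult_mono riesz_bound) auto
  finally have 1: "\<bar>riesz 1 1 m * riesz 2 2 l - riesz 1 2 m * riesz 2 1 l\<bar> \<le> 2" by simp
  have "wt (m + l) powr s \<le> (wt m * wt l) powr s"
    by (intro powr_mono2 assms wt_add_le) (simp add: less_imp_le)
  also have "\<dots> = wt m powr s * wt l powr s" by (simp add: powr_mult less_imp_le)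
  finally have 2: "\<bar>wt (m + l) powr s / (wt m powr s * wt l powr s)\<bar> \<le> 1"
    by (simp add: divide_le_eq)
  have "\<bar>det_kernel s m l\<bar> \<le> 2 * 1" unfolding det_kernel_def abs_mult by (intro mult_mono 1 2) auto
  then show ?thesis by simp
qed

section \<open>The inverse Laplacian and the Hessian determinant on weighted coefficients\<close>

definition unweight :: "real \<Rightarrow> ell1 \<Rightarrow> int \<times> int \<Rightarrow> complex" where
  "unweight s u n = coef u n / of_real (wt n powr s)"

text \<open>Here \<open>u\<close> holds the weighted coefficients of the Laplacian, the unknown of
  the fixed-point equation; the formula inverts the Laplacian.\<close>

definition potential :: "real \<Rightarrow> ell1 \<Rightarrow> real^2 \<Rightarrow> real" where
  "potential s u = fseries (\<lambda>n. - unweight s u n / of_real (4 * pi\<^sup>2 * sq_norm n))"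

definition fourier_embed :: "real \<Rightarrow> (real^2 \<Rightarrow> real) \<Rightarrow> ell1" where
  "fourier_embed s f = Abs_ell1 (\<lambda>n. of_real (wt n powr s) * fc f n)"

lemma unweight_wsummable: "wsummable s (unweight s u)" "wnorm s (unweight s u) = norm u"
  using coef_summable[of u] by (simp_all add: wsummable_def wnorm_def unweight_def norm_divide norm_ell1_def)

lemma wt_sq_le: "n \<noteq> 0 \<Longrightarrow> (wt n)\<^sup>2 \<le> 4 * pi\<^sup>2 * sq_norm n"
proof -
  assume "n \<noteq> 0"
  then have "(wt n)\<^sup>2 \<le> 9 * sq_norm n" using wt_power_le[of n 1] by (simp add: sq_norm_def)
  also have "\<dots> \<le> (4 * pi\<^sup>2) * sq_norm n"
  proof (intro mult_right_mono)
    have "3 * 3 \<le> pi * pi" using pi_gt3 by (intro mult_mono) auto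
    then show "9 \<le> 4 * pi\<^sup>2" by (simp add: power2_eq_square)
  qed (simp add: sq_norm_def)
  finally show ?thesis .
qed

text \<open>The inverse Laplacian gains two orders, with constant 1 because wt^2 <= 4 pi^2 |n|^2
  away from the origin.\<close>

lemma potential_coef_wsummable:
  "wsummable (s + 2) (\<lambda>n. - unweight s u n / of_real (4 * pi\<^sup>2 * sq_norm n))"
  "wnorm (s + 2) (\<lambda>n. - unweight s u n / of_real (4 * pi\<^sup>2 * sq_norm n)) \<le> norm u"
proof -
  have b: "cmod (- unweight s u n / of_real (4 * pi\<^sup>2 * sq_norm n)) \<le> 1 * wt n powr (- 2) * cmod (unweight s u n)" for n
  proof (cases "n = 0")
    case True
    then show ?thesis using sq_norm_0_iff[of n] by simp
  next
    case False
    have p: "0 < sq_norm n" using False sq_norm_0_iff[of n] by (simp add: sq_norm_def less_le)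
    have "1 / (4 * pi\<^sup>2 * sq_norm n) \<le> 1 / (wt n)\<^sup>2"
      using wt_sq_le[OF False] by (intro divide_left_mono) (auto simp: p)
    also have "\<dots> = wt n powr (- 2)"
      using powr_realpow[of "wt n" 2] by (simp add: powr_minus divide_inverse)
    finally have "cmod (unweight s u n) * (1 / (4 * pi\<^sup>2 * sq_norm n)) \<le> cmod (unweight s u n) * wt n powr (- 2)"
      by (intro mult_left_mono) auto
    then show ?thesis using p by (simp add: norm_divide norm_mult norm_power mult.commute)
  qed
  from wsummable_bound[OF unweight_wsummable(1) this]
  show "wsummable (s + 2) (\<lambda>n. - unweight s u n / of_real (4 * pi\<^sup>2 * sq_norm n))"
    "wnorm (s + 2) (\<lambda>n. - unweight s u n / of_real (4 * pi\<^sup>2 * sq_norm n)) \<le> norm u"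
    by (simp_all add: unweight_wsummable)
qed

lemma potential_periodic: "periodic (potential s u)"
  unfolding potential_def by (rule fseries_periodic)

lemma potential_hoelder_bd:
  assumes "0 < \<alpha>" "\<alpha> \<le> 1" "s + 2 = real k + \<alpha>"
  shows "hoelder_bd k \<alpha> (4 * pi * (2 * pi) ^ k * norm u) (potential s u)"
  unfolding potential_def
  by (rule hoelder_bd_mono[OF hoelder_bd_fseries[OF assms(1,2)]])
     (use potential_coef_wsummable[of s u] assms(3) in \<open>auto intro!: mult_left_mono\<close>)

lemma potential_norm_summable:
  assumes "0 \<le> s"
  shows "(\<lambda>n. - unweight s u n / of_real (4 * pi\<^sup>2 * sq_norm n)) norm_summable_on UNIV"
  using wsummable_abs[OF potential_coef_wsummable(1)[of s u]] assms by simp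

lemma potential_diff:
  assumes "0 \<le> s"
  shows "potential s (u - w) x = potential s u x - potential s w x"
proof -
  have "(\<lambda>n. - unweight s (u - w) n / of_real (4 * pi\<^sup>2 * sq_norm n)) =
      (\<lambda>n. - unweight s u n / of_real (4 * pi\<^sup>2 * sq_norm n) - - unweight s w n / of_real (4 * pi\<^sup>2 * sq_norm n))"
    by (simp add: fun_eq_iff unweight_def diff_divide_distrib)
  then show ?thesis
    unfolding potential_def using fseries_diff[OF potential_norm_summable potential_norm_summable, OF assms assms] by simp
qed

lemma potential_add:
  assumes "0 \<le> s"
  shows "potential s (u + w) x = potential s u x + potential s w x"
proof -
  have "(\<lambda>n. - unweight s (u + w) n / of_real (4 * pi\<^sup>2 * sq_norm n)) =
      (\<lambda>n. - unweight s u n / of_real (4 * pi\<^sup>2 * sq_norm n) + - unweight s w n / of_real (4 * pi\<^sup>2 * sq_norm n))"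
    by (simp add: fun_eq_iff unweight_def diff_divide_distrib add_divide_distrib)
  then show ?thesis
    unfolding potential_def using fseries_add[OF potential_norm_summable potential_norm_summable, OF assms assms] by simp
qed

lemma potential_scaleR: "potential s (c *\<^sub>R u) x = c * potential s u x"
  unfolding potential_def fseries_scaleR[symmetric]
  by (simp add: unweight_def scaleR_conv_of_real)

lemma unweight_hermitian: "u \<in> hermitian \<Longrightarrow> 0 \<le> s \<Longrightarrow> real_family (unweight s u)"
  using wsummable_abs[OF unweight_wsummable(1)[of s u]] by (simp add: real_family_def hermitian_def unweight_def)

lemma potential_mean_zero:
  assumes "u \<in> hermitian" "0 \<le> s"
  shows "mean_zero (potential s u)"
proof -
  have "real_family (\<lambda>n. - unweight s u n / of_real (4 * pi\<^sup>2 * sq_norm n))"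
    using unweight_hermitian[OF assms] potential_norm_summable[OF assms(2), of u] by (simp add: real_family_def sq_norm_minus)
  from fc_fseries[OF this, of 0] have "fc (potential s u) 0 = 0"
    using sq_norm_0_iff[of 0] by (simp add: potential_def)
  then show ?thesis by (simp add: fc_0 mean_zero_def)
qed

lemma pd2_potential:
  assumes s: "1 < s"
  shows "pd i (pd j (potential s u)) = fseries (\<lambda>n. of_real (riesz i j n) * unweight s u n)"
proof -
  define a where "a = (\<lambda>n. - unweight s u n / of_real (4 * pi\<^sup>2 * sq_norm n))"
  have a: "wsummable (s + 2) a" unfolding a_def by (rule potential_coef_wsummable)
  have 1: "wsummable (1 + 1) a" using wsummable_mono(1)[OF a] s by simp
  have 2: "wsummable (1 + 1) (dcoef j a)" using wsummable_mono(1)[OF wsummable_dcoef(1)[OF a]] s by simp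
  have "pd i (pd j (potential s u)) = fseries (dcoef i (dcoef j a))"
    unfolding potential_def a_def[symmetric] by (simp add: pd_fseries[OF 1] pd_fseries[OF 2])
  also have "dcoef i (dcoef j a) = (\<lambda>n. of_real (riesz i j n) * unweight s u n)"
  proof
    fix n
    show "dcoef i (dcoef j a) n = of_real (riesz i j n) * unweight s u n"
      using sq_norm_0_iff[of n]
      by (cases "n = 0") (auto simp: dcoef_def a_def riesz_def idx_def power2_eq_square field_simps)
  qed
  finally show ?thesis .
qed

lemma riesz_family:
  assumes "u \<in> hermitian" "0 \<le> s"
  shows "real_family (\<lambda>n. of_real (riesz i j n) * unweight s u n)"
  unfolding real_family_def
proof (intro conjI allI)
  note r = unweight_hermitian[OF assms, unfolded real_family_def]
  show "(\<lambda>n. of_real (riesz i j n) * unweight s u n) norm_summable_on UNIV"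
    by (rule abs_summable_bound[OF conjunct1[OF r], of _ 1]) (use riesz_bound in \<open>auto simp: norm_mult intro: mult_left_le_one_le\<close>)
  show "of_real (riesz i j (- n)) * unweight s u (- n) = cnj (of_real (riesz i j n) * unweight s u n)" for n
    using spec[OF conjunct2[OF r], of n] by (simp add: riesz_minus)
qed

text \<open>The two diagonal multipliers sum to 1 except at frequency 0, where they vanish; hence
  the condition on \<open>coef u 0\<close>.\<close>

lemma laplacian_potential:
  assumes u: "u \<in> hermitian" "coef u 0 = 0" and s: "1 < s"
  shows "laplacian (potential s u) = fseries (unweight s u)"
proof
  fix x
  have "laplacian (potential s u) x = fseries (\<lambda>n. of_real (riesz 1 1 n) * unweight s u n + of_real (riesz 2 2 n) * unweight s u n) x"
    using riesz_family[OF u(1), of s] s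
    by (simp add: laplacian_def sum_UNIV_2 pd2_potential fseries_add real_family_def)
  also have "(\<lambda>n. of_real (riesz 1 1 n) * unweight s u n + of_real (riesz 2 2 n) * unweight s u n) = unweight s u"
  proof
    fix n
    have "n \<noteq> 0 \<Longrightarrow> riesz 1 1 n + riesz 2 2 n = 1"
      using sq_norm_0_iff[of n] by (simp add: riesz_def add_divide_distrib[symmetric] sq_norm_def power2_eq_square)
    then have "n \<noteq> 0 \<Longrightarrow> complex_of_real (riesz 1 1 n) + of_real (riesz 2 2 n) = 1" by (metis of_real_1 of_real_add)
    then show "of_real (riesz 1 1 n) * unweight s u n + of_real (riesz 2 2 n) * unweight s u n = unweight s u n"
      using u(2) unfolding distrib_right[symmetric] by (cases "n = 0") (auto simp: unweight_def)
  qed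
  finally show "laplacian (potential s u) x = fseries (unweight s u) x" .
qed

lemma det_kernel_bounded: "0 \<le> s \<Longrightarrow> bounded_kernel (det_kernel s) 2"
  by unfold_locales (rule det_kernel_bound)

text \<open>The two products in the determinant are convolutions of series with multipliers; their
  difference is one twisted convolution, in which the weight quotient of the kernel cancels the
  weights of the factors and leaves the one at \<open>n\<close>.\<close>

lemma det_hessian_potential:
  assumes u: "u \<in> hermitian" and s: "1 < s"
  shows "det (hessian (potential s u) x) = fseries (unweight s (twisted_conv (det_kernel s) u u)) x"
proof -
  interpret bounded_kernel "det_kernel s" 2 by (rule det_kernel_bounded) (use s in simp)
  let ?R = "\<lambda>i j n. of_real (riesz i j n) * unweight s u n"
  have R: "real_family (?R i j)" for i j by (rule riesz_family[OF u]) (use s in simp)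
  have "det (hessian (potential s u) x) = fseries (?R 1 1) x * fseries (?R 2 2) x - fseries (?R 1 2) x * fseries (?R 2 1) x"
    using s by (simp add: det_2 hessian_def pd2_potential)
  also have "\<dots> = fseries (\<lambda>n. (\<Sum>\<^sub>\<infinity>m. ?R 1 1 m * ?R 2 2 (n - m)) - (\<Sum>\<^sub>\<infinity>m. ?R 1 2 m * ?R 2 1 (n - m))) x"
    unfolding fseries_mult(1)[OF R R] by (rule fseries_diff[symmetric]; rule fseries_mult(3)[OF R R])
  also have "(\<lambda>n. (\<Sum>\<^sub>\<infinity>m. ?R 1 1 m * ?R 2 2 (n - m)) - (\<Sum>\<^sub>\<infinity>m. ?R 1 2 m * ?R 2 1 (n - m)))
      = unweight s (twisted_conv (det_kernel s) u u)"
  proof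
    fix n
    have "(\<Sum>\<^sub>\<infinity>m. ?R 1 1 m * ?R 2 2 (n - m)) - (\<Sum>\<^sub>\<infinity>m. ?R 1 2 m * ?R 2 1 (n - m))
       = (\<Sum>\<^sub>\<infinity>m. ?R 1 1 m * ?R 2 2 (n - m) - ?R 1 2 m * ?R 2 1 (n - m))"
      by (rule infsum_sub[symmetric]) (rule fseries_mult(2)[OF R R])+
    also have "\<dots> = (\<Sum>\<^sub>\<infinity>m. of_real (det_kernel s m (n - m)) * (coef u m * coef u (n - m)) * of_real (inverse (wt n powr s)))"
    proof (intro infsum_cong)
      fix m
      have "of_real (det_kernel s m (n - m)) * of_real (inverse (wt n powr s)) =
         complex_of_real (riesz 1 1 m * riesz 2 2 (n - m) - riesz 1 2 m * riesz 2 1 (n - m)) * of_real (inverse (wt m powr s)) * of_real (inverse (wt (n - m) powr s))"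
        unfolding of_real_mult[symmetric] of_real_eq_iff det_kernel_def by (simp add: field_simps)
      moreover have "of_real (det_kernel s m (n - m)) * (coef u m * coef u (n - m)) * of_real (inverse (wt n powr s)) =
         (of_real (det_kernel s m (n - m)) * of_real (inverse (wt n powr s))) * (coef u m * coef u (n - m))"
        by (simp only: mult_ac)
      moreover have "?R 1 1 m * ?R 2 2 (n - m) - ?R 1 2 m * ?R 2 1 (n - m) =
         complex_of_real (riesz 1 1 m * riesz 2 2 (n - m) - riesz 1 2 m * riesz 2 1 (n - m)) * of_real (inverse (wt m powr s)) * of_real (inverse (wt (n - m) powr s)) * (coef u m * coef u (n - m))"
        by (simp add: unweight_def divide_inverse algebra_simps)
      ultimately show "?R 1 1 m * ?R 2 2 (n - m) - ?R 1 2 m * ?R 2 1 (n - m) =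
          of_real (det_kernel s m (n - m)) * (coef u m * coef u (n - m)) * of_real (inverse (wt n powr s))"
        by (simp only:)
    qed
    also have "\<dots> = unweight s (twisted_conv (det_kernel s) u u) n"
      by (simp add: unweight_def coef_twisted_conv infsum_cmult_left' divide_inverse)
    finally show "(\<Sum>\<^sub>\<infinity>m. ?R 1 1 m * ?R 2 2 (n - m)) - (\<Sum>\<^sub>\<infinity>m. ?R 1 2 m * ?R 2 1 (n - m))
      = unweight s (twisted_conv (det_kernel s) u u) n" .
  qed
  finally show ?thesis .
qed

text \<open>At frequency 0 the two arguments are opposite and the symbol vanishes identically: the
  determinant of the Hessian is a null Lagrangian. Hence solutions of the fixed-point equation
  inherit mean zero from the density.\<close>

lemma coef_det_conv_0:
  assumes "0 \<le> s"
  shows "coef (twisted_conv (det_kernel s) u w) 0 = 0"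
proof -
  interpret bounded_kernel "det_kernel s" 2 by (rule det_kernel_bounded[OF assms])
  have "det_kernel s m (0 - m) = 0" for m
    by (simp add: det_kernel_def riesz_minus) (simp add: riesz_def)
  then show ?thesis by (simp add: coef_twisted_conv)
qed

lemma det_conv_hermitian:
  assumes "0 \<le> s" "u \<in> hermitian" "w \<in> hermitian"
  shows "twisted_conv (det_kernel s) u w \<in> hermitian"
proof -
  interpret bounded_kernel "det_kernel s" 2 by (rule det_kernel_bounded[OF assms(1)])
  have "wt (- m - l) = wt (m + l)" for m l using wt_minus[of "m + l"] by simp
  then show ?thesis
    by (intro twisted_conv_hermitian assms) (simp add: det_kernel_def riesz_minus)
qed

section \<open>Integral identities\<close>

text \<open>Twice the polarisation of the Hessian determinant, see \<open>polar_det_self\<close>.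
  Writing the mixed derivative in one fixed order makes it symmetric by mere algebra.\<close>

definition polar_det :: "(real^2 \<Rightarrow> real) \<Rightarrow> (real^2 \<Rightarrow> real) \<Rightarrow> real^2 \<Rightarrow> real" where
  "polar_det b c x = pd 1 (pd 1 b) x * pd 2 (pd 2 c) x + pd 2 (pd 2 b) x * pd 1 (pd 1 c) x
     - 2 * (pd 1 (pd 2 b) x * pd 1 (pd 2 c) x)"

definition det_form :: "(real^2 \<Rightarrow> real) \<Rightarrow> (real^2 \<Rightarrow> real) \<Rightarrow> (real^2 \<Rightarrow> real) \<Rightarrow> real" where
  "det_form a b c = (LINT x|torus. a x * polar_det b c x)"

lemma polar_det_commute: "polar_det b c x = polar_det c b x"
  by (simp add: polar_det_def algebra_simps)

lemma det_form_commute23: "det_form a b c = det_form a c b"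
  unfolding det_form_def polar_det_commute[of b c] ..

lemma polar_det_self:
  assumes "C_k 2 f" "periodic f"
  shows "polar_det f f x = 2 * det (hessian f x)"
proof -
  have "pd 2 (pd 1 f) = pd 1 (pd 2 f)" by (rule pd_commute[OF assms])
  then show ?thesis by (simp add: polar_det_def det_2 hessian_def algebra_simps)
qed

lemma C_k_pd2: "C_k 3 f \<Longrightarrow> C_k 2 (pd i f)" "C_k 3 f \<Longrightarrow> C_k 1 (pd i (pd j f))" "C_k 3 f \<Longrightarrow> C_k 1 (pd i f)"
  "C_k 3 f \<Longrightarrow> C_k 2 f" "C_k 3 f \<Longrightarrow> C_k 1 f"
proof -
  assume f: "C_k 3 f"
  have f': "C_k (Suc 2) f" using f by (simp only: numeral_3_eq_3 numeral_2_eq_2)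
  show 1: "C_k 2 (pd i f)" for i using C_k_SucD(2)[OF f'] .
  have "C_k (Suc 1) (pd i f)" for i using 1[of i] by (simp only: numeral_2_eq_2 One_nat_def)
  then show "C_k 1 (pd i (pd j f))" by (rule C_k_SucD(2))
  show "C_k 1 (pd i f)" by (rule C_k_mono[OF 1]) simp
  show "C_k 2 f" "C_k 1 f" by (rule C_k_mono[OF f], simp)+
qed

lemma C_k_1D: "C_k 1 f \<Longrightarrow> f differentiable (at x)" "C_k 1 f \<Longrightarrow> continuous_on UNIV f"
  "C_k 1 f \<Longrightarrow> continuous_on UNIV (pd i f)"
  using C_k_continuous[of 1 f] by auto

text \<open>(X, Y) is \<open>a\<close> times the cofactor matrix of D^2 c applied to grad b. The
  rows of a cofactor matrix of a Hessian are divergence free, so the third derivatives of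
  \<open>c\<close> cancel in the divergence, whose integral is 0. What remains is symmetric in
  \<open>a\<close> and \<open>b\<close>; with the symmetry of \<open>polar_det\<close> the form
  becomes totally symmetric.\<close>

lemma det_form_by_parts:
  assumes a: "C_k 3 a" "periodic a" and b: "C_k 3 b" "periodic b" and c: "C_k 3 c" "periodic c"
  shows "det_form a b c = - (LINT x|torus. pd 1 a x * pd 1 b x * pd 2 (pd 2 c) x + pd 2 a x * pd 2 b x * pd 1 (pd 1 c) x
     - (pd 1 a x * pd 2 b x + pd 2 a x * pd 1 b x) * pd 1 (pd 2 c) x)"
proof -
  define X where "X x = a x * (pd 1 b x * pd 2 (pd 2 c) x - pd 2 b x * pd 1 (pd 2 c) x)" for x
  define Y where "Y x = a x * (pd 2 b x * pd 1 (pd 1 c) x - pd 1 b x * pd 1 (pd 2 c) x)" for x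
  have XY: "C_k 1 X" "C_k 1 Y" unfolding X_def Y_def
    by (intro C_k_mult C_k_sub C_k_pd2 a b c)+
  have per: "periodic X" "periodic Y"
    using a(2) b(2) c(2) periodicD[OF periodic_pd] periodicD[OF periodic_pd[OF periodic_pd]] periodicD
    unfolding X_def Y_def by (simp_all add: periodic_def)
  note cont = C_k_1D(2)[OF C_k_pd2(5)[OF a(1)]] C_k_1D(2)[OF C_k_pd2(3)[OF a(1)]] C_k_1D(2)[OF C_k_pd2(3)[OF b(1)]]
    C_k_1D(2)[OF C_k_pd2(2)[OF b(1)]] C_k_1D(2)[OF C_k_pd2(2)[OF c(1)]]
  note dif = C_k_1D(1)[OF C_k_pd2(5)[OF a(1)]] C_k_1D(1)[OF C_k_pd2(3)[OF b(1)]] C_k_1D(1)[OF C_k_pd2(2)[OF c(1)]]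
  have com: "pd 2 (pd 1 b) = pd 1 (pd 2 b)" "pd 2 (pd 1 (pd 2 c)) = pd 1 (pd 2 (pd 2 c))"
    "pd 1 (pd 1 (pd 2 c)) = pd 2 (pd 1 (pd 1 c))"
  proof -
    show "pd 2 (pd 1 b) = pd 1 (pd 2 b)" by (rule pd_commute[OF C_k_pd2(4)[OF b(1)] b(2)])
    show "pd 2 (pd 1 (pd 2 c)) = pd 1 (pd 2 (pd 2 c))" by (rule pd_commute[OF C_k_pd2(1)[OF c(1)] periodic_pd[OF c(2)]])
    have "pd 1 (pd 2 c) = pd 2 (pd 1 c)" by (rule pd_commute[OF C_k_pd2(4)[OF c(1)] c(2)])
    then show "pd 1 (pd 1 (pd 2 c)) = pd 2 (pd 1 (pd 1 c))"
      using pd_commute[OF C_k_pd2(1)[OF c(1)] periodic_pd[OF c(2)], of 1 2 1] by simp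
  qed
  let ?s = "\<lambda>x. pd 1 a x * pd 1 b x * pd 2 (pd 2 c) x + pd 2 a x * pd 2 b x * pd 1 (pd 1 c) x
     - (pd 1 a x * pd 2 b x + pd 2 a x * pd 1 b x) * pd 1 (pd 2 c) x"
  have pt: "pd 1 X x + pd 2 Y x = a x * polar_det b c x + ?s x" for x
  proof -
    have "pd 1 X x = pd 1 a x * (pd 1 b x * pd 2 (pd 2 c) x - pd 2 b x * pd 1 (pd 2 c) x)
        + a x * ((pd 1 (pd 1 b) x * pd 2 (pd 2 c) x + pd 1 b x * pd 1 (pd 2 (pd 2 c)) x)
               - (pd 1 (pd 2 b) x * pd 1 (pd 2 c) x + pd 2 b x * pd 1 (pd 1 (pd 2 c)) x))"
      unfolding X_def by (simp add: pd_mult pd_diff dif differentiable_mult differentiable_diff)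
    moreover have "pd 2 Y x = pd 2 a x * (pd 2 b x * pd 1 (pd 1 c) x - pd 1 b x * pd 1 (pd 2 c) x)
        + a x * ((pd 2 (pd 2 b) x * pd 1 (pd 1 c) x + pd 2 b x * pd 2 (pd 1 (pd 1 c)) x)
               - (pd 2 (pd 1 b) x * pd 1 (pd 2 c) x + pd 1 b x * pd 2 (pd 1 (pd 2 c)) x))"
      unfolding Y_def by (simp add: pd_mult pd_diff dif differentiable_mult differentiable_diff)
    ultimately show ?thesis unfolding polar_det_def com by (simp add: algebra_simps)
  qed
  have "0 = (LINT x|torus. pd 1 X x + pd 2 Y x)"
    using integral_pd_zero[OF XY(1) per(1)] integral_pd_zero[OF XY(2) per(2)]
      Bochner_Integration.integral_add[OF integrable_torus[OF C_k_1D(3)[OF XY(1)]] integrable_torus[OF C_k_1D(3)[OF XY(2)]], of 1 2]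
    by simp
  also have "\<dots> = (LINT x|torus. a x * polar_det b c x + ?s x)" by (simp only: pt)
  also have "\<dots> = det_form a b c + (LINT x|torus. ?s x)"
    unfolding det_form_def polar_det_def
    by (intro Bochner_Integration.integral_add integrable_torus continuous_intros cont)
  finally show ?thesis by simp
qed

lemma det_form_commute12:
  assumes "C_k 3 a" "periodic a" "C_k 3 b" "periodic b" "C_k 3 c" "periodic c"
  shows "det_form a b c = det_form b a c"
  unfolding det_form_by_parts[OF assms] det_form_by_parts[OF assms(3,4,1,2,5,6)]
  by (simp add: mult_ac add_ac)

lemma polar_det_continuous:
  assumes "C_k 3 b" "C_k 3 c" shows "continuous_on UNIV (polar_det b c)"
  unfolding polar_det_def
  by (intro continuous_intros C_k_1D(2)[OF C_k_pd2(2)] assms)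

lemma det_form_add:
  assumes "C_k 3 a" "C_k 3 a'" "C_k 3 b" "C_k 3 c"
  shows "det_form (\<lambda>x. a x + a' x) b c = det_form a b c + det_form a' b c"
  unfolding det_form_def distrib_right
  by (intro Bochner_Integration.integral_add integrable_torus continuous_intros polar_det_continuous
        C_k_1D(2)[OF C_k_pd2(5)] assms)

lemma det_form_cube:
  assumes f: "C_k 3 f" "periodic f" and g: "C_k 3 g" "periodic g"
  shows "det_form (\<lambda>x. f x + g x) (\<lambda>x. f x + g x) (\<lambda>x. f x + g x)
    = det_form f f f + 3 * det_form g f f + 3 * det_form f g g + det_form g g g"
proof -
  let ?h = "\<lambda>x. f x + g x"
  have h: "C_k 3 ?h" "periodic ?h" using f g by (auto simp: periodic_def intro!: C_k_add)
  note fgh = f g h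
  have e: "det_form a ?h c = det_form a f c + det_form a g c"
    if "C_k 3 a" "periodic a" "C_k 3 c" "periodic c" for a c
    using det_form_commute12[OF that(1,2) h that(3,4)] det_form_commute12[OF that(1,2) f that(3,4)]
      det_form_commute12[OF that(1,2) g that(3,4)] det_form_add[OF f(1) g(1) that(1,3)] by simp
  have e3: "det_form a c ?h = det_form a c f + det_form a c g"
    if "C_k 3 a" "periodic a" "C_k 3 c" "periodic c" for a c
    using e[OF that] by (simp add: det_form_commute23[of a c])
  have "det_form ?h ?h ?h = det_form f ?h ?h + det_form g ?h ?h"
    by (rule det_form_add[OF f(1) g(1) h(1) h(1)])
  also have "\<dots> = det_form f f f + det_form f f g + (det_form f g f + det_form f g g)
      + (det_form g f f + det_form g f g + (det_form g g f + det_form g g g))"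
    by (simp only: e[OF f h] e[OF g h] e3[OF f f] e3[OF f g] e3[OF g f] e3[OF g g])
  also have "det_form f f g = det_form g f f"
    using det_form_commute23[of f f g] det_form_commute12[OF f g f] by simp
  also have "det_form f g f = det_form g f f" by (rule det_form_commute12[OF f g f])
  also have "det_form g f g = det_form f g g" by (rule det_form_commute12[OF g f g])
  also have "det_form g g f = det_form f g g"
    using det_form_commute23[of g g f] det_form_commute12[OF g f g] by simp
  finally show ?thesis by simp
qed

lemma det_form_bound:
  assumes a: "continuous_on UNIV a" "\<And>x. \<bar>a x\<bar> \<le> A" and b: "C_k 3 b" "\<And>i j x. \<bar>pd i (pd j b) x\<bar> \<le> D"
    and c: "C_k 3 c" "\<And>i j x. \<bar>pd i (pd j c) x\<bar> \<le> E"
  shows "\<bar>det_form a b c\<bar> \<le> 4 * A * D * E"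
proof -
  have A: "0 \<le> A" "0 \<le> D" "0 \<le> E" using a(2) b(2) c(2) order_trans[OF abs_ge_zero] by blast+
  have "norm (a x * polar_det b c x) \<le> 4 * A * D * E" for x
  proof -
    have p: "\<bar>pd i (pd j b) x * pd i' (pd j' c) x\<bar> \<le> D * E" for i j i' j'
      unfolding abs_mult by (intro mult_mono b c A) simp
    have "\<bar>polar_det b c x\<bar> \<le> 4 * (D * E)"
      unfolding polar_det_def using p[of 1 1 2 2] p[of 2 2 1 1] p[of 1 2 1 2] by linarith
    then have "\<bar>a x\<bar> * \<bar>polar_det b c x\<bar> \<le> A * (4 * (D * E))"
      by (intro mult_mono a A) auto
    then show ?thesis by (simp add: abs_mult)
  qed
  then show ?thesis
    using integral_torus_norm_le[of "\<lambda>x. a x * polar_det b c x" "4 * A * D * E"]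
      polar_det_continuous[OF b(1) c(1)] a(1) by (simp add: det_form_def continuous_on_mult)
qed

section \<open>Green's identities for the Laplacian\<close>

lemma green_identity:
  assumes u: "C_k 2 u" "periodic u" and w: "C_k 2 w" "periodic w"
  shows "(LINT x|torus. u x * laplacian w x) = - (LINT x|torus. grad u x \<bullet> grad w x)"
proof -
  have c: "C_k 1 u" "C_k 1 w" using C_k_mono[OF u(1), of 1] C_k_mono[OF w(1), of 1] by (simp_all del: C_k.simps)
  have w1: "C_k 1 (pd i w)" for i using C_k_pd[OF w(1), of 1] by (simp add: numeral_2_eq_2 del: C_k.simps)
  have p: "(LINT x|torus. u x * pd i (pd i w) x) = - (LINT x|torus. pd i u x * pd i w x)" for i
    using integral_by_parts[OF c(1) u(2) w1 periodic_pd[OF w(2)], of i] by simp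
  have "(LINT x|torus. u x * laplacian w x) = (LINT x|torus. u x * pd 1 (pd 1 w) x) + (LINT x|torus. u x * pd 2 (pd 2 w) x)"
    unfolding laplacian_def sum_UNIV_2 distrib_left
    by (intro Bochner_Integration.integral_add integrable_torus continuous_intros C_k_1D(2)[OF c(1)] C_k_1D(3)[OF w1])
  also have "\<dots> = - ((LINT x|torus. pd 1 u x * pd 1 w x) + (LINT x|torus. pd 2 u x * pd 2 w x))" by (simp add: p)
  also have "(LINT x|torus. pd 1 u x * pd 1 w x) + (LINT x|torus. pd 2 u x * pd 2 w x) = (LINT x|torus. grad u x \<bullet> grad w x)"
    unfolding inner_vec_def grad_nth sum_UNIV_2 inner_real_def
    by (intro Bochner_Integration.integral_add[symmetric] integrable_torus continuous_intros C_k_1D(3) c)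
  finally show ?thesis .
qed

lemma green_symmetric:
  assumes "C_k 2 u" "periodic u" "C_k 2 w" "periodic w"
  shows "(LINT x|torus. u x * laplacian w x) = (LINT x|torus. w x * laplacian u x)"
  unfolding green_identity[OF assms] green_identity[OF assms(3,4,1,2)] by (simp add: inner_commute)

section \<open>Functionals on Hoelder spaces\<close>

text \<open>A remainder quadratic in the norm near 0 is at most e times the norm once the norm is
  below e / (|C| + 1). All three functionals are differentiated through this criterion.\<close>

lemma has_functional_derivativeI:
  assumes g: "continuous_on UNIV g" "\<And>x. \<bar>g x\<bar> \<le> G" and d0: "0 < d0"
    and rem: "\<And>h. h \<in> holder_space0 k \<alpha> \<Longrightarrow> holder_norm k \<alpha> h < d0 \<Longrightarrow>
      \<bar>F (\<lambda>x. \<rho> x + h x) - F \<rho> - (LINT x|torus. g x * h x)\<bar> \<le> C * (holder_norm k \<alpha> h)\<^sup>2"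
  shows "has_functional_derivative k \<alpha> F \<rho> g"
  unfolding has_functional_derivative_def has_frechet_derivative_at_def
proof (intro conjI ballI allI impI)
  have cont: "continuous_on UNIV h" if "h \<in> holder_space0 k \<alpha>" for h
    using that by (auto simp: holder_space0_def holder_space_def intro: C_k_continuous)
  have N: "0 \<le> holder_norm k \<alpha> h" "\<And>x. \<bar>h x\<bar> \<le> holder_norm k \<alpha> h" if "h \<in> holder_space0 k \<alpha>" for h
    using that holder_norm_bounds[of h k \<alpha>] holder_norm_bounds(1)[of h k \<alpha> 0 0]
    by (auto simp: holder_space0_def mixed_pd_def)
  show "(LINT x|torus. g x * (f x + h x)) = (LINT x|torus. g x * f x) + (LINT x|torus. g x * h x)"
    if "f \<in> holder_space0 k \<alpha>" "h \<in> holder_space0 k \<alpha>" for f h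
    unfolding distrib_left using that
    by (intro Bochner_Integration.integral_add integrable_torus continuous_intros g cont)
  show "(LINT x|torus. g x * (c * h x)) = c * (LINT x|torus. g x * h x)" for c h
    by (simp add: mult.left_commute)
  show "\<exists>K. \<forall>h\<in>holder_space0 k \<alpha>. \<bar>LINT x|torus. g x * h x\<bar> \<le> K * holder_norm k \<alpha> h"
  proof (intro exI[of _ G] ballI)
    fix h assume h: "h \<in> holder_space0 k \<alpha>"
    have "norm (g x * h x) \<le> G * holder_norm k \<alpha> h" for x
      unfolding real_norm_def abs_mult using g(2)[of x] by (intro mult_mono g N h) auto
    then show "\<bar>LINT x|torus. g x * h x\<bar> \<le> G * holder_norm k \<alpha> h"
      using integral_torus_norm_le[of "\<lambda>x. g x * h x"] g(1) cont[OF h] by (simp add: continuous_on_mult)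
  qed
  fix e :: real assume e: "0 < e"
  define d where "d = min d0 (e / (\<bar>C\<bar> + 1))"
  have "0 < d" using d0 e by (simp add: d_def)
  moreover have "\<bar>F (\<lambda>x. \<rho> x + h x) - F \<rho> - (LINT x|torus. g x * h x)\<bar> \<le> e * holder_norm k \<alpha> h"
    if h: "h \<in> holder_space0 k \<alpha>" and small: "holder_norm k \<alpha> h < d" for h
  proof -
    have "\<bar>F (\<lambda>x. \<rho> x + h x) - F \<rho> - (LINT x|torus. g x * h x)\<bar> \<le> C * (holder_norm k \<alpha> h)\<^sup>2"
      by (rule rem[OF h]) (use small in \<open>simp add: d_def\<close>)
    also have "\<dots> \<le> (\<bar>C\<bar> + 1) * (holder_norm k \<alpha> h)\<^sup>2" by (intro mult_right_mono) auto
    also have "\<dots> = ((\<bar>C\<bar> + 1) * holder_norm k \<alpha> h) * holder_norm k \<alpha> h" by (simp add: power2_eq_square)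
    also have "\<dots> \<le> e * holder_norm k \<alpha> h"
    proof (intro mult_right_mono N h)
      have "holder_norm k \<alpha> h \<le> e / (\<bar>C\<bar> + 1)" using small by (simp add: d_def)
      then show "(\<bar>C\<bar> + 1) * holder_norm k \<alpha> h \<le> e" by (simp add: le_divide_eq mult.commute)
    qed
    finally show ?thesis .
  qed
  ultimately show "\<exists>d>0. \<forall>h\<in>holder_space0 k \<alpha>. holder_norm k \<alpha> h < d \<longrightarrow>
      \<bar>F (\<lambda>x. \<rho> x + h x) - F \<rho> - (LINT x|torus. g x * h x)\<bar> \<le> e * holder_norm k \<alpha> h" by blast
qed

text \<open>Cutting [0, 1] into n equal steps reduces the total quadratic error to C / n, so only
  the linear rate survives. This plays the part of integrating a derivative bound along a
  path.\<close>

lemma increment_bound: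
  fixes G :: "real \<Rightarrow> real"
  assumes step: "\<And>t t'. 0 \<le> t \<Longrightarrow> t \<le> 1 \<Longrightarrow> 0 \<le> t' \<Longrightarrow> t' \<le> 1 \<Longrightarrow> \<bar>G t' - G t\<bar> \<le> A * \<bar>t' - t\<bar> + C * (t' - t)\<^sup>2"
  shows "\<bar>G 1 - G 0\<bar> \<le> A"
proof -
  have n: "\<bar>G 1 - G 0\<bar> \<le> A + C / real n" if "0 < n" for n
  proof -
    have "G (real n / real n) - G (real 0 / real n) = (\<Sum>i<n. G (real (Suc i) / real n) - G (real i / real n))"
      by (rule sum_lessThan_telescope[symmetric])
    then have "\<bar>G 1 - G 0\<bar> = \<bar>\<Sum>i<n. G (real (Suc i) / real n) - G (real i / real n)\<bar>" using that by simp
    also have "\<dots> \<le> (\<Sum>i<n. \<bar>G (real (Suc i) / real n) - G (real i / real n)\<bar>)" by (rule sum_abs)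
    also have "\<dots> \<le> (\<Sum>i<n. A / real n + C / (real n)\<^sup>2)"
    proof (intro sum_mono)
      fix i assume "i \<in> {..<n}"
      then have i: "0 \<le> real i / real n" "real i / real n \<le> 1" "0 \<le> real (Suc i) / real n" "real (Suc i) / real n \<le> 1"
        using that by (auto simp: divide_le_eq)
      have "real (Suc i) / real n - real i / real n = 1 / real n" by (simp add: diff_divide_distrib[symmetric])
      then show "\<bar>G (real (Suc i) / real n) - G (real i / real n)\<bar> \<le> A / real n + C / (real n)\<^sup>2"
        using step[OF i] by (simp add: power_divide)
    qed
    also have "\<dots> = A + C / real n" using that by (simp add: distrib_left power2_eq_square)
    finally show ?thesis .
  qed
  have "(\<lambda>n. A + C / real n) \<longlonglongrightarrow> A + 0" by (intro tendsto_intros lim_const_over_n)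
  then show ?thesis
    by (intro LIMSEQ_le_const[of "\<lambda>n. A + C / real n" A]) (auto intro!: exI[of _ 1] n)
qed

lemma fseries_minus: "fseries (\<lambda>n. - a n) x = - fseries a x"
  using fseries_scaleR[of "-1" a x] by simp

section \<open>Expansion of the semigeostrophic potential\<close>

locale hoelder_setting =
  fixes k :: nat and \<alpha> :: real
  assumes k: "3 \<le> k" and \<alpha>: "0 < \<alpha>" "\<alpha> < 1"
begin

text \<open>Potentials gain two derivatives and are estimated with \<open>k + \<alpha>\<close> weights. Since \<open>s < k - 1\<close>,
  Bessel's inequality for the \<open>k\<close>-th derivatives of \<open>\<rho>\<close> controls its Fourier series with weight \<open>s\<close>.\<close>

abbreviation s :: real where "s \<equiv> real k + \<alpha> - 2"

abbreviation B :: "ell1 \<Rightarrow> ell1 \<Rightarrow> ell1" where "B \<equiv> twisted_conv (det_kernel s)"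

lemma s: "1 < s" "0 \<le> s" "s + 2 = real k + \<alpha>" "s < real k - 1"
  using k \<alpha> by auto

sublocale bounded_kernel "det_kernel s" 2
  by (rule det_kernel_bounded[OF s(2)])

definition embed_const :: real where
  "embed_const = 2 * 3 ^ k * sqrt (\<Sum>\<^sub>\<infinity>n. wt n powr (2 * (s - real k)))"

lemma embed_const_nonneg: "0 \<le> embed_const"
  unfolding embed_const_def by (intro mult_nonneg_nonneg real_sqrt_ge_zero infsum_nonneg) auto

lemma holder_space0D:
  assumes "\<rho> \<in> holder_space0 k \<alpha>"
  shows "C_k k \<rho>" "periodic \<rho>" "continuous_on UNIV \<rho>" "fc \<rho> 0 = 0"
    "hoelder_bd k \<alpha> (holder_norm k \<alpha> \<rho>) \<rho>" "0 \<le> holder_norm k \<alpha> \<rho>" "\<And>x. \<bar>\<rho> x\<bar> \<le> holder_norm k \<alpha> \<rho>"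
proof -
  have h: "\<rho> \<in> holder_space k \<alpha>" and m: "mean_zero \<rho>" using assms by (auto simp: holder_space0_def)
  show C: "C_k k \<rho>" "periodic \<rho>" using h by (auto simp: holder_space_def)
  show "continuous_on UNIV \<rho>" by (rule C_k_continuous[OF C(1)])
  show "fc \<rho> 0 = 0" using m by (simp add: fc_0 mean_zero_def)
  show b: "hoelder_bd k \<alpha> (holder_norm k \<alpha> \<rho>) \<rho>" by (rule holder_space_imp_hoelder_bd[OF h])
  show "0 \<le> holder_norm k \<alpha> \<rho>" "\<And>x. \<bar>\<rho> x\<bar> \<le> holder_norm k \<alpha> \<rho>"
    using hoelder_bd_nonneg[OF b] hoelder_bd_abs[OF b] by auto
qed

lemma holder_space0I:
  assumes "hoelder_bd k \<alpha> K f" "periodic f" "(LINT x|torus. f x) = 0"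
  shows "f \<in> holder_space0 k \<alpha>"
  using hoelder_bd_imp_holder_norm(1)[OF assms(1,2) \<alpha>(1)] assms(3) by (simp add: holder_space0_def mean_zero_def)

lemma holder_space0_add:
  assumes f: "f \<in> holder_space0 k \<alpha>" and g: "g \<in> holder_space0 k \<alpha>"
  shows "(\<lambda>x. f x + g x) \<in> holder_space0 k \<alpha>"
proof (rule holder_space0I[OF hoelder_bd_add[OF holder_space0D(5)[OF f] holder_space0D(5)[OF g]]])
  show "periodic (\<lambda>x. f x + g x)" using holder_space0D(2)[OF f] holder_space0D(2)[OF g] by (simp add: periodic_def)
  show "(LINT x|torus. f x + g x) = 0"
    using f g Bochner_Integration.integral_add[OF integrable_torus[OF holder_space0D(3)[OF f]] integrable_torus[OF holder_space0D(3)[OF g]]]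
    by (simp add: holder_space0_def mean_zero_def)
qed

lemma holder_space0_cmult:
  assumes f: "f \<in> holder_space0 k \<alpha>"
  shows "(\<lambda>x. c * f x) \<in> holder_space0 k \<alpha>"
proof (rule holder_space0I[OF hoelder_bd_cmult[OF holder_space0D(5)[OF f]]])
  show "periodic (\<lambda>x. c * f x)" by (rule periodic_cmult[OF holder_space0D(2)[OF f]])
  show "(LINT x|torus. c * f x) = 0" using f by (simp add: holder_space0_def mean_zero_def)
qed

lemma fourier_embed:
  assumes \<rho>: "\<rho> \<in> holder_space0 k \<alpha>"
  shows "coef (fourier_embed s \<rho>) n = of_real (wt n powr s) * fc \<rho> n"
    and "norm (fourier_embed s \<rho>) \<le> embed_const * holder_norm k \<alpha> \<rho>"
proof -
  have K: "\<bar>(pd i ^^ k) \<rho> x\<bar> \<le> holder_norm k \<alpha> \<rho>" for i x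
    using exhaust_2[of i] holder_norm_bounds(1)[of \<rho> k \<alpha> k 0 x] holder_norm_bounds(1)[of \<rho> k \<alpha> 0 k x] \<rho>
    by (auto simp: holder_space0_def mixed_pd_def)
  have b: "(\<Sum>n\<in>F. cmod (of_real (wt n powr s) * fc \<rho> n)) \<le> embed_const * holder_norm k \<alpha> \<rho>" if "finite F" for F
    using fc_weighted_sum[OF holder_space0D(1,2)[OF \<rho>] K holder_space0D(4)[OF \<rho>] that s(4)]
    by (simp add: norm_mult embed_const_def mult_ac)
  show "norm (fourier_embed s \<rho>) \<le> embed_const * holder_norm k \<alpha> \<rho>"
    unfolding fourier_embed_def by (rule ell1_boundI(2)[OF b])
  show "coef (fourier_embed s \<rho>) n = of_real (wt n powr s) * fc \<rho> n"
    unfolding fourier_embed_def using coef_Abs[OF ell1_boundI(1)[OF b]] by simp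
qed

lemma embed_hermitian: "\<rho> \<in> holder_space0 k \<alpha> \<Longrightarrow> fourier_embed s \<rho> \<in> hermitian"
  unfolding hermitian_def by (intro CollectI allI) (simp add: fourier_embed fc_minus_index)

lemma embed_0: "\<rho> \<in> holder_space0 k \<alpha> \<Longrightarrow> coef (fourier_embed s \<rho>) 0 = 0"
  by (simp add: fourier_embed holder_space0D)

lemma fseries_embed:
  assumes \<rho>: "\<rho> \<in> holder_space0 k \<alpha>"
  shows "fseries (unweight s (fourier_embed s \<rho>)) = \<rho>"
proof -
  have e: "unweight s (fourier_embed s \<rho>) = fc \<rho>" by (simp add: fun_eq_iff unweight_def fourier_embed[OF \<rho>])
  then have "wsummable s (fc \<rho>)" using unweight_wsummable(1)[of s "fourier_embed s \<rho>"] by simp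
  then show ?thesis unfolding e by (intro fourier_inversion holder_space0D[OF \<rho>]) (use s in auto)
qed

lemma embed_add:
  assumes f: "f \<in> holder_space0 k \<alpha>" and g: "g \<in> holder_space0 k \<alpha>"
  shows "fourier_embed s (\<lambda>x. f x + g x) = fourier_embed s f + fourier_embed s g"
  by (rule ell1_eqI) (simp add: fourier_embed f g holder_space0_add fc_add holder_space0D distrib_left)

lemma embed_cmult:
  assumes f: "f \<in> holder_space0 k \<alpha>"
  shows "fourier_embed s (\<lambda>x. c * f x) = c *\<^sub>R fourier_embed s f"
  by (rule ell1_eqI) (simp add: fourier_embed f holder_space0_cmult fc_cmult scaleR_conv_of_real)

definition pot_const :: real where "pot_const = 4 * pi * (2 * pi) ^ k"

lemma pot_const_nonneg: "0 \<le> pot_const" by (simp add: pot_const_def)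

lemma potential_bd: "hoelder_bd k \<alpha> (pot_const * norm u) (potential s u)"
  unfolding pot_const_def by (rule potential_hoelder_bd) (use \<alpha> s in auto)

lemma potential_C_k: "C_k k (potential s u)" by (rule hoelder_bd_C_k[OF potential_bd \<alpha>(1)])

lemma potential_C_3: "C_k 3 (potential s u)" by (rule C_k_mono[OF potential_C_k k])

lemma potential_C_2: "C_k 2 (potential s u)" by (rule C_k_mono[OF potential_C_k]) (use k in simp)

lemma potential_cont: "continuous_on UNIV (potential s u)" by (rule C_k_continuous[OF potential_C_k])

lemma potential_diffble: "potential s u differentiable (at x)" by (rule C_k_diff[OF potential_C_k]) (use k in simp)

lemma potential_abs: "\<bar>potential s u x\<bar> \<le> pot_const * norm u" by (rule hoelder_bd_abs[OF potential_bd])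

lemma potential_pd_abs: "\<bar>pd i (potential s u) x\<bar> \<le> pot_const * norm u"
  and potential_pd2_abs: "\<bar>pd i (pd j (potential s u)) x\<bar> \<le> pot_const * norm u"
proof -
  have "k = Suc (Suc (k - 2))" using k by simp
  then have h: "hoelder_bd (Suc (Suc (k - 2))) \<alpha> (pot_const * norm u) (potential s u)" using potential_bd by metis
  then have "hoelder_bd (Suc (k - 2)) \<alpha> (pot_const * norm u) (pd i (potential s u))" for i by simp
  then show "\<bar>pd i (potential s u) x\<bar> \<le> pot_const * norm u" by (rule hoelder_bd_abs)
  have "hoelder_bd (k - 2) \<alpha> (pot_const * norm u) (pd i (pd j (potential s u)))" using h by simp
  then show "\<bar>pd i (pd j (potential s u)) x\<bar> \<le> pot_const * norm u" by (rule hoelder_bd_abs)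
qed

lemma phi_eq:
  assumes \<rho>: "\<rho> \<in> holder_space0 k \<alpha>"
  shows "phi \<rho> = potential s (fourier_embed s \<rho>)"
  unfolding phi_def
  by (rule poisson_eqI[OF potential_C_2 potential_periodic potential_mean_zero[OF embed_hermitian[OF \<rho>] s(2)]])
     (simp add: laplacian_potential embed_hermitian embed_0 \<rho> s fseries_embed)

lemma laplacian_phi: "\<rho> \<in> holder_space0 k \<alpha> \<Longrightarrow> laplacian (phi \<rho>) x = \<rho> x"
  by (simp add: phi_eq laplacian_potential embed_hermitian embed_0 s fseries_embed)

lemma minus_hermitian: "u \<in> hermitian \<Longrightarrow> - u \<in> hermitian" by (simp add: hermitian_def)

text \<open>The Hessian determinant of \<open>phi\<close> has weighted coefficients
  \<open>B p p\<close> for the embedded density \<open>p\<close>, so - \<open>B p p\<close> is the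
  Laplacian of \<open>chi\<close> in coefficient form.\<close>

lemma chi_eq:
  assumes \<rho>: "\<rho> \<in> holder_space0 k \<alpha>"
  shows "chi \<rho> = potential s (- B (fourier_embed s \<rho>) (fourier_embed s \<rho>))"
    and "laplacian (chi \<rho>) x = - det (hessian (phi \<rho>) x)"
proof -
  let ?u = "B (fourier_embed s \<rho>) (fourier_embed s \<rho>)"
  have h: "- ?u \<in> hermitian" by (intro minus_hermitian det_conv_hermitian s embed_hermitian \<rho>)
  have "unweight s (- ?u) = (\<lambda>n. - unweight s ?u n)" by (simp add: fun_eq_iff unweight_def)
  then have l: "laplacian (potential s (- ?u)) x = - det (hessian (phi \<rho>) x)" for x
    using laplacian_potential[OF h _ s(1)] coef_det_conv_0[OF s(2)] det_hessian_potential[OF embed_hermitian[OF \<rho>] s(1)]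
    by (simp add: phi_eq[OF \<rho>] fseries_minus)
  show c: "chi \<rho> = potential s (- ?u)"
    unfolding chi_def
    by (rule poisson_eqI[OF potential_C_2 potential_periodic potential_mean_zero[OF h s(2)] l])
  show "laplacian (chi \<rho>) x = - det (hessian (phi \<rho>) x)" unfolding c by (rule l)
qed

text \<open>The two bounds serve different ends: the coefficient norm drives the contraction, and
  the sup bound keeps 1 + \<epsilon> \<rho> positive.\<close>

definition size_le :: "real \<Rightarrow> (real^2 \<Rightarrow> real) \<Rightarrow> bool" where
  "size_le N \<rho> \<longleftrightarrow> \<rho> \<in> holder_space0 k \<alpha> \<and> norm (fourier_embed s \<rho>) \<le> N \<and> (\<forall>x. \<bar>\<rho> x\<bar> \<le> N)"

lemma size_le_holder:
  assumes "\<rho> \<in> holder_space0 k \<alpha>" "holder_norm k \<alpha> \<rho> \<le> N"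
  shows "size_le ((embed_const + 1) * N) \<rho>"
proof -
  have N: "0 \<le> N" using holder_space0D(6)[OF assms(1)] assms(2) by linarith
  have "embed_const * holder_norm k \<alpha> \<rho> \<le> embed_const * N"
    by (intro mult_left_mono assms embed_const_nonneg)
  moreover have "0 \<le> embed_const * N" using embed_const_nonneg N by simp
  ultimately show ?thesis
    unfolding size_le_def distrib_right mult_1
    using fourier_embed(2)[OF assms(1)] holder_space0D(7)[OF assms(1)] assms N by (auto intro: order_trans add_increasing2 add_increasing)
qed

lemma size_le_add:
  assumes f: "size_le N f" and g: "size_le N' g"
  shows "size_le (N + N') (\<lambda>x. f x + g x)"
  unfolding size_le_def
proof (intro conjI allI)
  have fg: "f \<in> holder_space0 k \<alpha>" "g \<in> holder_space0 k \<alpha>" using f g by (auto simp: size_le_def)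
  show "(\<lambda>x. f x + g x) \<in> holder_space0 k \<alpha>" by (rule holder_space0_add[OF fg])
  show "norm (fourier_embed s (\<lambda>x. f x + g x)) \<le> N + N'"
    unfolding embed_add[OF fg] using f g by (intro norm_triangle_mono) (auto simp: size_le_def)
  fix x
  have "\<bar>f x\<bar> \<le> N" "\<bar>g x\<bar> \<le> N'" using f g by (auto simp: size_le_def)
  then show "\<bar>f x + g x\<bar> \<le> N + N'" by linarith
qed

lemma size_le_cmult: "size_le N f \<Longrightarrow> size_le (\<bar>c\<bar> * N) (\<lambda>x. c * f x)"
  unfolding size_le_def
  by (auto simp: embed_cmult abs_mult intro!: holder_space0_cmult mult_left_mono)

lemma size_le_mono: "size_le N f \<Longrightarrow> N \<le> N' \<Longrightarrow> size_le N' f"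
  unfolding size_le_def by (auto intro: order_trans)

lemma size_le_nonneg: "size_le N f \<Longrightarrow> 0 \<le> N"
  unfolding size_le_def using norm_ge_zero order_trans by blast

section \<open>Existence, stability and expansion of the potential\<close>

lemma psi_solution:
  assumes \<rho>: "size_le M \<rho>" and M: "16 * \<bar>\<epsilon>\<bar> * M \<le> 1" and \<epsilon>: "\<epsilon> \<noteq> 0"
  obtains b where "norm b \<le> 2 * M" "b = fourier_embed s \<rho> - \<epsilon> *\<^sub>R B b b" "psi \<epsilon> \<rho> = potential s b"
    "\<And>x. 0 < 1 + \<epsilon> * \<rho> x" "jac (\<lambda>x. \<epsilon> * psi \<epsilon> \<rho> x) = (\<lambda>x. 1 + \<epsilon> * \<rho> x)"
proof -
  have h: "\<rho> \<in> holder_space0 k \<alpha>" and n: "norm (fourier_embed s \<rho>) \<le> M" and a: "\<And>x. \<bar>\<rho> x\<bar> \<le> M"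
    using \<rho> by (auto simp: size_le_def)
  have pos: "0 < 1 + \<epsilon> * \<rho> x" for x
  proof -
    have "\<bar>\<epsilon> * \<rho> x\<bar> \<le> \<bar>\<epsilon>\<bar> * M" unfolding abs_mult by (intro mult_left_mono a) simp
    then show ?thesis using M by linarith
  qed
  obtain b where b: "b \<in> hermitian" "norm b \<le> 2 * M" "b = fourier_embed s \<rho> - \<epsilon> *\<^sub>R B b b"
  proof (rule quadratic_fixed_point[of B hermitian "fourier_embed s \<rho>" \<epsilon> M])
    show "fourier_embed s \<rho> - \<epsilon> *\<^sub>R B x x \<in> hermitian" if "x \<in> hermitian" for x
      by (intro hermitian_diff hermitian_scaleR embed_hermitian det_conv_hermitian h s that)
  qed (use twisted_conv_diff_left twisted_conv_diff_right norm_twisted_conv closed_hermitian embed_hermitian h n M in auto)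
  have b0: "coef b 0 = 0"
  proof -
    have "coef b 0 = coef (fourier_embed s \<rho> - \<epsilon> *\<^sub>R B b b) 0" by (rule arg_cong[where f = "\<lambda>u. coef u 0", OF b(3)])
    then show ?thesis by (simp add: embed_0 h coef_det_conv_0[OF s(2)])
  qed
  have eq: "laplacian (potential s b) x + \<epsilon> * det (hessian (potential s b) x) = \<rho> x" for x
  proof -
    have "laplacian (potential s b) x + \<epsilon> * det (hessian (potential s b) x)
       = fseries (unweight s b) x + fseries (\<lambda>n. \<epsilon> *\<^sub>R unweight s (B b b) n) x"
      by (simp add: laplacian_potential[OF _ _ s(1)] det_hessian_potential[OF _ s(1)] b(1) b0 fseries_scaleR)
    also have "\<dots> = fseries (\<lambda>n. unweight s b n + \<epsilon> *\<^sub>R unweight s (B b b) n) x"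
    proof (rule fseries_add[symmetric])
      show "unweight s b norm_summable_on UNIV" by (rule wsummable_abs[OF unweight_wsummable(1) s(2)])
      have "unweight s (B b b) norm_summable_on UNIV" by (rule wsummable_abs[OF unweight_wsummable(1) s(2)])
      then show "(\<lambda>n. \<epsilon> *\<^sub>R unweight s (B b b) n) norm_summable_on UNIV"
        using abs_summable_cmult[of _ UNIV "of_real \<epsilon>"] by (simp add: scaleR_conv_of_real)
    qed
    also have "(\<lambda>n. unweight s b n + \<epsilon> *\<^sub>R unweight s (B b b) n) = unweight s (b + \<epsilon> *\<^sub>R B b b)"
      by (simp add: fun_eq_iff unweight_def add_divide_distrib scaleR_conv_of_real)
    also have "b + \<epsilon> *\<^sub>R B b b = fourier_embed s \<rho>" by (rule eq_diff_eq[THEN iffD1, OF b(3)])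
    finally show ?thesis by (simp add: fseries_embed h)
  qed
  have psi: "psi \<epsilon> \<rho> = potential s b"
    by (rule psi_eqI[OF potential_C_2 potential_periodic potential_mean_zero[OF b(1) s(2)] eq pos \<epsilon>])
  have "jac (\<lambda>x. \<epsilon> * psi \<epsilon> \<rho> x) = (\<lambda>x. 1 + \<epsilon> * \<rho> x)"
    unfolding psi by (simp add: fun_eq_iff jac_cmult[OF potential_C_2] eq)
  then show thesis using that b psi pos by blast
qed

lemma B_diff_bound:
  assumes "norm x \<le> R" "norm y \<le> R"
  shows "norm (B x x - B y y) \<le> 4 * R * norm (x - y)"
proof -
  have "B x x - B y y = B (x - y) x + B y (x - y)" by (simp add: twisted_conv_diff_left twisted_conv_diff_right)
  then have "norm (B x x - B y y) \<le> 2 * norm (x - y) * norm x + 2 * norm y * norm (x - y)"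
    by (metis norm_triangle_mono norm_twisted_conv)
  also have "\<dots> \<le> 2 * norm (x - y) * R + 2 * R * norm (x - y)"
    using order_trans[OF norm_ge_zero assms(1)] by (intro add_mono mult_mono assms) auto
  finally show ?thesis by (simp add: algebra_simps)
qed

text \<open>Subtracting the two fixed-point equations leaves a difference of quadratic terms that is
  at most half of |c - b|, since 8 |\<epsilon>| M <= 1/2; absorbing it on the left gives the factor
  2.\<close>

lemma psi_lipschitz:
  assumes \<rho>: "size_le M \<rho>" and h: "size_le N h" and \<rho>h: "size_le M (\<lambda>x. \<rho> x + h x)"
    and M: "16 * \<bar>\<epsilon>\<bar> * M \<le> 1" and \<epsilon>: "\<epsilon> \<noteq> 0"
  shows "\<bar>psi \<epsilon> (\<lambda>x. \<rho> x + h x) x - psi \<epsilon> \<rho> x\<bar> \<le> pot_const * (2 * N)"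
proof -
  obtain b where b: "norm b \<le> 2 * M" "b = fourier_embed s \<rho> - \<epsilon> *\<^sub>R B b b" "psi \<epsilon> \<rho> = potential s b"
    by (rule psi_solution[OF \<rho> M \<epsilon>]) (rule that)
  obtain c where c: "norm c \<le> 2 * M" "c = fourier_embed s (\<lambda>x. \<rho> x + h x) - \<epsilon> *\<^sub>R B c c" "psi \<epsilon> (\<lambda>x. \<rho> x + h x) = potential s c"
    by (rule psi_solution[OF \<rho>h M \<epsilon>]) (rule that)
  have e: "fourier_embed s (\<lambda>x. \<rho> x + h x) = fourier_embed s \<rho> + fourier_embed s h" using \<rho> h by (simp add: size_le_def embed_add)
  have "c - b = (fourier_embed s (\<lambda>x. \<rho> x + h x) - \<epsilon> *\<^sub>R B c c) - (fourier_embed s \<rho> - \<epsilon> *\<^sub>R B b b)"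
    by (rule arg_cong2[where f = minus, OF c(2) b(2)])
  also have "\<dots> = fourier_embed s h - \<epsilon> *\<^sub>R (B c c - B b b)" unfolding e by (simp add: algebra_simps)
  finally have cb: "c - b = fourier_embed s h - \<epsilon> *\<^sub>R (B c c - B b b)" .
  have "norm (c - b) \<le> norm (fourier_embed s h) + \<bar>\<epsilon>\<bar> * norm (B c c - B b b)"
    unfolding cb using norm_triangle_ineq4[of "fourier_embed s h" "\<epsilon> *\<^sub>R (B c c - B b b)"] by simp
  also have "\<dots> \<le> norm (fourier_embed s h) + \<bar>\<epsilon>\<bar> * (4 * (2 * M) * norm (c - b))"
    by (intro add_left_mono mult_left_mono B_diff_bound b(1) c(1)) simp
  also have "\<bar>\<epsilon>\<bar> * (4 * (2 * M) * norm (c - b)) = (16 * \<bar>\<epsilon>\<bar> * M) * (norm (c - b) / 2)" by simp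
  also have "\<dots> \<le> 1 * (norm (c - b) / 2)" by (intro mult_right_mono M) simp
  finally have "norm (c - b) \<le> 2 * N" using h by (simp add: size_le_def)
  then have "pot_const * norm (c - b) \<le> pot_const * (2 * N)" by (intro mult_left_mono pot_const_nonneg)
  then show ?thesis using potential_abs[of "c - b" x] by (simp add: b(3) c(3) potential_diff[OF s(2)])
qed

text \<open>With p the embedded density, the error is r = - \<epsilon> (B b b - B p p), and b - p =
  - \<epsilon> B b b is already of order \<epsilon>. The two factors 8 from the bounds on the ball
  of radius 2M multiply to 64.\<close>

lemma psi_expansion:
  assumes \<rho>: "size_le M \<rho>" and M: "16 * \<bar>\<epsilon>\<bar> * M \<le> 1" and \<epsilon>: "\<epsilon> \<noteq> 0"
  obtains r where "norm r \<le> 64 * M ^ 3 * \<epsilon>\<^sup>2" "\<And>x. psi \<epsilon> \<rho> x = phi \<rho> x + \<epsilon> * chi \<rho> x + potential s r x"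
proof -
  have M0: "0 \<le> M" by (rule size_le_nonneg[OF \<rho>])
  obtain b where b: "norm b \<le> 2 * M" "b = fourier_embed s \<rho> - \<epsilon> *\<^sub>R B b b" "psi \<epsilon> \<rho> = potential s b"
    by (rule psi_solution[OF \<rho> M \<epsilon>]) (rule that)
  have h: "\<rho> \<in> holder_space0 k \<alpha>" and n: "norm (fourier_embed s \<rho>) \<le> M" using \<rho> by (auto simp: size_le_def)
  let ?p = "fourier_embed s \<rho>"
  define r where "r = b - ?p + \<epsilon> *\<^sub>R B ?p ?p"
  have "b + \<epsilon> *\<^sub>R B b b = ?p" by (rule eq_diff_eq[THEN iffD1, OF b(2)])
  then have bp': "b - ?p = - (\<epsilon> *\<^sub>R B b b)" by (metis add_diff_cancel_left' minus_diff_eq)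
  have "norm (b - ?p) = \<bar>\<epsilon>\<bar> * norm (B b b)" unfolding bp' by simp
  also have "\<dots> \<le> \<bar>\<epsilon>\<bar> * (2 * (2 * M) * (2 * M))"
    by (intro mult_left_mono order_trans[OF norm_twisted_conv] mult_mono b(1)) (use M0 in auto)
  finally have bp: "norm (b - ?p) \<le> \<bar>\<epsilon>\<bar> * (8 * M\<^sup>2)" by (simp add: power2_eq_square)
  have "r = - (\<epsilon> *\<^sub>R (B b b - B ?p ?p))" unfolding r_def bp' by (simp add: algebra_simps)
  then have "norm r = \<bar>\<epsilon>\<bar> * norm (B b b - B ?p ?p)" by simp
  also have "\<dots> \<le> \<bar>\<epsilon>\<bar> * (4 * (2 * M) * (\<bar>\<epsilon>\<bar> * (8 * M\<^sup>2)))"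
    using n M0 by (intro mult_left_mono order_trans[OF B_diff_bound[of _ "2 * M"]] bp b(1)) auto
  also have "\<dots> = 64 * M ^ 3 * \<epsilon>\<^sup>2" by (simp add: power2_eq_square power3_eq_cube flip: abs_mult)
  finally have "norm r \<le> 64 * M ^ 3 * \<epsilon>\<^sup>2" .
  moreover have "psi \<epsilon> \<rho> x = phi \<rho> x + \<epsilon> * chi \<rho> x + potential s r x" for x
  proof -
    have "b = ?p + \<epsilon> *\<^sub>R (- B ?p ?p) + r" by (simp add: r_def)
    then have "potential s b x = potential s (?p + \<epsilon> *\<^sub>R (- B ?p ?p) + r) x" by metis
    then show ?thesis by (simp only: b(3) phi_eq[OF h] chi_eq(1)[OF h] potential_add[OF s(2)] potential_scaleR)
  qed
  ultimately show thesis by (rule that)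
qed

end

section \<open>Quadratic remainders of the three functionals\<close>

context hoelder_setting
begin

lemma psi_cont:
  assumes "size_le M \<rho>" "16 * \<bar>\<epsilon>\<bar> * M \<le> 1" "\<epsilon> \<noteq> 0"
  shows "continuous_on UNIV (psi \<epsilon> \<rho>)" "C_k k (psi \<epsilon> \<rho>)" "periodic (psi \<epsilon> \<rho>)" "\<bar>psi \<epsilon> \<rho> x\<bar> \<le> pot_const * (2 * M)"
proof -
  obtain b where b: "norm b \<le> 2 * M" "psi \<epsilon> \<rho> = potential s b"
    by (rule psi_solution[OF assms]) (rule that)
  show "continuous_on UNIV (psi \<epsilon> \<rho>)" "C_k k (psi \<epsilon> \<rho>)" "periodic (psi \<epsilon> \<rho>)"
    unfolding b(2) by (rule potential_cont potential_C_k potential_periodic)+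
  have "pot_const * norm b \<le> pot_const * (2 * M)" by (intro mult_left_mono b pot_const_nonneg)
  then show "\<bar>psi \<epsilon> \<rho> x\<bar> \<le> pot_const * (2 * M)" using potential_abs[of b x] unfolding b(2) by linarith
qed

text \<open>By duality \<open>H_eps \<epsilon>\<close> is convex with subgradient \<open>- psi \<epsilon> \<rho>\<close> at \<open>\<rho>\<close>; using the subgradient
  at both ends turns Lipschitz continuity of \<open>psi \<epsilon>\<close> into a quadratic remainder.\<close>

lemma H_eps_subgradient:
  assumes \<rho>: "size_le M \<rho>" and \<rho>': "size_le M \<rho>'" and M: "16 * \<bar>\<epsilon>\<bar> * M \<le> 1" and \<epsilon>: "\<epsilon> \<noteq> 0"
  shows "H_eps \<epsilon> \<rho> - (LINT x|torus. psi \<epsilon> \<rho> x * (\<rho>' x - \<rho> x)) \<le> H_eps \<epsilon> \<rho>'"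
proof -
  have pos: "\<And>x. 0 < 1 + \<epsilon> * \<rho> x" and jac: "jac (\<lambda>x. \<epsilon> * psi \<epsilon> \<rho> x) = (\<lambda>x. 1 + \<epsilon> * \<rho> x)"
    using psi_solution[OF \<rho> M \<epsilon>] by blast+
  have pos': "\<And>x. 0 < 1 + \<epsilon> * \<rho>' x" and jac': "jac (\<lambda>x. \<epsilon> * psi \<epsilon> \<rho>' x) = (\<lambda>x. 1 + \<epsilon> * \<rho>' x)"
    using psi_solution[OF \<rho>' M \<epsilon>] by blast+
  have k2: "2 \<le> k" using k by simp
  obtain l where l: "transport_potential (\<lambda>x. \<epsilon> * psi \<epsilon> \<rho> x) l"
    by (rule jac_pos_imp_transport_potential[OF C_k_cmult[OF C_k_mono[OF psi_cont(2)[OF \<rho> M \<epsilon>] k2]] periodic_cmult[OF psi_cont(3)[OF \<rho> M \<epsilon>]]])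
       (use pos jac in auto)
  obtain l' where l': "transport_potential (\<lambda>x. \<epsilon> * psi \<epsilon> \<rho>' x) l'"
    by (rule jac_pos_imp_transport_potential[OF C_k_cmult[OF C_k_mono[OF psi_cont(2)[OF \<rho>' M \<epsilon>] k2]] periodic_cmult[OF psi_cont(3)[OF \<rho>' M \<epsilon>]]])
       (use pos' jac' in auto)
  have "(LINT x|torus. (\<epsilon> * \<rho>' x - \<epsilon> * \<rho> x) * (\<epsilon> * psi \<epsilon> \<rho> x)) = (LINT x|torus. \<epsilon>\<^sup>2 * (psi \<epsilon> \<rho> x * (\<rho>' x - \<rho> x)))"
    by (intro Bochner_Integration.integral_cong refl) (simp add: power2_eq_square algebra_simps)
  then have I: "(LINT x|torus. (\<epsilon> * \<rho>' x - \<epsilon> * \<rho> x) * (\<epsilon> * psi \<epsilon> \<rho> x)) = \<epsilon>\<^sup>2 * (LINT x|torus. psi \<epsilon> \<rho> x * (\<rho>' x - \<rho> x))"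
    by simp
  have "(W2 (density torus (\<lambda>x. ennreal (1 + \<epsilon> * \<rho> x))) torus)\<^sup>2 - 2 * (\<epsilon>\<^sup>2 * (LINT x|torus. psi \<epsilon> \<rho> x * (\<rho>' x - \<rho> x)))
    \<le> (W2 (density torus (\<lambda>x. ennreal (1 + \<epsilon> * \<rho>' x))) torus)\<^sup>2"
    using W2_subgradient[OF l l'] pos pos' by (simp add: jac jac' less_imp_le I)
  then have "(1 / (2 * \<epsilon>\<^sup>2)) * ((W2 (density torus (\<lambda>x. ennreal (1 + \<epsilon> * \<rho> x))) torus)\<^sup>2 - 2 * (\<epsilon>\<^sup>2 * (LINT x|torus. psi \<epsilon> \<rho> x * (\<rho>' x - \<rho> x))))
    \<le> (1 / (2 * \<epsilon>\<^sup>2)) * (W2 (density torus (\<lambda>x. ennreal (1 + \<epsilon> * \<rho>' x))) torus)\<^sup>2"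
    by (rule mult_left_mono) simp
  then show ?thesis using \<epsilon> unfolding H_eps_def right_diff_distrib by simp
qed

lemma size_leD:
  assumes "size_le N h"
  shows "h \<in> holder_space0 k \<alpha>" "norm (fourier_embed s h) \<le> N" "\<bar>h x\<bar> \<le> N" "continuous_on UNIV h"
  using assms holder_space0D(3)[of h] by (auto simp: size_le_def)

lemma integral_product_bound:
  fixes f h :: "real^2 \<Rightarrow> real"
  assumes "continuous_on UNIV f" "continuous_on UNIV h" "\<And>x. \<bar>f x\<bar> \<le> A" "\<And>x. \<bar>h x\<bar> \<le> N"
  shows "\<bar>LINT x|torus. f x * h x\<bar> \<le> A * N"
proof -
  have "norm (f x * h x) \<le> A * N" for x
    unfolding real_norm_def abs_mult using order_trans[OF abs_ge_zero assms(3)] by (intro mult_mono assms) auto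
  then show ?thesis using integral_torus_norm_le[of "\<lambda>x. f x * h x" "A * N"] assms(1,2) by (simp add: continuous_on_mult)
qed

lemma H_eps_remainder:
  assumes \<rho>: "size_le M \<rho>" and h: "size_le N h" and \<rho>h: "size_le M (\<lambda>x. \<rho> x + h x)"
    and M: "16 * \<bar>\<epsilon>\<bar> * M \<le> 1" and \<epsilon>: "\<epsilon> \<noteq> 0"
  shows "\<bar>H_eps \<epsilon> (\<lambda>x. \<rho> x + h x) - H_eps \<epsilon> \<rho> - (LINT x|torus. - psi \<epsilon> \<rho> x * h x)\<bar> \<le> pot_const * (2 * N) * N"
proof -
  let ?\<rho>' = "\<lambda>x. \<rho> x + h x"
  note c = psi_cont(1)[OF \<rho> M \<epsilon>] psi_cont(1)[OF \<rho>h M \<epsilon>] size_leD(4)[OF h]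
  have 1: "H_eps \<epsilon> \<rho> - (LINT x|torus. psi \<epsilon> \<rho> x * h x) \<le> H_eps \<epsilon> ?\<rho>'"
    using H_eps_subgradient[OF \<rho> \<rho>h M \<epsilon>] by simp
  have 2: "H_eps \<epsilon> ?\<rho>' + (LINT x|torus. psi \<epsilon> ?\<rho>' x * h x) \<le> H_eps \<epsilon> \<rho>"
    using H_eps_subgradient[OF \<rho>h \<rho> M \<epsilon>] by simp
  have "(LINT x|torus. (psi \<epsilon> ?\<rho>' x - psi \<epsilon> \<rho> x) * h x) = (LINT x|torus. psi \<epsilon> ?\<rho>' x * h x) - (LINT x|torus. psi \<epsilon> \<rho> x * h x)"
    unfolding left_diff_distrib by (intro Bochner_Integration.integral_diff integrable_torus continuous_intros c)
  moreover have "\<bar>LINT x|torus. (psi \<epsilon> ?\<rho>' x - psi \<epsilon> \<rho> x) * h x\<bar> \<le> pot_const * (2 * N) * N"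
    by (intro integral_product_bound continuous_intros c psi_lipschitz[OF \<rho> h \<rho>h M \<epsilon>] size_leD(3)[OF h])
  ultimately show ?thesis using 1 2 by (simp add: abs_le_iff)
qed

lemma phi_add:
  assumes "\<rho> \<in> holder_space0 k \<alpha>" "h \<in> holder_space0 k \<alpha>"
  shows "phi (\<lambda>x. \<rho> x + h x) = (\<lambda>x. phi \<rho> x + phi h x)"
  by (simp add: fun_eq_iff phi_eq assms holder_space0_add embed_add potential_add[OF s(2)])

lemma phi_regular:
  assumes "\<rho> \<in> holder_space0 k \<alpha>"
  shows "C_k 3 (phi \<rho>)" "C_k 2 (phi \<rho>)" "C_k 1 (phi \<rho>)" "periodic (phi \<rho>)" "continuous_on UNIV (phi \<rho>)"
    "phi \<rho> differentiable (at x)"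
  unfolding phi_eq[OF assms]
  by (rule potential_C_3 potential_C_2 potential_periodic potential_cont potential_diffble C_k_pd2(5)[OF potential_C_3])+

lemma phi_bound:
  assumes "size_le N \<rho>"
  shows "\<bar>phi \<rho> x\<bar> \<le> pot_const * N" "\<bar>pd i (phi \<rho>) x\<bar> \<le> pot_const * N" "\<bar>pd i (pd j (phi \<rho>)) x\<bar> \<le> pot_const * N"
proof -
  have "pot_const * norm (fourier_embed s \<rho>) \<le> pot_const * N"
    by (intro mult_left_mono size_leD(2)[OF assms] pot_const_nonneg)
  then show "\<bar>phi \<rho> x\<bar> \<le> pot_const * N" "\<bar>pd i (phi \<rho>) x\<bar> \<le> pot_const * N" "\<bar>pd i (pd j (phi \<rho>)) x\<bar> \<le> pot_const * N"
    unfolding phi_eq[OF size_leD(1)[OF assms]]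
    using potential_abs[of "fourier_embed s \<rho>" x] potential_pd_abs[of i "fourier_embed s \<rho>" x] potential_pd2_abs[of i j "fourier_embed s \<rho>" x]
    by linarith+
qed

text \<open>\<open>H0\<close> is a quadratic form: Green's identity recognises the cross term as the
  derivative, and the remainder is half the Dirichlet integral of \<open>phi h\<close>. Its two
  gradient components cancel the factor 1/2.\<close>

lemma H0_remainder:
  assumes \<rho>: "\<rho> \<in> holder_space0 k \<alpha>" and h: "size_le N h"
  shows "\<bar>H0 (\<lambda>x. \<rho> x + h x) - H0 \<rho> - (LINT x|torus. - phi \<rho> x * h x)\<bar> \<le> (pot_const * N)\<^sup>2"
proof -
  note hh = size_leD(1)[OF h]
  let ?f = "phi \<rho>" and ?g = "phi h"
  have gc: "continuous_on UNIV (grad ?f)" "continuous_on UNIV (grad ?g)"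
    unfolding grad_eq by (intro continuous_on_vec_lambda C_k_1D(3) phi_regular \<rho> hh)+
  have "grad (\<lambda>x. ?f x + ?g x) x = grad ?f x + grad ?g x" for x
    by (simp add: vec_eq_iff grad_nth pd_add phi_regular(6) \<rho> hh)
  then have "(LINT x|torus. (norm (grad (\<lambda>x. ?f x + ?g x) x))\<^sup>2) = (LINT x|torus. ((norm (grad ?f x))\<^sup>2 + 2 * (grad ?f x \<bullet> grad ?g x)) + (norm (grad ?g x))\<^sup>2)"
    by (intro Bochner_Integration.integral_cong refl)
       (simp add: power2_norm_eq_inner inner_add_left inner_add_right inner_commute)
  also have "\<dots> = (LINT x|torus. (norm (grad ?f x))\<^sup>2) + 2 * (LINT x|torus. grad ?f x \<bullet> grad ?g x) + (LINT x|torus. (norm (grad ?g x))\<^sup>2)"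
    using gc by (simp add: integrable_torus continuous_intros)
  finally have e: "(LINT x|torus. (norm (grad (\<lambda>x. ?f x + ?g x) x))\<^sup>2) = \<dots>" .
  have "(LINT x|torus. - ?f x * h x) = - (LINT x|torus. ?f x * laplacian ?g x)"
    by (simp add: laplacian_phi hh)
  also have "\<dots> = (LINT x|torus. grad ?f x \<bullet> grad ?g x)"
    by (subst green_identity) (use phi_regular \<rho> hh in auto)
  finally have g: "(LINT x|torus. - ?f x * h x) = (LINT x|torus. grad ?f x \<bullet> grad ?g x)" .
  have "norm ((norm (grad ?g x))\<^sup>2) \<le> 2 * (pot_const * N)\<^sup>2" for x
  proof -
    have "(pd i ?g x)\<^sup>2 \<le> (pot_const * N)\<^sup>2" for i
      using phi_bound(2)[OF h, of i x] power_mono[of "\<bar>pd i ?g x\<bar>" "pot_const * N" 2] by simp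
    from this[of 1] this[of 2] show ?thesis
      by (simp add: power2_norm_eq_inner inner_vec_def grad_nth sum_UNIV_2 flip: power2_eq_square)
  qed
  then have "norm (LINT x|torus. (norm (grad ?g x))\<^sup>2) \<le> 2 * (pot_const * N)\<^sup>2"
    using gc by (intro integral_torus_norm_le continuous_intros)
  then have "(LINT x|torus. (norm (grad ?g x))\<^sup>2) \<le> 2 * (pot_const * N)\<^sup>2" by simp
  moreover have "0 \<le> (LINT x|torus. (norm (grad ?g x))\<^sup>2)" by simp
  moreover have "\<bar>1 / 2 * (a + 2 * b + c) - 1 / 2 * a - b\<bar> \<le> p" if "c \<le> 2 * p" "0 \<le> c" for a b c p :: real
    using that by (simp add: field_simps)
  ultimately show ?thesis unfolding g H0_def phi_add[OF \<rho> hh] e by blast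
qed

lemma H1_eq: "\<rho> \<in> holder_space0 k \<alpha> \<Longrightarrow> H1 \<rho> = 1 / 6 * det_form (phi \<rho>) (phi \<rho>) (phi \<rho>)"
  unfolding H1_def det_form_def
  by (simp add: polar_det_self phi_regular mult.left_commute[of _ "2::real"])

text \<open>\<open>H1\<close> is 1/6 of a totally symmetric cubic form, so its linear part is 1/2
  \<open>det_form\<close> of (\<open>phi h\<close>, \<open>phi \<rho>\<close>,
  \<open>phi \<rho>\<close>), the integral of \<open>phi h\<close> times the Hessian determinant of
  \<open>phi \<rho>\<close>. As that determinant is minus the Laplacian of
  \<open>chi \<rho>\<close>, Green's symmetry moves the Laplacian to \<open>phi h\<close> and gives
  - \<open>chi \<rho>\<close>.\<close>

lemma H1_remainder:
  assumes \<rho>: "size_le M \<rho>" and h: "size_le N h"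
  shows "\<bar>H1 (\<lambda>x. \<rho> x + h x) - H1 \<rho> - (LINT x|torus. - chi \<rho> x * h x)\<bar> \<le> pot_const ^ 3 * (2 * M + N) * N\<^sup>2"
proof -
  note rr = size_leD(1)[OF \<rho>] and hh = size_leD(1)[OF h]
  let ?f = "phi \<rho>" and ?g = "phi h"
  have chi: "C_k 2 (chi \<rho>)" "periodic (chi \<rho>)"
    unfolding chi_eq(1)[OF rr] by (rule potential_C_2 potential_periodic)+
  have "(LINT x|torus. - chi \<rho> x * h x) = - (LINT x|torus. chi \<rho> x * laplacian ?g x)"
    by (simp add: laplacian_phi hh)
  also have "\<dots> = - (LINT x|torus. ?g x * laplacian (chi \<rho>) x)"
    by (subst green_symmetric) (use chi phi_regular hh in auto)
  also have "\<dots> = (LINT x|torus. ?g x * det (hessian ?f x))"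
    by (simp add: chi_eq(2)[OF rr])
  also have "\<dots> = 1 / 2 * det_form ?g ?f ?f"
    unfolding det_form_def by (simp add: polar_det_self phi_regular rr mult.left_commute[of _ "2::real"])
  finally have L: "(LINT x|torus. - chi \<rho> x * h x) = 1 / 2 * det_form ?g ?f ?f" .
  have b1: "\<bar>det_form ?f ?g ?g\<bar> \<le> 4 * (pot_const * M) * (pot_const * N) * (pot_const * N)"
    by (rule det_form_bound) (use phi_regular phi_bound \<rho> h rr hh in auto)
  have b2: "\<bar>det_form ?g ?g ?g\<bar> \<le> 4 * (pot_const * N) * (pot_const * N) * (pot_const * N)"
    by (rule det_form_bound) (use phi_regular phi_bound h hh in auto)
  have "H1 (\<lambda>x. \<rho> x + h x) - H1 \<rho> - (LINT x|torus. - chi \<rho> x * h x) = 1 / 2 * det_form ?f ?g ?g + 1 / 6 * det_form ?g ?g ?g"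
    unfolding L H1_eq[OF holder_space0_add[OF rr hh]] H1_eq[OF rr] phi_add[OF rr hh]
      det_form_cube[OF phi_regular(1)[OF rr] phi_regular(4)[OF rr] phi_regular(1)[OF hh] phi_regular(4)[OF hh]]
    by (simp add: field_simps)
  also have "\<bar>\<dots>\<bar> \<le> 2 * (pot_const * M) * (pot_const * N) * (pot_const * N) + (pot_const * N) * (pot_const * N) * (pot_const * N)"
  proof -
    have "0 \<le> (pot_const * N) * (pot_const * N) * (pot_const * N)"
      using pot_const_nonneg size_le_nonneg[OF h] by simp
    then show ?thesis using b1 b2 unfolding abs_le_iff by linarith
  qed
  also have "\<dots> = pot_const ^ 3 * (2 * M + N) * N\<^sup>2" by (simp add: power2_eq_square power3_eq_cube algebra_simps)
  finally show ?thesis .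
qed

lemma chi_bounded:
  assumes "\<rho> \<in> holder_space0 k \<alpha>"
  shows "continuous_on UNIV (chi \<rho>)" "\<exists>G. \<forall>x. \<bar>chi \<rho> x\<bar> \<le> G" "C_k k (chi \<rho>)"
  unfolding chi_eq(1)[OF assms] using potential_cont potential_abs potential_C_k by blast+

lemma H0_derivative:
  assumes \<rho>: "\<rho> \<in> holder_space0 k \<alpha>"
  shows "has_functional_derivative k \<alpha> H0 \<rho> (\<lambda>x. - phi \<rho> x)"
proof (rule has_functional_derivativeI)
  show "continuous_on UNIV (\<lambda>x. - phi \<rho> x)" by (intro continuous_intros phi_regular \<rho>)
  show "\<bar>- phi \<rho> x\<bar> \<le> pot_const * norm (fourier_embed s \<rho>)" for x using potential_abs by (simp add: phi_eq[OF \<rho>])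
  show "0 < (1::real)" by simp
  fix h assume h: "h \<in> holder_space0 k \<alpha>"
  show "\<bar>H0 (\<lambda>x. \<rho> x + h x) - H0 \<rho> - (LINT x|torus. - phi \<rho> x * h x)\<bar>
      \<le> (pot_const * (embed_const + 1))\<^sup>2 * (holder_norm k \<alpha> h)\<^sup>2"
    using H0_remainder[OF \<rho> size_le_holder[OF h order_refl]] by (simp add: power_mult_distrib mult.assoc)
qed

lemma H1_derivative:
  assumes \<rho>: "\<rho> \<in> holder_space0 k \<alpha>"
  shows "has_functional_derivative k \<alpha> H1 \<rho> (\<lambda>x. - chi \<rho> x)"
proof -
  obtain G where G: "\<And>x. \<bar>chi \<rho> x\<bar> \<le> G" using chi_bounded(2)[OF \<rho>] by blast
  let ?e = "embed_const + 1"
  define M where "M = ?e * holder_norm k \<alpha> \<rho>"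
  have M: "size_le M \<rho>" unfolding M_def by (rule size_le_holder[OF \<rho> order_refl])
  have e0: "0 \<le> ?e" using embed_const_nonneg by simp
  show ?thesis
  proof (rule has_functional_derivativeI)
    show "continuous_on UNIV (\<lambda>x. - chi \<rho> x)" by (intro continuous_intros chi_bounded \<rho>)
    show "\<bar>- chi \<rho> x\<bar> \<le> G" for x using G by simp
    show "0 < (1::real)" by simp
    fix h assume h: "h \<in> holder_space0 k \<alpha>" and h1: "holder_norm k \<alpha> h < 1"
    \<comment> \<open>For perturbations of norm below 1 the cubic term is absorbed into the
      quadratic bound.\<close>
    have "?e * holder_norm k \<alpha> h \<le> ?e * 1" using h1 e0 by (intro mult_left_mono) auto
    then have "pot_const ^ 3 * (2 * M + ?e * holder_norm k \<alpha> h) * (?e * holder_norm k \<alpha> h)\<^sup>2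
       \<le> pot_const ^ 3 * (2 * M + ?e) * (?e * holder_norm k \<alpha> h)\<^sup>2"
      using pot_const_nonneg by (intro mult_right_mono mult_left_mono) auto
    then show "\<bar>H1 (\<lambda>x. \<rho> x + h x) - H1 \<rho> - (LINT x|torus. - chi \<rho> x * h x)\<bar>
        \<le> (pot_const ^ 3 * (2 * M + ?e) * ?e\<^sup>2) * (holder_norm k \<alpha> h)\<^sup>2"
      using H1_remainder[OF M size_le_holder[OF h order_refl]] unfolding power_mult_distrib mult.assoc by linarith
  qed
qed

text \<open>The smallness condition is imposed for R + 1 instead of R, so that perturbations of norm
  below 1 stay in the range where \<open>psi\<close> exists and is Lipschitz.\<close>

lemma H_eps_derivative:
  assumes \<rho>: "\<rho> \<in> holder_space0 k \<alpha>" "holder_norm k \<alpha> \<rho> \<le> R"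
    and M: "16 * \<bar>\<epsilon>\<bar> * ((embed_const + 1) * (R + 1)) \<le> 1" and \<epsilon>: "\<epsilon> \<noteq> 0"
  shows "has_functional_derivative k \<alpha> (H_eps \<epsilon>) \<rho> (\<lambda>x. - psi \<epsilon> \<rho> x)"
proof (rule has_functional_derivativeI)
  let ?e = "embed_const + 1"
  have e0: "0 \<le> ?e" using embed_const_nonneg by simp
  have s1: "size_le (?e * R) \<rho>" by (rule size_le_holder[OF \<rho>])
  then have sM: "size_le (?e * (R + 1)) \<rho>" by (rule size_le_mono) (use e0 in \<open>simp add: distrib_left\<close>)
  show "continuous_on UNIV (\<lambda>x. - psi \<epsilon> \<rho> x)" by (intro continuous_intros psi_cont(1)[OF sM M \<epsilon>])
  show "\<bar>- psi \<epsilon> \<rho> x\<bar> \<le> pot_const * (2 * (?e * (R + 1)))" for x using psi_cont(4)[OF sM M \<epsilon>] by simp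
  show "0 < (1::real)" by simp
  fix h assume h: "h \<in> holder_space0 k \<alpha>" and h1: "holder_norm k \<alpha> h < 1"
  have "size_le (?e * 1) h" by (rule size_le_holder[OF h]) (use h1 in simp)
  from size_le_add[OF s1 this] have \<rho>h: "size_le (?e * (R + 1)) (\<lambda>x. \<rho> x + h x)" by (simp add: distrib_left)
  show "\<bar>H_eps \<epsilon> (\<lambda>x. \<rho> x + h x) - H_eps \<epsilon> \<rho> - (LINT x|torus. - psi \<epsilon> \<rho> x * h x)\<bar>
      \<le> (pot_const * 2 * ?e\<^sup>2) * (holder_norm k \<alpha> h)\<^sup>2"
  proof -
    have "pot_const * (2 * (e * n)) * (e * n) = pot_const * 2 * e\<^sup>2 * n\<^sup>2" for e n by (simp add: power2_eq_square)
    then show ?thesis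
      using H_eps_remainder[OF sM size_le_holder[OF h order_refl] \<rho>h M \<epsilon>] by metis
  qed
qed

lemma derivative_expansion:
  assumes \<rho>: "size_le M \<rho>" and M: "16 * \<bar>\<epsilon>\<bar> * M \<le> 1" and \<epsilon>: "\<epsilon> \<noteq> 0"
    and h: "continuous_on UNIV h" "\<And>x. \<bar>h x\<bar> \<le> N"
  shows "\<bar>(LINT x|torus. - psi \<epsilon> \<rho> x * h x) - ((LINT x|torus. - phi \<rho> x * h x) + \<epsilon> * (LINT x|torus. - chi \<rho> x * h x))\<bar>
    \<le> pot_const * 64 * M ^ 3 * \<epsilon>\<^sup>2 * N"
proof -
  obtain r where r: "norm r \<le> 64 * M ^ 3 * \<epsilon>\<^sup>2" "\<And>x. psi \<epsilon> \<rho> x = phi \<rho> x + \<epsilon> * chi \<rho> x + potential s r x"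
    by (rule psi_expansion[OF \<rho> M \<epsilon>]) (rule that)
  note c = phi_regular(5)[OF size_leD(1)[OF \<rho>]] chi_bounded(1)[OF size_leD(1)[OF \<rho>]] potential_cont h(1)
  have "(LINT x|torus. - psi \<epsilon> \<rho> x * h x) = (LINT x|torus. (- phi \<rho> x * h x + \<epsilon> * (- chi \<rho> x * h x)) - potential s r x * h x)"
    by (intro Bochner_Integration.integral_cong refl) (simp add: r(2) algebra_simps)
  also have "\<dots> = (LINT x|torus. (- phi \<rho> x * h x + \<epsilon> * (- chi \<rho> x * h x))) - (LINT x|torus. potential s r x * h x)"
    by (intro Bochner_Integration.integral_diff integrable_torus continuous_intros c)
  also have "(LINT x|torus. (- phi \<rho> x * h x + \<epsilon> * (- chi \<rho> x * h x))) = (LINT x|torus. - phi \<rho> x * h x) + (LINT x|torus. \<epsilon> * (- chi \<rho> x * h x))"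
    by (intro Bochner_Integration.integral_add integrable_torus continuous_intros c)
  finally have "(LINT x|torus. - psi \<epsilon> \<rho> x * h x) - ((LINT x|torus. - phi \<rho> x * h x) + \<epsilon> * (LINT x|torus. - chi \<rho> x * h x)) = - (LINT x|torus. potential s r x * h x)"
    by simp
  moreover have "\<bar>LINT x|torus. potential s r x * h x\<bar> \<le> (pot_const * norm r) * N"
    by (intro integral_product_bound c potential_abs h)
  moreover have "(pot_const * norm r) * N \<le> (pot_const * (64 * M ^ 3 * \<epsilon>\<^sup>2)) * N"
    using order_trans[OF abs_ge_zero h(2)] by (intro mult_right_mono mult_left_mono r pot_const_nonneg) auto
  ultimately show ?thesis by (simp add: mult.assoc)
qed

text \<open>The base point of the path along which the expansion is summed up. For
  \<open>H_eps\<close> the zero function is the transport potential of the uniform density, with the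
  identity as optimal map.\<close>

lemma H_zero:
  assumes "\<epsilon> \<noteq> 0"
  shows "H_eps \<epsilon> (\<lambda>x. 0) = 0" "H0 (\<lambda>x. 0) = 0" "H1 (\<lambda>x. 0) = 0"
proof -
  have z: "(\<lambda>x. 0) \<in> holder_space0 k \<alpha>"
  proof (rule holder_space0I[of 0])
    show "hoelder_bd k \<alpha> 0 (\<lambda>x. 0)"
      using hoelder_bd_fseries[of \<alpha> k "\<lambda>_. 0"] \<alpha> by (simp add: fseries_def[abs_def] wsummable_def wnorm_def)
  qed (auto simp: periodic_def)
  have "phi (\<lambda>x. 0) = (\<lambda>x. phi (\<lambda>x. 0) x + phi (\<lambda>x. 0) x)" using phi_add[OF z z] by simp
  then have p: "phi (\<lambda>x. 0) = (\<lambda>x. 0)" by (simp add: fun_eq_iff)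
  have "grad (\<lambda>x. 0) x = 0" for x by (simp add: vec_eq_iff grad_nth)
  then show "H0 (\<lambda>x. 0) = 0" "H1 (\<lambda>x. 0) = 0" by (simp_all add: H0_def H1_def p)
  have j: "jac (\<lambda>x. 0) = (\<lambda>x. 1)"
  proof -
    have z: "pd i (\<lambda>x. 0) = (\<lambda>x. 0)" for i by (simp add: fun_eq_iff)
    show ?thesis unfolding jac_def[abs_def] z by simp
  qed
  obtain l where "transport_potential (\<lambda>x. 0) l"
    by (rule jac_pos_imp_transport_potential[of "\<lambda>x. 0"]) (auto simp: j periodic_def intro: C_k_const)
  then interpret transport_potential "\<lambda>x. 0" l .
  have "transport_cost = 0" unfolding transport_cost_def by (simp add: \<open>\<And>x. grad (\<lambda>x. 0) x = 0\<close>)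
  then show "H_eps \<epsilon> (\<lambda>x. 0) = 0" using W2_eq_transport_cost by (simp add: H_eps_def j)
qed

text \<open>The error \<open>G\<close> along t \<rho> has increments made of two parts: the
  discrepancy of the derivatives, of order \<epsilon>^2 and linear in the step, and Taylor
  remainders, not small in \<epsilon> but quadratic in the step. By \<open>increment_bound\<close>
  only the first part survives; its perturbation size |t' - t| M raises M^3 to M^4.\<close>

lemma H_eps_expansion:
  assumes \<rho>: "size_le M \<rho>" and M: "16 * \<bar>\<epsilon>\<bar> * M \<le> 1" and \<epsilon>: "\<epsilon> \<noteq> 0"
  shows "\<bar>H_eps \<epsilon> \<rho> - (H0 \<rho> + \<epsilon> * H1 \<rho>)\<bar> \<le> pot_const * 64 * M ^ 4 * \<epsilon>\<^sup>2"
proof -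
  have M0: "0 \<le> M" by (rule size_le_nonneg[OF \<rho>])
  define G where "G t = H_eps \<epsilon> (\<lambda>x. t * \<rho> x) - (H0 (\<lambda>x. t * \<rho> x) + \<epsilon> * H1 (\<lambda>x. t * \<rho> x))" for t
  have "\<bar>G 1 - G 0\<bar> \<le> pot_const * 64 * M ^ 4 * \<epsilon>\<^sup>2"
  proof (rule increment_bound)
    fix t t' :: real assume t: "0 \<le> t" "t \<le> 1" "0 \<le> t'" "t' \<le> 1"
    define N where "N = \<bar>t' - t\<bar> * M"
    have N: "N \<le> M" unfolding N_def using t M0 by (simp add: mult_le_cancel_right2 abs_le_iff)
    have scale: "size_le M (\<lambda>x. u * \<rho> x)" if "0 \<le> u" "u \<le> 1" for u
      by (rule size_le_mono[OF size_le_cmult[OF \<rho>]]) (use that M0 in \<open>simp add: mult_le_cancel_right1 mult_left_le_one_le\<close>)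
    let ?\<sigma> = "\<lambda>x. t * \<rho> x" and ?h = "\<lambda>x. (t' - t) * \<rho> x"
    have sh: "size_le N ?h" unfolding N_def by (rule size_le_cmult[OF \<rho>])
    have add: "(\<lambda>x. ?\<sigma> x + ?h x) = (\<lambda>x. t' * \<rho> x)" by (simp add: fun_eq_iff algebra_simps)
    note s1 = scale[OF t(1,2)] and s2 = scale[OF t(3,4)]
    have r: "\<bar>H_eps \<epsilon> (\<lambda>x. t' * \<rho> x) - H_eps \<epsilon> ?\<sigma> - (LINT x|torus. - psi \<epsilon> ?\<sigma> x * ?h x)\<bar> \<le> pot_const * (2 * N) * N"
      using H_eps_remainder[OF s1 sh _ M \<epsilon>] s2 unfolding add by blast
    have r0: "\<bar>H0 (\<lambda>x. t' * \<rho> x) - H0 ?\<sigma> - (LINT x|torus. - phi ?\<sigma> x * ?h x)\<bar> \<le> (pot_const * N)\<^sup>2"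
      using H0_remainder[OF size_leD(1)[OF s1] sh] unfolding add .
    have r1: "\<bar>H1 (\<lambda>x. t' * \<rho> x) - H1 ?\<sigma> - (LINT x|torus. - chi ?\<sigma> x * ?h x)\<bar> \<le> pot_const ^ 3 * (3 * M) * N\<^sup>2"
    proof -
      have "pot_const ^ 3 * (2 * M + N) * N\<^sup>2 \<le> pot_const ^ 3 * (3 * M) * N\<^sup>2"
        using N pot_const_nonneg by (intro mult_right_mono mult_left_mono) auto
      then show ?thesis using H1_remainder[OF s1 sh] unfolding add by linarith
    qed
    have r1': "\<bar>\<epsilon> * H1 (\<lambda>x. t' * \<rho> x) - \<epsilon> * H1 ?\<sigma> - \<epsilon> * (LINT x|torus. - chi ?\<sigma> x * ?h x)\<bar> \<le> \<bar>\<epsilon>\<bar> * (pot_const ^ 3 * (3 * M) * N\<^sup>2)"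
      unfolding right_diff_distrib[symmetric] abs_mult by (intro mult_left_mono r1) simp
    have d: "\<bar>(LINT x|torus. - psi \<epsilon> ?\<sigma> x * ?h x) - ((LINT x|torus. - phi ?\<sigma> x * ?h x) + \<epsilon> * (LINT x|torus. - chi ?\<sigma> x * ?h x))\<bar>
       \<le> pot_const * 64 * M ^ 3 * \<epsilon>\<^sup>2 * N"
      by (rule derivative_expansion[OF s1 M \<epsilon> size_leD(4)[OF sh] size_leD(3)[OF sh]])
    have "\<bar>G t' - G t\<bar> \<le> pot_const * 64 * M ^ 3 * \<epsilon>\<^sup>2 * N + (pot_const * (2 * N) * N + (pot_const * N)\<^sup>2 + \<bar>\<epsilon>\<bar> * (pot_const ^ 3 * (3 * M) * N\<^sup>2))"
      using r r0 r1' d unfolding G_def abs_le_iff by linarith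
    also have "\<dots> = pot_const * 64 * M ^ 4 * \<epsilon>\<^sup>2 * \<bar>t' - t\<bar> + (2 * pot_const + pot_const\<^sup>2 + \<bar>\<epsilon>\<bar> * pot_const ^ 3 * 3 * M) * N\<^sup>2"
      by (simp add: N_def power2_eq_square algebra_simps eval_nat_numeral)
    also have "N\<^sup>2 = M\<^sup>2 * (t' - t)\<^sup>2" by (simp add: N_def power_mult_distrib)
    finally show "\<bar>G t' - G t\<bar> \<le> pot_const * 64 * M ^ 4 * \<epsilon>\<^sup>2 * \<bar>t' - t\<bar> +
        ((2 * pot_const + pot_const\<^sup>2 + \<bar>\<epsilon>\<bar> * pot_const ^ 3 * 3 * M) * M\<^sup>2) * (t' - t)\<^sup>2"
      by (simp only: mult.assoc)
  qed
  moreover have "G 0 = 0" by (simp add: G_def H_zero[OF \<epsilon>])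
  ultimately show ?thesis by (simp add: G_def)
qed

section \<open>The vector field and the final assembly\<close>

lemma bracket_eq: "bracket f g x = pd 1 f x * pd 2 g x - pd 2 f x * pd 1 g x"
  by (simp add: bracket_def grad_perp_def grad_def inner_vec_def sum_UNIV_2)

lemma bracket_expansion:
  assumes \<rho>: "size_le M \<rho>" "holder_norm k \<alpha> \<rho> \<le> R" and M: "16 * \<bar>\<epsilon>\<bar> * M \<le> 1" and \<epsilon>: "\<epsilon> \<noteq> 0"
  shows "\<exists>F\<in>holder_space (k - 1) \<alpha>.
    (\<forall>x. - bracket (psi \<epsilon> \<rho>) \<rho> x = - bracket (phi \<rho>) \<rho> x - \<epsilon> * bracket (chi \<rho>) \<rho> x + F x) \<and>
    holder_norm (k - 1) \<alpha> F \<le> pd_count (k - 1) * (2 * (2 * 4 ^ (k - 1) * (pot_const * (64 * M ^ 3)) * R)) * \<epsilon>\<^sup>2"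
proof -
  note rr = size_leD(1)[OF \<rho>(1)]
  obtain r where r: "norm r \<le> 64 * M ^ 3 * \<epsilon>\<^sup>2" "\<And>x. psi \<epsilon> \<rho> x = phi \<rho> x + \<epsilon> * chi \<rho> x + potential s r x"
    by (rule psi_expansion[OF \<rho>(1) M \<epsilon>]) (rule that)
  let ?r = "potential s r"
  define K where "K = pot_const * (64 * M ^ 3 * \<epsilon>\<^sup>2)"
  \<comment> \<open>Minus the bracket of the remainder potential with \<rho>; the bracket is linear
    in its first argument, so this is the exact error.\<close>
  define F where "F x = pd 2 ?r x * pd 1 \<rho> x + (- 1) * (pd 1 ?r x * pd 2 \<rho> x)" for x
  have kS: "k = Suc (k - 1)" using k by simp
  have "hoelder_bd k \<alpha> K ?r"
    unfolding K_def by (rule hoelder_bd_mono[OF potential_bd]) (intro mult_left_mono r pot_const_nonneg)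
  then have r': "hoelder_bd (k - 1) \<alpha> K (pd i ?r)" for i using kS by (metis hoelder_bd.simps(2))
  have "hoelder_bd k \<alpha> R \<rho>" by (rule hoelder_bd_mono[OF holder_space0D(5)[OF rr] \<rho>(2)])
  then have \<rho>': "hoelder_bd (k - 1) \<alpha> R (pd i \<rho>)" for i using kS by (metis hoelder_bd.simps(2))
  have prod: "hoelder_bd (k - 1) \<alpha> (2 * 4 ^ (k - 1) * K * R) (\<lambda>x. pd i ?r x * pd j \<rho> x)" for i j
    using \<alpha> by (intro hoelder_bd_mult r' \<rho>') auto
  have "hoelder_bd (k - 1) \<alpha> (2 * 4 ^ (k - 1) * K * R + \<bar>- 1\<bar> * (2 * 4 ^ (k - 1) * K * R)) F"
    unfolding F_def[abs_def] by (intro hoelder_bd_add hoelder_bd_cmult prod)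
  then have Fb: "hoelder_bd (k - 1) \<alpha> (2 * (2 * 4 ^ (k - 1) * K * R)) F" by (simp add: mult_ac)
  have "periodic F"
    using periodicD[OF periodic_pd[OF potential_periodic]] periodicD[OF periodic_pd[OF holder_space0D(2)[OF rr]]]
    by (simp add: periodic_def F_def)
  from hoelder_bd_imp_holder_norm[OF Fb this \<alpha>(1)]
  have F: "F \<in> holder_space (k - 1) \<alpha>" "holder_norm (k - 1) \<alpha> F \<le> pd_count (k - 1) * (2 * (2 * 4 ^ (k - 1) * K * R))" by auto
  have "pd i (psi \<epsilon> \<rho>) x = pd i (phi \<rho>) x + \<epsilon> * pd i (chi \<rho>) x + pd i ?r x" for i x
  proof -
    have d: "phi \<rho> differentiable (at x)" "chi \<rho> differentiable (at x)" "?r differentiable (at x)"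
      unfolding phi_eq[OF rr] chi_eq(1)[OF rr] by (rule potential_diffble)+
    have "psi \<epsilon> \<rho> = (\<lambda>x. (phi \<rho> x + \<epsilon> * chi \<rho> x) + ?r x)" by (simp add: fun_eq_iff r(2))
    then show ?thesis using d by (simp add: pd_add pd_cmult differentiable_add differentiable_mult)
  qed
  then have "- bracket (psi \<epsilon> \<rho>) \<rho> x = - bracket (phi \<rho>) \<rho> x - \<epsilon> * bracket (chi \<rho>) \<rho> x + F x" for x
    by (simp add: bracket_eq F_def algebra_simps)
  then show ?thesis using F unfolding K_def by (intro bexI[of _ F] conjI allI) (simp_all add: mult_ac)
qed

end

theorem theorem4p3:
  fixes k :: nat and \<alpha> :: real and B :: "(real^2 \<Rightarrow> real) set"
  assumes "k \<ge> 3" and "0 < \<alpha>" and "\<alpha> < 1"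
    and "B \<subseteq> holder_space0 k \<alpha>" and "bdd_above (holder_norm k \<alpha> ` B)"
  shows
    "(\<forall>\<rho>\<in>holder_space0 k \<alpha>.
        has_functional_derivative k \<alpha> H0 \<rho> (\<lambda>x. - phi \<rho> x) \<and>
        has_functional_derivative k \<alpha> H1 \<rho> (\<lambda>x. - chi \<rho> x)) \<and>
     (\<exists>\<epsilon>\<^sub>0>0. \<exists>C. \<forall>\<epsilon>. \<epsilon> \<noteq> 0 \<and> \<bar>\<epsilon>\<bar> < \<epsilon>\<^sub>0 \<longrightarrow>
        (\<forall>\<rho>\<in>B. \<bar>H_eps \<epsilon> \<rho> - (H0 \<rho> + \<epsilon> * H1 \<rho>)\<bar> \<le> C * \<epsilon>\<^sup>2) \<and>
        (\<forall>\<rho>\<in>B. \<exists>D D0 D1.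
           has_frechet_derivative_at k \<alpha> (H_eps \<epsilon>) \<rho> D \<and>
           has_frechet_derivative_at k \<alpha> H0 \<rho> D0 \<and>
           has_frechet_derivative_at k \<alpha> H1 \<rho> D1 \<and>
           (\<forall>h\<in>holder_space0 k \<alpha>.
              \<bar>D h - (D0 h + \<epsilon> * D1 h)\<bar> \<le> C * \<epsilon>\<^sup>2 * holder_norm k \<alpha> h)) \<and>
        (\<forall>\<rho>\<in>B. \<exists>R\<in>holder_space (k - 1) \<alpha>.
           (\<forall>x. - bracket (psi \<epsilon> \<rho>) \<rho> x
              = - bracket (phi \<rho>) \<rho> x - \<epsilon> * bracket (chi \<rho>) \<rho> x + R x) \<and>
           holder_norm (k - 1) \<alpha> R \<le> C * \<epsilon>\<^sup>2) \<and>
        (\<forall>I \<rho> \<rho>'. is_interval I \<and> (\<forall>t\<in>I. \<rho> t \<in> B) \<and> semigeostrophic_solution \<epsilon> I \<rho> \<rho>' \<longrightarrow>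
           (\<forall>t\<in>I. \<exists>R\<in>holder_space (k - 1) \<alpha>.
              (\<forall>x. \<rho>' t x + bracket (phi (\<rho> t)) (\<rho> t) x
                 + \<epsilon> * bracket (chi (\<rho> t)) (\<rho> t) x = R x) \<and>
              holder_norm (k - 1) \<alpha> R \<le> C * \<epsilon>\<^sup>2)))"
proof -
  interpret hoelder_setting k \<alpha> by unfold_locales (use assms in auto)
  obtain R0 where R0: "\<And>\<rho>. \<rho> \<in> B \<Longrightarrow> holder_norm k \<alpha> \<rho> \<le> R0"
    using assms(5) by (auto simp: bdd_above_def)
  \<comment> \<open>The maximum keeps the bound nonnegative even if \<open>B\<close> is
    empty.\<close>
  define R where "R = max R0 0"
  have R: "\<And>\<rho>. \<rho> \<in> B \<Longrightarrow> holder_norm k \<alpha> \<rho> \<le> R" "0 \<le> R" using R0 by (auto simp: R_def le_max_iff_disj)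
  \<comment> \<open>One unit beyond the bound on \<open>B\<close>, which is the room that
    \<open>H_eps_derivative\<close> needs for perturbations of norm below 1; the threshold below
    then makes 16 |\<epsilon>| M <= 1 for all densities in \<open>B\<close> at once.\<close>
  define M where "M = (embed_const + 1) * (R + 1)"
  have Mpos: "0 < M" unfolding M_def using embed_const_nonneg R(2) by (intro mult_pos_pos) auto
  have size: "size_le M \<rho>" if "\<rho> \<in> B" for \<rho>
    unfolding M_def by (rule size_le_holder) (use that assms(4) R(1)[OF that] in auto)
  define \<epsilon>\<^sub>0 where "\<epsilon>\<^sub>0 = 1 / (16 * M)"
  define C1 C2 C3 where "C1 = pot_const * 64 * M ^ 4" and "C2 = pot_const * 64 * M ^ 3"
    and "C3 = pd_count (k - 1) * (2 * (2 * 4 ^ (k - 1) * (pot_const * (64 * M ^ 3)) * R))"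
  have C0: "0 \<le> C1" "0 \<le> C2" "0 \<le> C3"
    unfolding C1_def C2_def C3_def pd_count_def using pot_const_nonneg Mpos R(2) by simp_all
  define C where "C = C1 + C2 + C3"
  have C: "C1 \<le> C" "C2 \<le> C" "C3 \<le> C" using C0 by (auto simp: C_def)
  have main: "(\<forall>\<rho>\<in>B. \<bar>H_eps \<epsilon> \<rho> - (H0 \<rho> + \<epsilon> * H1 \<rho>)\<bar> \<le> C * \<epsilon>\<^sup>2) \<and>
        (\<forall>\<rho>\<in>B. \<exists>D D0 D1.
           has_frechet_derivative_at k \<alpha> (H_eps \<epsilon>) \<rho> D \<and>
           has_frechet_derivative_at k \<alpha> H0 \<rho> D0 \<and>
           has_frechet_derivative_at k \<alpha> H1 \<rho> D1 \<and>
           (\<forall>h\<in>holder_space0 k \<alpha>.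
              \<bar>D h - (D0 h + \<epsilon> * D1 h)\<bar> \<le> C * \<epsilon>\<^sup>2 * holder_norm k \<alpha> h)) \<and>
        (\<forall>\<rho>\<in>B. \<exists>R\<in>holder_space (k - 1) \<alpha>.
           (\<forall>x. - bracket (psi \<epsilon> \<rho>) \<rho> x
              = - bracket (phi \<rho>) \<rho> x - \<epsilon> * bracket (chi \<rho>) \<rho> x + R x) \<and>
           holder_norm (k - 1) \<alpha> R \<le> C * \<epsilon>\<^sup>2) \<and>
        (\<forall>I \<rho> \<rho>'. is_interval I \<and> (\<forall>t\<in>I. \<rho> t \<in> B) \<and> semigeostrophic_solution \<epsilon> I \<rho> \<rho>' \<longrightarrow>
           (\<forall>t\<in>I. \<exists>R\<in>holder_space (k - 1) \<alpha>.
              (\<forall>x. \<rho>' t x + bracket (phi (\<rho> t)) (\<rho> t) x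
                 + \<epsilon> * bracket (chi (\<rho> t)) (\<rho> t) x = R x) \<and>
              holder_norm (k - 1) \<alpha> R \<le> C * \<epsilon>\<^sup>2))"
    if \<epsilon>: "\<epsilon> \<noteq> 0 \<and> \<bar>\<epsilon>\<bar> < \<epsilon>\<^sub>0" for \<epsilon>
  proof -
    have eM: "16 * \<bar>\<epsilon>\<bar> * M \<le> 1" and e0: "\<epsilon> \<noteq> 0"
      using \<epsilon> Mpos by (auto simp: \<epsilon>\<^sub>0_def field_simps)
    have 1: "\<bar>H_eps \<epsilon> \<rho> - (H0 \<rho> + \<epsilon> * H1 \<rho>)\<bar> \<le> C * \<epsilon>\<^sup>2" if "\<rho> \<in> B" for \<rho>
      using H_eps_expansion[OF size[OF that] eM e0] mult_right_mono[OF C(1), of "\<epsilon>\<^sup>2"] unfolding C1_def by simp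
    have 2: "\<exists>D D0 D1. has_frechet_derivative_at k \<alpha> (H_eps \<epsilon>) \<rho> D \<and> has_frechet_derivative_at k \<alpha> H0 \<rho> D0 \<and>
        has_frechet_derivative_at k \<alpha> H1 \<rho> D1 \<and>
        (\<forall>h\<in>holder_space0 k \<alpha>. \<bar>D h - (D0 h + \<epsilon> * D1 h)\<bar> \<le> C * \<epsilon>\<^sup>2 * holder_norm k \<alpha> h)" if "\<rho> \<in> B" for \<rho>
    proof (intro exI conjI ballI)
      have \<rho>: "\<rho> \<in> holder_space0 k \<alpha>" using that assms(4) by auto
      show "has_frechet_derivative_at k \<alpha> (H_eps \<epsilon>) \<rho> (\<lambda>h. LINT x|torus. - psi \<epsilon> \<rho> x * h x)"
        using H_eps_derivative[OF \<rho> R(1)[OF that] eM[unfolded M_def] e0] by (simp add: has_functional_derivative_def)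
      show "has_frechet_derivative_at k \<alpha> H0 \<rho> (\<lambda>h. LINT x|torus. - phi \<rho> x * h x)"
        using H0_derivative[OF \<rho>] by (simp add: has_functional_derivative_def)
      show "has_frechet_derivative_at k \<alpha> H1 \<rho> (\<lambda>h. LINT x|torus. - chi \<rho> x * h x)"
        using H1_derivative[OF \<rho>] by (simp add: has_functional_derivative_def)
      fix h assume h: "h \<in> holder_space0 k \<alpha>"
      have "C2 * \<epsilon>\<^sup>2 * holder_norm k \<alpha> h \<le> C * \<epsilon>\<^sup>2 * holder_norm k \<alpha> h"
        by (intro mult_right_mono C holder_space0D(6)[OF h]) simp
      then show "\<bar>(LINT x|torus. - psi \<epsilon> \<rho> x * h x) - ((LINT x|torus. - phi \<rho> x * h x) + \<epsilon> * (LINT x|torus. - chi \<rho> x * h x))\<bar>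
          \<le> C * \<epsilon>\<^sup>2 * holder_norm k \<alpha> h"
        using derivative_expansion[OF size[OF that] eM e0 holder_space0D(3)[OF h] holder_space0D(7)[OF h]]
        unfolding C2_def by linarith
    qed
    have 3: "\<exists>R\<in>holder_space (k - 1) \<alpha>.
           (\<forall>x. - bracket (psi \<epsilon> \<rho>) \<rho> x = - bracket (phi \<rho>) \<rho> x - \<epsilon> * bracket (chi \<rho>) \<rho> x + R x) \<and>
           holder_norm (k - 1) \<alpha> R \<le> C * \<epsilon>\<^sup>2" if "\<rho> \<in> B" for \<rho>
      using bracket_expansion[OF size[OF that] R(1)[OF that] eM e0] mult_right_mono[OF C(3), of "\<epsilon>\<^sup>2"]
      unfolding C3_def by (meson order_trans zero_le_power2)
    have 4: "\<exists>R\<in>holder_space (k - 1) \<alpha>.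
              (\<forall>x. \<rho>' t x + bracket (phi (\<rho> t)) (\<rho> t) x + \<epsilon> * bracket (chi (\<rho> t)) (\<rho> t) x = R x) \<and>
              holder_norm (k - 1) \<alpha> R \<le> C * \<epsilon>\<^sup>2"
      if I: "\<forall>t\<in>I. \<rho> t \<in> B" and sol: "semigeostrophic_solution \<epsilon> I \<rho> \<rho>'" and t: "t \<in> I" for I \<rho> \<rho>' t
    proof -
      obtain F where F: "F \<in> holder_space (k - 1) \<alpha>" "holder_norm (k - 1) \<alpha> F \<le> C * \<epsilon>\<^sup>2"
        "\<And>x. - bracket (psi \<epsilon> (\<rho> t)) (\<rho> t) x = - bracket (phi (\<rho> t)) (\<rho> t) x - \<epsilon> * bracket (chi (\<rho> t)) (\<rho> t) x + F x"
        using 3[of "\<rho> t"] I t by blast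
      have "\<rho>' t x + bracket (psi \<epsilon> (\<rho> t)) (\<rho> t) x = 0" for x
        using sol t by (simp add: semigeostrophic_solution_def)
      then have "\<rho>' t x = - bracket (psi \<epsilon> (\<rho> t)) (\<rho> t) x" for x by (simp add: eq_neg_iff_add_eq_0)
      then have "\<rho>' t x + bracket (phi (\<rho> t)) (\<rho> t) x + \<epsilon> * bracket (chi (\<rho> t)) (\<rho> t) x = F x" for x
        by (simp add: F(3))
      then show ?thesis using F(1,2) by blast
    qed
    show ?thesis
    proof (rule conjI[OF _ conjI[OF _ conjI]])
      show "\<forall>\<rho>\<in>B. \<bar>H_eps \<epsilon> \<rho> - (H0 \<rho> + \<epsilon> * H1 \<rho>)\<bar> \<le> C * \<epsilon>\<^sup>2" using 1 by (rule ballI)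
    qed (rule ballI, erule 2, rule ballI, erule 3, intro allI impI ballI, elim conjE, rule 4)
  qed
  have "0 < \<epsilon>\<^sub>0" using Mpos by (simp add: \<epsilon>\<^sub>0_def)
  show ?thesis
  proof (rule conjI)
    show "\<forall>\<rho>\<in>holder_space0 k \<alpha>. has_functional_derivative k \<alpha> H0 \<rho> (\<lambda>x. - phi \<rho> x) \<and>
        has_functional_derivative k \<alpha> H1 \<rho> (\<lambda>x. - chi \<rho> x)"
      by (intro ballI conjI H0_derivative H1_derivative)
  qed (rule exI[of _ \<epsilon>\<^sub>0], rule conjI, rule \<open>0 < \<epsilon>\<^sub>0\<close>, rule exI[of _ C], intro allI impI, rule main)
qed

end
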